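(* Let $\{\Phi_a\}_{a\in I}$ be a reflection-symmetric rotational variable-radius family of annuli in $\mathbb{M}^3_\kappa$, with radius function $r$, such that, for every $a$, $\varphi_a\not\equiv0$ and $A_a(\eta,\eta)\ne0$ (everywhere) on $\partial\Sigma$. Then, for every $a$, $$\dim\mathcal{K}_0^{\mathrm{ev}}(\Sigma_a)=\begin{cases}1,& r'(a)=0,\\ 0,& r'(a)\ne0;\end{cases}$$ equivalently, $a\mapsto\dim\mathcal{K}_0^{\mathrm{ev}}(\Sigma_a)$ is the indicator function of the critical set $\{r'=0\}$ of the radius map.
   Context: For $\kappa\in\{-1,0,1\}$, $\mathbb{M}^{3}_\kappa$ is the complete simply connected 3-dimensional space form of constant sectional curvature $\kappa$, with Levi-Civita connection $\overline\nabla$. Fix $p_0$, let $\rho=\operatorname{dist}(p_0,\cdot)$, $B(r)$ the closed geodesic ball of radius $r>0$ centred at $p_0$ ($r<\pi$ if $\kappa=1$), $S(r)=\partial B(r)$, and $\operatorname{ct}_\kappa(t)=\coth t,\ 1/t,\ \cot t$ for $\kappa=-1,0,1$. A free boundary minimal immersion in $B(r)$ is a two-sided minimal immersion $\Phi:\Sigma\to B(r)$ of a compact surface with nonempty boundary, with $\Phi(\partial\Sigma)\subset S(r)$ and outward unit conormal $\eta$ of $\partial\Sigma$ in $\Sigma$ equal to $\partial_\rho$ along $\partial\Sigma$. $A(X,Y)=\langle\overline\nabla_X\nu,Y\rangle$ for a unit normal $\nu$. A variable-radius family (of annuli) is a smooth map $\Phi:I\times\Sigma\to\mathbb{M}^3_\kappa$,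 $I\subset\mathbb{R}$ an interval, $\Sigma$ an annulus, such that every $\Phi_a=\Phi(a,\cdot)$ is a free boundary minimal immersion in $B(r(a))$ (all balls centred at $p_0$), with $r:I\to(0,\infty)$ smooth ($r<\pi$ if $\kappa=1$). Unit normals $\nu_a$ are chosen smoothly in $a$; $\varphi_a=\langle\partial_a\Phi_a,\nu_a\rangle$; $\Sigma_a$ is $\Sigma$ with the immersion $\Phi_a$. The family is rotational if there is a geodesic $\ell$ through $p_0$ such that every $\Phi_a$ is equivariant with respect to the group $SO(2)$ of rotations about $\ell$; coordinates on $\Sigma$ are $(s,\theta)$, with $s$ the arclength parameter of the profile (up to an $a$-dependent constant rescaling making the domain, e.g. $[-1,1]\times\mathbb{S}^1$, independent of $a$), symmetric about $s=0$, and $\theta$ the rotation angle. It is reflection-symmetric if there is an orientation-reversing isometry $\sigma$ of $\mathbb{M}^3_\kappa$ fixing $p_0$ with $\sigma\circ\Phi_a(s,\theta)=\Phi_a(-s,\theta)$ for all $a,s,\theta$. The Jacobi--Robin kernel is $\mathcal{K}(\Sigma_a,r(a))=\{u\in C^\infty(\Sigma):\Delta u+(|A_a|^2+2\kappa)u=0,\ \partial_\eta u-\operatorname{ct}_\kappa(r(a))u=0\text{ on }\partial\Sigma\}$, and $\mathcal{K}_0^{\mathrm{ev}}(\Sigma_a)$ is its subspace of functions independent of $\theta$ and even in $s$. *)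

theory Defs
  imports "HOL-Analysis.Analysis" "HOL-Library.Function_Algebras"
begin

section \<open>Pointwise real vector space structure on functions\<close>

text \<open>This makes the library notions \<^const>\<open>span\<close> and \<^const>\<open>dim\<close> available for spaces of
  real-valued functions.\<close>

instantiation "fun" :: (type, real_vector) real_vector
begin

definition scaleR_fun :: "real \<Rightarrow> ('a \<Rightarrow> 'b) \<Rightarrow> 'a \<Rightarrow> 'b"
  where "scaleR_fun c f = (\<lambda>x. c *\<^sub>R f x)"

instance
  by standard (simp_all add: scaleR_fun_def fun_eq_iff scaleR_add_right scaleR_add_left)

end

section \<open>Smooth maps\<close>

text \<open>\<open>Ck_on k U f\<close> is meant for open \<open>U\<close>. As the domain type is finite-dimensional, it says that
  \<open>f\<close> is of class \<open>C\<^sup>k\<close>. Smoothness on an arbitrary set means existence of a smooth extension to an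
  open neighbourhood; this covers boundary points and end points of intervals.\<close>

fun Ck_on :: "nat \<Rightarrow> 'a::euclidean_space set \<Rightarrow> ('a \<Rightarrow> 'b::real_normed_vector) \<Rightarrow> bool" where
  "Ck_on 0 U f \<longleftrightarrow> continuous_on U f"
| "Ck_on (Suc k) U f \<longleftrightarrow>
     (\<exists>f'. (\<forall>x\<in>U. (f has_derivative f' x) (at x)) \<and> (\<forall>v. Ck_on k U (\<lambda>x. f' x v)))"

definition smooth_on :: "'a::euclidean_space set \<Rightarrow> ('a \<Rightarrow> 'b::real_normed_vector) \<Rightarrow> bool" where
  "smooth_on S f \<longleftrightarrow>
     (\<exists>U g. open U \<and> S \<subseteq> U \<and> (\<forall>k. Ck_on k U g) \<and> (\<forall>x\<in>S. g x = f x))"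

section \<open>The space forms of curvature \<open>-1\<close>, \<open>0\<close>, \<open>1\<close>\<close>

text \<open>The parameter \<open>\<kappa>\<close> is one of \<open>-1\<close>, \<open>0\<close>, \<open>1\<close>. With coordinate 1 as the distinguished one,
  \<open>space_form \<kappa>\<close> is the upper sheet of the hyperboloid in Minkowski space, the affine hyperplane
  \<open>x\<^sub>1 = 1\<close>, or the unit sphere. The Riemannian metric is the restriction of \<open>sf_inner \<kappa>\<close> to the
  tangent spaces; it is positive definite there in all three cases.\<close>

definition sf_inner :: "real \<Rightarrow> real^4 \<Rightarrow> real^4 \<Rightarrow> real" where
  "sf_inner \<kappa> x y = \<kappa> * x$1 * y$1 + x$2 * y$2 + x$3 * y$3 + x$4 * y$4"

definition sf_quad :: "real \<Rightarrow> real^4 \<Rightarrow> real^4 \<Rightarrow> real" where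
  "sf_quad \<kappa> x y = x$1 * y$1 + \<kappa> * (x$2 * y$2 + x$3 * y$3 + x$4 * y$4)"

definition space_form :: "real \<Rightarrow> (real^4) set" where
  "space_form \<kappa> = {x. sf_quad \<kappa> x x = 1 \<and> (\<kappa> \<le> 0 \<longrightarrow> x$1 > 0)}"

definition tangent_space :: "real \<Rightarrow> real^4 \<Rightarrow> (real^4) set" where
  "tangent_space \<kappa> x = {v. sf_quad \<kappa> x v = 0}"

text \<open>Riemannian distance.\<close>

definition sf_dist :: "real \<Rightarrow> real^4 \<Rightarrow> real^4 \<Rightarrow> real" where
  "sf_dist \<kappa> x y =
     (if \<kappa> = 1 then arccos (sf_inner \<kappa> x y)
      else if \<kappa> = -1 then arcosh (- sf_inner \<kappa> x y)
      else norm (x - y))"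

definition geo_ball :: "real \<Rightarrow> real^4 \<Rightarrow> real \<Rightarrow> (real^4) set" where
  "geo_ball \<kappa> p\<^sub>0 R = {x \<in> space_form \<kappa>. sf_dist \<kappa> p\<^sub>0 x \<le> R}"

definition geo_sphere :: "real \<Rightarrow> real^4 \<Rightarrow> real \<Rightarrow> (real^4) set" where
  "geo_sphere \<kappa> p\<^sub>0 R = {x \<in> space_form \<kappa>. sf_dist \<kappa> p\<^sub>0 x = R}"

definition sn :: "real \<Rightarrow> real \<Rightarrow> real" where
  "sn \<kappa> t = (if \<kappa> = 1 then sin t else if \<kappa> = -1 then sinh t else t)"

definition cs :: "real \<Rightarrow> real \<Rightarrow> real" where
  "cs \<kappa> t = (if \<kappa> = 1 then cos t else if \<kappa> = -1 then cosh t else 1)"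

definition ct :: "real \<Rightarrow> real \<Rightarrow> real" where
  "ct \<kappa> t = (if \<kappa> = 1 then cot t else if \<kappa> = -1 then cosh t / sinh t else 1 / t)"

text \<open>The unit speed geodesic from \<open>p\<^sub>0\<close> with initial velocity \<open>v\<close> is \<open>t \<mapsto> cs \<kappa> t p\<^sub>0 + sn \<kappa> t v\<close>,
  and \<open>\<partial>\<^sub>\<rho>\<close> at \<open>x\<close> is the velocity at \<open>x\<close> of such a geodesic through \<open>x\<close>; eliminating \<open>v\<close> by means of
  \<open>(cs \<kappa> t)\<^sup>2 + \<kappa> (sn \<kappa> t)\<^sup>2 = 1\<close> gives the following formula.\<close>

definition radial_field :: "real \<Rightarrow> real^4 \<Rightarrow> real^4 \<Rightarrow> real^4" where
  "radial_field \<kappa> p\<^sub>0 x =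
     (let \<rho> = sf_dist \<kappa> p\<^sub>0 x in (1 / sn \<kappa> \<rho>) *\<^sub>R (cs \<kappa> \<rho> *\<^sub>R x - p\<^sub>0))"

text \<open>Every isometry of the model is the restriction of a unique linear map of \<open>\<real>\<^sup>4\<close>. Since the
  position vector is transverse to the tangent spaces, and is mapped to the position vector, the
  sign of the determinant of that linear map tells whether the isometry preserves orientation.\<close>

definition orientation_reversing_isometry :: "real \<Rightarrow> (real^4 \<Rightarrow> real^4) \<Rightarrow> bool" where
  "orientation_reversing_isometry \<kappa> \<sigma> \<longleftrightarrow>
     bij_betw \<sigma> (space_form \<kappa>) (space_form \<kappa>) \<and>
     (\<forall>x\<in>space_form \<kappa>. \<forall>y\<in>space_form \<kappa>. sf_dist \<kappa> (\<sigma> x) (\<sigma> y) = sf_dist \<kappa> x y) \<and>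
     (\<exists>F. linear F \<and> (\<forall>x\<in>space_form \<kappa>. F x = \<sigma> x) \<and> det (matrix F) < 0)"

section \<open>Geometry of immersed annuli\<close>

text \<open>The annulus \<open>[-1,1] \<times> S\<^sup>1\<close> is represented by its universal cover; maps on it are maps on the
  strip that are \<open>2\<pi>\<close>-periodic in the second coordinate \<open>\<theta>\<close>. Values outside the strip are
  irrelevant.\<close>

definition annulus :: "(real \<times> real) set" where
  "annulus = {-1..1} \<times> UNIV"

definition annulus_bd :: "(real \<times> real) set" where
  "annulus_bd = {-1, 1} \<times> UNIV"

definition periodic_map :: "(real \<times> real \<Rightarrow> 'a) \<Rightarrow> bool" where
  "periodic_map f \<longleftrightarrow> (\<forall>s\<in>{-1..1}. \<forall>\<theta>. f (s, \<theta> + 2 * pi) = f (s, \<theta>))"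

text \<open>Coordinate derivatives: index 1 is \<open>\<partial>\<^sub>s\<close> (one-sided on the boundary), index 2 is \<open>\<partial>\<^sub>\<theta>\<close>.\<close>

definition pd :: "2 \<Rightarrow> (real \<times> real \<Rightarrow> 'a::real_normed_vector) \<Rightarrow> real \<times> real \<Rightarrow> 'a" where
  "pd i f p =
     (if i = 1 then vector_derivative (\<lambda>s. f (s, snd p)) (at (fst p) within {-1..1})
      else vector_derivative (\<lambda>\<theta>. f (fst p, \<theta>)) (at (snd p)))"

definition immersion :: "(real \<times> real \<Rightarrow> real^4) \<Rightarrow> bool" where
  "immersion f \<longleftrightarrow> smooth_on annulus f \<and> periodic_map f \<and>
     (\<forall>p\<in>annulus. \<forall>c::real^2. (\<Sum>i\<in>UNIV. c$i *\<^sub>R pd i f p) = 0 \<longrightarrow> c = 0)"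

definition first_form :: "real \<Rightarrow> (real \<times> real \<Rightarrow> real^4) \<Rightarrow> real \<times> real \<Rightarrow> real^2^2" where
  "first_form \<kappa> f p = (\<chi> i j. sf_inner \<kappa> (pd i f p) (pd j f p))"

definition inv_form :: "real \<Rightarrow> (real \<times> real \<Rightarrow> real^4) \<Rightarrow> real \<times> real \<Rightarrow> real^2^2" where
  "inv_form \<kappa> f p = matrix_inv (first_form \<kappa> f p)"

text \<open>Levi-Civita derivative along \<open>f\<close> of a vector field \<open>V\<close> tangent to the space form: the
  tangential part of the derivative in \<open>\<real>\<^sup>4\<close>. The normal part equals \<open>- \<kappa> \<langle>V, \<partial>\<^sub>i f\<rangle> f\<close>.\<close>

definition cov_deriv ::
  "real \<Rightarrow> (real \<times> real \<Rightarrow> real^4) \<Rightarrow> 2 \<Rightarrow> (real \<times> real \<Rightarrow> real^4) \<Rightarrow> real \<times> real \<Rightarrow> real^4" where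
  "cov_deriv \<kappa> f i V p = pd i V p + (\<kappa> * sf_inner \<kappa> (V p) (pd i f p)) *\<^sub>R f p"

definition unit_normal ::
  "real \<Rightarrow> (real \<times> real \<Rightarrow> real^4) \<Rightarrow> (real \<times> real \<Rightarrow> real^4) \<Rightarrow> bool" where
  "unit_normal \<kappa> f \<nu> \<longleftrightarrow> smooth_on annulus \<nu> \<and> periodic_map \<nu> \<and>
     (\<forall>p\<in>annulus. \<nu> p \<in> tangent_space \<kappa> (f p) \<and> sf_inner \<kappa> (\<nu> p) (\<nu> p) = 1 \<and>
        (\<forall>i. sf_inner \<kappa> (\<nu> p) (pd i f p) = 0))"

definition second_form ::
  "real \<Rightarrow> (real \<times> real \<Rightarrow> real^4) \<Rightarrow> (real \<times> real \<Rightarrow> real^4) \<Rightarrow> real \<times> real \<Rightarrow> real^2^2" where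
  "second_form \<kappa> f \<nu> p = (\<chi> i j. sf_inner \<kappa> (cov_deriv \<kappa> f i \<nu> p) (pd j f p))"

definition mean_curvature ::
  "real \<Rightarrow> (real \<times> real \<Rightarrow> real^4) \<Rightarrow> (real \<times> real \<Rightarrow> real^4) \<Rightarrow> real \<times> real \<Rightarrow> real" where
  "mean_curvature \<kappa> f \<nu> p =
     (\<Sum>i\<in>UNIV. \<Sum>j\<in>UNIV. inv_form \<kappa> f p $ i $ j * second_form \<kappa> f \<nu> p $ i $ j)"

definition second_form_norm2 ::
  "real \<Rightarrow> (real \<times> real \<Rightarrow> real^4) \<Rightarrow> (real \<times> real \<Rightarrow> real^4) \<Rightarrow> real \<times> real \<Rightarrow> real" where
  "second_form_norm2 \<kappa> f \<nu> p =
     (\<Sum>i\<in>UNIV. \<Sum>j\<in>UNIV. \<Sum>k\<in>UNIV. \<Sum>l\<in>UNIV.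
        inv_form \<kappa> f p $ i $ k * inv_form \<kappa> f p $ j $ l *
        second_form \<kappa> f \<nu> p $ i $ j * second_form \<kappa> f \<nu> p $ k $ l)"

definition laplacian ::
  "real \<Rightarrow> (real \<times> real \<Rightarrow> real^4) \<Rightarrow> (real \<times> real \<Rightarrow> real) \<Rightarrow> real \<times> real \<Rightarrow> real" where
  "laplacian \<kappa> f u p =
     (\<Sum>i\<in>UNIV. pd i (\<lambda>q. sqrt (det (first_form \<kappa> f q)) *
        (\<Sum>j\<in>UNIV. inv_form \<kappa> f q $ i $ j * pd j u q)) p) / sqrt (det (first_form \<kappa> f p))"

text \<open>Components of the outward unit conormal at a point with \<open>s = 1\<close> or \<open>s = -1\<close>: the normalised
  gradient of \<open>s\<close>, times the sign of \<open>s\<close>.\<close>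

definition conormal :: "real \<Rightarrow> (real \<times> real \<Rightarrow> real^4) \<Rightarrow> real \<times> real \<Rightarrow> real^2" where
  "conormal \<kappa> f p = (\<chi> i. sgn (fst p) * inv_form \<kappa> f p $ i $ 1 / sqrt (inv_form \<kappa> f p $ 1 $ 1))"

definition conormal_deriv ::
  "real \<Rightarrow> (real \<times> real \<Rightarrow> real^4) \<Rightarrow> (real \<times> real \<Rightarrow> 'a::real_normed_vector) \<Rightarrow> real \<times> real \<Rightarrow> 'a" where
  "conormal_deriv \<kappa> f u p = (\<Sum>i\<in>UNIV. conormal \<kappa> f p $ i *\<^sub>R pd i u p)"

definition second_form_conormal ::
  "real \<Rightarrow> (real \<times> real \<Rightarrow> real^4) \<Rightarrow> (real \<times> real \<Rightarrow> real^4) \<Rightarrow> real \<times> real \<Rightarrow> real" where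
  "second_form_conormal \<kappa> f \<nu> p =
     (\<Sum>i\<in>UNIV. \<Sum>j\<in>UNIV. second_form \<kappa> f \<nu> p $ i $ j * conormal \<kappa> f p $ i * conormal \<kappa> f p $ j)"

text \<open>Two-sidedness is witnessed by the globally defined unit normal \<open>\<nu>\<close>. In the last condition
  \<open>conormal_deriv \<kappa> f f\<close> is the image of the conormal under the differential of \<open>f\<close>.\<close>

definition free_boundary_minimal ::
  "real \<Rightarrow> real^4 \<Rightarrow> real \<Rightarrow> (real \<times> real \<Rightarrow> real^4) \<Rightarrow> (real \<times> real \<Rightarrow> real^4) \<Rightarrow> bool" where
  "free_boundary_minimal \<kappa> p\<^sub>0 R f \<nu> \<longleftrightarrow>
     immersion f \<and> unit_normal \<kappa> f \<nu> \<and>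
     (\<forall>p\<in>annulus. f p \<in> geo_ball \<kappa> p\<^sub>0 R) \<and>
     (\<forall>p\<in>annulus. mean_curvature \<kappa> f \<nu> p = 0) \<and>
     (\<forall>p\<in>annulus_bd. f p \<in> geo_sphere \<kappa> p\<^sub>0 R) \<and>
     (\<forall>p\<in>annulus_bd. conormal_deriv \<kappa> f f p = radial_field \<kappa> p\<^sub>0 (f p))"

section \<open>Variable-radius families\<close>

definition variable_radius_family ::
  "real \<Rightarrow> real^4 \<Rightarrow> real set \<Rightarrow> (real \<Rightarrow> real) \<Rightarrow>
   (real \<Rightarrow> real \<times> real \<Rightarrow> real^4) \<Rightarrow> (real \<Rightarrow> real \<times> real \<Rightarrow> real^4) \<Rightarrow> bool" where
  "variable_radius_family \<kappa> p\<^sub>0 I r \<Phi> \<nu> \<longleftrightarrow>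
     is_interval I \<and> interior I \<noteq> {} \<and>
     smooth_on I r \<and> (\<forall>a\<in>I. r a > 0 \<and> (\<kappa> = 1 \<longrightarrow> r a < pi)) \<and>
     smooth_on (I \<times> annulus) (\<lambda>(a, p). \<Phi> a p) \<and>
     smooth_on (I \<times> annulus) (\<lambda>(a, p). \<nu> a p) \<and>
     (\<forall>a\<in>I. free_boundary_minimal \<kappa> p\<^sub>0 (r a) (\<Phi> a) (\<nu> a))"

definition normal_speed ::
  "real \<Rightarrow> real set \<Rightarrow> (real \<Rightarrow> real \<times> real \<Rightarrow> real^4) \<Rightarrow> (real \<Rightarrow> real \<times> real \<Rightarrow> real^4) \<Rightarrow>
   real \<Rightarrow> real \<times> real \<Rightarrow> real" where
  "normal_speed \<kappa> I \<Phi> \<nu> a p =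
     sf_inner \<kappa> (vector_derivative (\<lambda>b. \<Phi> b p) (at a within I)) (\<nu> a p)"

definition orthonormal_frame :: "real \<Rightarrow> real^4 \<Rightarrow> real^4 \<Rightarrow> real^4 \<Rightarrow> real^4 \<Rightarrow> bool" where
  "orthonormal_frame \<kappa> p\<^sub>0 e\<^sub>1 e\<^sub>2 e\<^sub>3 \<longleftrightarrow>
     e\<^sub>1 \<in> tangent_space \<kappa> p\<^sub>0 \<and> e\<^sub>2 \<in> tangent_space \<kappa> p\<^sub>0 \<and> e\<^sub>3 \<in> tangent_space \<kappa> p\<^sub>0 \<and>
     sf_inner \<kappa> e\<^sub>1 e\<^sub>1 = 1 \<and> sf_inner \<kappa> e\<^sub>2 e\<^sub>2 = 1 \<and> sf_inner \<kappa> e\<^sub>3 e\<^sub>3 = 1 \<and>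
     sf_inner \<kappa> e\<^sub>1 e\<^sub>2 = 0 \<and> sf_inner \<kappa> e\<^sub>1 e\<^sub>3 = 0 \<and> sf_inner \<kappa> e\<^sub>2 e\<^sub>3 = 0"

text \<open>Rotation by the angle \<open>t\<close> about the geodesic \<open>\<ell>\<close> through \<open>p\<^sub>0\<close> orthogonal to the orthonormal
  tangent vectors \<open>e\<^sub>1\<close>, \<open>e\<^sub>2\<close> at \<open>p\<^sub>0\<close>: it fixes \<open>p\<^sub>0\<close> and the direction of \<open>\<ell>\<close>, and rotates the
  components along \<open>e\<^sub>1\<close>, \<open>e\<^sub>2\<close>. Subtracting \<open>p\<^sub>0\<close> matters only for \<open>\<kappa> = 0\<close>, as otherwise
  \<open>\<langle>p\<^sub>0, e\<^sub>i\<rangle> = 0\<close>.\<close>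

definition rotation :: "real \<Rightarrow> real^4 \<Rightarrow> real^4 \<Rightarrow> real^4 \<Rightarrow> real \<Rightarrow> real^4 \<Rightarrow> real^4" where
  "rotation \<kappa> p\<^sub>0 e\<^sub>1 e\<^sub>2 t x =
     (let c\<^sub>1 = sf_inner \<kappa> (x - p\<^sub>0) e\<^sub>1; c\<^sub>2 = sf_inner \<kappa> (x - p\<^sub>0) e\<^sub>2
      in x + (cos t - 1) *\<^sub>R (c\<^sub>1 *\<^sub>R e\<^sub>1 + c\<^sub>2 *\<^sub>R e\<^sub>2) + sin t *\<^sub>R (c\<^sub>1 *\<^sub>R e\<^sub>2 - c\<^sub>2 *\<^sub>R e\<^sub>1))"

text \<open>The vector \<open>e\<^sub>3\<close> spans the axis \<open>\<ell>\<close>. The second condition says that \<open>\<theta>\<close> is the rotation angle: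
  the profile \<open>\<theta> = 0\<close> lies in the totally geodesic half-plane bounded by \<open>\<ell>\<close> and containing the
  direction \<open>e\<^sub>1\<close>. The third says that \<open>s\<close> is arclength on profiles up to a constant factor.\<close>

definition rotational ::
  "real \<Rightarrow> real^4 \<Rightarrow> real set \<Rightarrow> (real \<Rightarrow> real \<times> real \<Rightarrow> real^4) \<Rightarrow> bool" where
  "rotational \<kappa> p\<^sub>0 I \<Phi> \<longleftrightarrow>
     (\<exists>e\<^sub>1 e\<^sub>2 e\<^sub>3. orthonormal_frame \<kappa> p\<^sub>0 e\<^sub>1 e\<^sub>2 e\<^sub>3 \<and>
        (\<forall>a\<in>I. \<forall>s\<in>{-1..1}. \<forall>\<theta> t. \<Phi> a (s, \<theta> + t) = rotation \<kappa> p\<^sub>0 e\<^sub>1 e\<^sub>2 t (\<Phi> a (s, \<theta>))) \<and>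
        (\<forall>a\<in>I. \<forall>s\<in>{-1..1}. sf_inner \<kappa> (\<Phi> a (s, 0) - p\<^sub>0) e\<^sub>2 = 0 \<and>
                             sf_inner \<kappa> (\<Phi> a (s, 0) - p\<^sub>0) e\<^sub>1 \<ge> 0)) \<and>
     (\<forall>a\<in>I. \<exists>c>0. \<forall>p\<in>annulus. sf_inner \<kappa> (pd 1 (\<Phi> a) p) (pd 1 (\<Phi> a) p) = c\<^sup>2)"

definition reflection_symmetric ::
  "real \<Rightarrow> real^4 \<Rightarrow> real set \<Rightarrow> (real \<Rightarrow> real \<times> real \<Rightarrow> real^4) \<Rightarrow> bool" where
  "reflection_symmetric \<kappa> p\<^sub>0 I \<Phi> \<longleftrightarrow>
     (\<exists>\<sigma>. orientation_reversing_isometry \<kappa> \<sigma> \<and> \<sigma> p\<^sub>0 = p\<^sub>0 \<and>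
        (\<forall>a\<in>I. \<forall>s\<in>{-1..1}. \<forall>\<theta>. \<sigma> (\<Phi> a (s, \<theta>)) = \<Phi> a (-s, \<theta>)))"

section \<open>The Jacobi--Robin kernel\<close>

text \<open>Smooth functions on the annulus, extended by 0 outside the strip, so that distinct elements
  are distinct functions on the annulus and linear dimension has its usual meaning.\<close>

definition smooth_functions :: "(real \<times> real \<Rightarrow> real) set" where
  "smooth_functions = {u. smooth_on annulus u \<and> periodic_map u \<and> (\<forall>p. p \<notin> annulus \<longrightarrow> u p = 0)}"

definition jacobi_robin_kernel ::
  "real \<Rightarrow> real \<Rightarrow> (real \<times> real \<Rightarrow> real^4) \<Rightarrow> (real \<times> real \<Rightarrow> real^4) \<Rightarrow> (real \<times> real \<Rightarrow> real) set" where
  "jacobi_robin_kernel \<kappa> R f \<nu> =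
     {u \<in> smooth_functions.
        (\<forall>p\<in>annulus. laplacian \<kappa> f u p + (second_form_norm2 \<kappa> f \<nu> p + 2 * \<kappa>) * u p = 0) \<and>
        (\<forall>p\<in>annulus_bd. conormal_deriv \<kappa> f u p - ct \<kappa> R * u p = 0)}"

definition even_kernel ::
  "real \<Rightarrow> real \<Rightarrow> (real \<times> real \<Rightarrow> real^4) \<Rightarrow> (real \<times> real \<Rightarrow> real^4) \<Rightarrow> (real \<times> real \<Rightarrow> real) set" where
  "even_kernel \<kappa> R f \<nu> =
     {u \<in> jacobi_robin_kernel \<kappa> R f \<nu>.
        (\<forall>s\<in>{-1..1}. \<forall>\<theta> \<theta>'. u (s, \<theta>) = u (s, \<theta>')) \<and>
        (\<forall>s\<in>{-1..1}. \<forall>\<theta>. u (-s, \<theta>) = u (s, \<theta>))}"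

text \<open>\<^const>\<open>dim\<close> is 0 also for infinite-dimensional spaces, hence the finiteness condition.\<close>

definition has_dim :: "'a::real_vector set \<Rightarrow> nat \<Rightarrow> bool" where
  "has_dim V n \<longleftrightarrow> (\<exists>B. finite B \<and> V \<subseteq> span B) \<and> dim V = n"

end

theory Submission
  imports Defs
begin

text \<open>
  Let \<open>\<phi>\<close> be the normal speed of the family at a parameter \<open>a\<close>. Four facts give the result.

  \<^item> Since all surfaces of the family are minimal, \<open>\<phi>\<close> satisfies the Jacobi equation
    \<open>\<Delta>\<phi> + (|A|\<^sup>2 + 2\<kappa>) \<phi> = 0\<close>.
  \<^item> Since they are rotational and reflection-symmetric, \<open>\<phi>\<close> depends on \<open>s\<close> only and is even. Here the
    reflection must reverse orientation: this makes it map the unit normal to the unit normal, rather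
    than to its opposite.
  \<^item> For functions of \<open>s\<close> the Jacobi equation is a linear second order ordinary differential equation,
    and an even solution is determined by its value at \<open>s = 0\<close>. As \<open>\<phi>\<close> does not vanish identically,
    the even solutions are exactly the multiples of \<open>\<phi>\<close>.
  \<^item> Along the boundary the conormal is the radial direction, for every parameter. Differentiating this
    in the parameter gives \<open>\<partial>\<^sub>\<eta> \<phi> - ct(r) \<phi> = r' A(\<eta>, \<eta>)\<close>.

  So the even kernel is the line spanned by \<open>\<phi>\<close> or is trivial, according to whether the right-hand side
  of the last equation vanishes, and as \<open>A(\<eta>, \<eta>) \<noteq> 0\<close> it does so exactly if \<open>r' = 0\<close>.

  The first and the last fact are \<open>jacobi_equation\<close> and \<open>boundary_variation\<close>. Both are computed on the
  profile curve \<open>\<gamma>\<close>, with a moving frame formed by the position vector, the tangent, the normal and the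
  direction of rotation; minimality becomes the equation \<open>k w = \<langle>n, e\<^sub>1\<rangle>\<close> between the curvature of the
  profile, the length \<open>2 \<pi> w\<close> of the parallel circles and the normal, and its derivative in the parameter
  is the Jacobi equation. The lemma \<open>F_\<nu>\<close> contains the parity of the normal, and
  \<open>has_dim_even_kernel\<close> combines the four facts for one parameter.
\<close>

section \<open>Calculus of smooth maps\<close>

lemma Ck_on_imp_continuous_on: "Ck_on k U f \<Longrightarrow> continuous_on U f"
  by (cases k) (auto intro!: continuous_at_imp_continuous_on dest: has_derivative_continuous)

lemma Ck_on_SucI:
  "(\<And>x. x \<in> U \<Longrightarrow> (f has_derivative f' x) (at x)) \<Longrightarrow> (\<And>v. Ck_on k U (\<lambda>x. f' x v)) \<Longrightarrow>
    Ck_on (Suc k) U f"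
  by (simp, intro exI[of _ f']) blast

lemma Ck_on_SucE:
  assumes "Ck_on (Suc k) U f"
  obtains f' where "\<And>x. x \<in> U \<Longrightarrow> (f has_derivative f' x) (at x)" "\<And>v. Ck_on k U (\<lambda>x. f' x v)"
  using assms by auto

lemma Ck_on_Suc_imp_Ck_on: "Ck_on (Suc k) U f \<Longrightarrow> Ck_on k U f"
proof (induction k arbitrary: f)
  case 0
  show ?case using Ck_on_imp_continuous_on[OF 0] by simp
next
  case (Suc k)
  show ?case
    by (rule Ck_on_SucE[OF Suc.prems], rule Ck_on_SucI) (assumption, rule Suc.IH)
qed

lemma Ck_on_subset: "Ck_on k U f \<Longrightarrow> V \<subseteq> U \<Longrightarrow> Ck_on k V f"
proof (induction k arbitrary: f)
  case 0
  then show ?case using continuous_on_subset by auto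
next
  case (Suc k)
  show ?case
    by (rule Ck_on_SucE[OF Suc.prems(1)], rule Ck_on_SucI) (use Suc in auto)
qed

lemma Ck_on_cong:
  "Ck_on k U f \<Longrightarrow> open U \<Longrightarrow> (\<And>x. x \<in> U \<Longrightarrow> f x = g x) \<Longrightarrow> Ck_on k U g"
proof (cases k)
  case 0
  then show "Ck_on k U f \<Longrightarrow> open U \<Longrightarrow> (\<And>x. x \<in> U \<Longrightarrow> f x = g x) \<Longrightarrow> Ck_on k U g"
    using continuous_on_cong by auto
next
  case (Suc m)
  assume *: "Ck_on k U f" "open U" "\<And>x. x \<in> U \<Longrightarrow> f x = g x"
  obtain f' where f': "\<And>x. x \<in> U \<Longrightarrow> (f has_derivative f' x) (at x)" "\<And>v. Ck_on m U (\<lambda>x. f' x v)"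
    using Ck_on_SucE *(1) Suc by blast
  have "(g has_derivative f' x) (at x)" if "x \<in> U" for x
    by (rule has_derivative_transform_within_open[OF f'(1)[OF that] *(2) that]) (rule *(3))
  then show "Ck_on k U g"
    unfolding Suc using f'(2) by (rule Ck_on_SucI)
qed

lemma Ck_on_add: "Ck_on k U f \<Longrightarrow> Ck_on k U g \<Longrightarrow> Ck_on k U (\<lambda>x. f x + g x)"
proof (induction k arbitrary: f g)
  case 0
  then show ?case by (auto intro: continuous_on_add)
next
  case (Suc k)
  then obtain f' g' where
    f': "\<forall>x\<in>U. (f has_derivative f' x) (at x)" "\<forall>v. Ck_on k U (\<lambda>x. f' x v)" and
    g': "\<forall>x\<in>U. (g has_derivative g' x) (at x)" "\<forall>v. Ck_on k U (\<lambda>x. g' x v)"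
    by auto
  then have "((\<lambda>x. f x + g x) has_derivative (\<lambda>v. f' x v + g' x v)) (at x)" if "x \<in> U" for x
    using that by (intro has_derivative_add) auto
  moreover have "Ck_on k U (\<lambda>x. f' x v + g' x v)" for v
    using Suc.IH f' g' by simp
  ultimately show ?case
    by (rule Ck_on_SucI)
qed

lemma Ck_on_bilinear:
  assumes B: "bounded_bilinear B"
  shows "Ck_on k U f \<Longrightarrow> Ck_on k U g \<Longrightarrow> Ck_on k U (\<lambda>x. B (f x) (g x))"
proof (induction k arbitrary: f g)
  case 0
  then show ?case using bounded_bilinear.continuous_on[OF B] by auto
next
  case (Suc k)
  then obtain f' g' where
    f': "\<forall>x\<in>U. (f has_derivative f' x) (at x)" "\<forall>v. Ck_on k U (\<lambda>x. f' x v)" and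
    g': "\<forall>x\<in>U. (g has_derivative g' x) (at x)" "\<forall>v. Ck_on k U (\<lambda>x. g' x v)"
    by auto
  have "((\<lambda>x. B (f x) (g x)) has_derivative (\<lambda>v. B (f x) (g' x v) + B (f' x v) (g x))) (at x)"
    if "x \<in> U" for x
    using that f' g' by (intro bounded_bilinear.FDERIV[OF B]) auto
  moreover have "Ck_on k U (\<lambda>x. B (f x) (g' x v) + B (f' x v) (g x))" for v
    using Suc.IH Ck_on_Suc_imp_Ck_on[OF Suc.prems(1)] Ck_on_Suc_imp_Ck_on[OF Suc.prems(2)] f' g'
    by (intro Ck_on_add) auto
  ultimately show ?case
    by (rule Ck_on_SucI)
qed

lemma Ck_on_affine:
  assumes L: "bounded_linear L"
  shows "Ck_on k U f \<Longrightarrow> Ck_on k ((\<lambda>x. b + L x) -` U) (\<lambda>x. f (b + L x))"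
proof (induction k arbitrary: f)
  case 0
  show ?case
    using 0 by (auto intro!: continuous_on_compose2[of U f] continuous_intros
        bounded_linear.continuous_on[OF L])
next
  case (Suc k)
  then obtain f' where
    f': "\<forall>x\<in>U. (f has_derivative f' x) (at x)" "\<forall>v. Ck_on k U (\<lambda>x. f' x v)"
    by auto
  have aff: "((\<lambda>x. b + L x) has_derivative L) (at x)" for x
    using bounded_linear.has_derivative[OF L has_derivative_ident, of "at x"]
    by (auto intro!: derivative_eq_intros)
  have "((\<lambda>x. f (b + L x)) has_derivative (\<lambda>v. f' (b + L x) (L v))) (at x)"
    if "b + L x \<in> U" for x
    using has_derivative_compose[OF aff, of f "f' (b + L x)" x] f' that by auto
  then show ?case
    by (intro Ck_on_SucI[where f' = "\<lambda>x v. f' (b + L x) (L v)"]) (auto intro: Suc.IH f'(2)[rule_format])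
qed

lemma smooth_on_bilinear:
  assumes "bounded_bilinear B" "smooth_on S f" "smooth_on S g"
  shows "smooth_on S (\<lambda>x. B (f x) (g x))"
proof -
  obtain U f0 V g0 where "open U" "S \<subseteq> U" "\<forall>k. Ck_on k U f0" "\<forall>x\<in>S. f0 x = f x"
      "open V" "S \<subseteq> V" "\<forall>k. Ck_on k V g0" "\<forall>x\<in>S. g0 x = g x"
    using assms unfolding smooth_on_def by metis
  moreover from this have "\<forall>k. Ck_on k (U \<inter> V) (\<lambda>x. B (f0 x) (g0 x))"
    using Ck_on_bilinear[OF assms(1)] Ck_on_subset by (metis Int_lower1 Int_lower2)
  ultimately show ?thesis
    unfolding smooth_on_def by (intro exI[of _ "U \<inter> V"] exI[of _ "\<lambda>x. B (f0 x) (g0 x)"]) auto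
qed

lemma smooth_on_affine:
  assumes L: "bounded_linear L" and f: "smooth_on S f" and T: "\<And>x. x \<in> T \<Longrightarrow> b + L x \<in> S"
  shows "smooth_on T (\<lambda>x. f (b + L x))"
proof -
  obtain U g where U: "open U" "S \<subseteq> U" "\<forall>k. Ck_on k U g" "\<forall>x\<in>S. g x = f x"
    using f unfolding smooth_on_def by metis
  have "open ((\<lambda>x. b + L x) -` U)"
    using U(1) by (intro open_vimage) (auto intro!: continuous_intros bounded_linear.continuous_on[OF L])
  moreover have "T \<subseteq> (\<lambda>x. b + L x) -` U"
    using T U(2) by auto
  ultimately show ?thesis
    unfolding smooth_on_def using U T
    by (intro exI[of _ "(\<lambda>x. b + L x) -` U"] exI[of _ "\<lambda>x. g (b + L x)"])
      (auto intro!: Ck_on_affine[OF L])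
qed

lemma smooth_on_subset: "smooth_on S f \<Longrightarrow> T \<subseteq> S \<Longrightarrow> smooth_on T f"
  unfolding smooth_on_def by (meson subset_iff order_trans)

lemma smooth_on_cong:
  "smooth_on S f \<Longrightarrow> (\<And>x. x \<in> S \<Longrightarrow> f x = g x) \<Longrightarrow> smooth_on S g"
  unfolding smooth_on_def by metis

lemma smooth_on_imp_continuous_on: "smooth_on S f \<Longrightarrow> continuous_on S f"
  unfolding smooth_on_def
  by (metis Ck_on_imp_continuous_on continuous_on_cong continuous_on_subset)

lemma has_derivative_imp_has_vector_derivative_fst:
  fixes F :: "real \<times> 'b::real_normed_vector \<Rightarrow> 'c::real_normed_vector"
  assumes F: "(F has_derivative F') (at (a, p) within I \<times> S)" and p: "p \<in> S"
  shows "((\<lambda>b. F (b, p)) has_vector_derivative F' (1, 0)) (at a within I)"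
proof -
  have "((\<lambda>b. (b, p)) has_derivative (\<lambda>h. (h, 0))) (at a within I)"
    by (auto intro!: derivative_eq_intros)
  moreover have "(F has_derivative F') (at (a, p) within (\<lambda>b. (b, p)) ` I)"
    by (rule has_derivative_subset[OF F]) (use p in auto)
  ultimately have "((\<lambda>b. F (b, p)) has_derivative (\<lambda>h. F' (h, 0))) (at a within I)"
    by (rule has_derivative_in_compose[of "\<lambda>b. (b, p)" "\<lambda>h. (h, 0)" a I F F'])
  moreover have "(\<lambda>h. F' (h, 0)) = (\<lambda>h. h *\<^sub>R F' (1, 0))"
  proof
    fix h :: real
    have "(h, 0 :: 'b) = h *\<^sub>R (1, 0)" by simp
    then show "F' (h, 0) = h *\<^sub>R F' (1, 0)"
      using linear_cmul[OF has_derivative_linear[OF F], of h "(1, 0)"] by (simp only:)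
  qed
  ultimately show ?thesis
    unfolding has_vector_derivative_def by (simp only:)
qed

lemma has_derivative_imp_has_vector_derivative_snd:
  fixes F :: "'b::real_normed_vector \<times> real \<Rightarrow> 'c::real_normed_vector"
  assumes F: "(F has_derivative F') (at (a, s) within S \<times> J)" and a: "a \<in> S"
  shows "((\<lambda>t. F (a, t)) has_vector_derivative F' (0, 1)) (at s within J)"
proof -
  have "((\<lambda>t. (a, t)) has_derivative (\<lambda>h. (0, h))) (at s within J)"
    by (auto intro!: derivative_eq_intros)
  moreover have "(F has_derivative F') (at (a, s) within (\<lambda>t. (a, t)) ` J)"
    by (rule has_derivative_subset[OF F]) (use a in auto)
  ultimately have "((\<lambda>t. F (a, t)) has_derivative (\<lambda>h. F' (0, h))) (at s within J)"
    by (rule has_derivative_in_compose[of "\<lambda>t. (a, t)" "\<lambda>h. (0, h)" s J F F'])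
  moreover have "(\<lambda>h. F' (0, h)) = (\<lambda>h. h *\<^sub>R F' (0, 1))"
  proof
    fix h :: real
    have "(0 :: 'b, h) = h *\<^sub>R (0, 1)" by simp
    then show "F' (0, h) = h *\<^sub>R F' (0, 1)"
      using linear_cmul[OF has_derivative_linear[OF F], of h "(0, 1)"] by (simp only:)
  qed
  ultimately show ?thesis
    unfolding has_vector_derivative_def by (simp only:)
qed

lemma second_difference_mean_value:
  fixes f :: "real \<Rightarrow> real \<Rightarrow> real"
  assumes "h > 0"
    and "\<And>s t. s \<in> {x..x+h} \<Longrightarrow> t \<in> {y..y+h} \<Longrightarrow> ((\<lambda>s. f s t) has_real_derivative f1 s t) (at s)"
    and "\<And>s t. s \<in> {x..x+h} \<Longrightarrow> t \<in> {y..y+h} \<Longrightarrow> ((\<lambda>t. f1 s t) has_real_derivative f12 s t) (at t)"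
  obtains \<xi> \<eta> where "\<xi> \<in> {x..x+h}" "\<eta> \<in> {y..y+h}"
    "f (x+h) (y+h) - f (x+h) y - f x (y+h) + f x y = h * h * f12 \<xi> \<eta>"
proof -
  have "((\<lambda>s. f s (y+h) - f s y) has_real_derivative f1 s (y+h) - f1 s y) (at s)"
    if "x \<le> s" "s \<le> x + h" for s
    using assms that by (intro DERIV_diff) auto
  then obtain \<xi> where \<xi>: "x < \<xi>" "\<xi> < x + h"
    "f (x+h) (y+h) - f (x+h) y - (f x (y+h) - f x y) = h * (f1 \<xi> (y+h) - f1 \<xi> y)"
    using MVT2[of x "x+h" "\<lambda>s. f s (y+h) - f s y" "\<lambda>s. f1 s (y+h) - f1 s y"] assms(1) by auto
  obtain \<eta> where \<eta>: "y < \<eta>" "\<eta> < y + h" "f1 \<xi> (y+h) - f1 \<xi> y = h * f12 \<xi> \<eta>"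
    using MVT2[of y "y+h" "f1 \<xi>" "f12 \<xi>"] assms \<xi> by auto
  show thesis
    using that[of \<xi> \<eta>] \<xi> \<eta> by (auto simp: algebra_simps)
qed

text \<open>Both mixed derivatives are limits of the same second difference quotients.\<close>

lemma mixed_partials_commute_real:
  fixes f :: "real \<times> real \<Rightarrow> real"
  assumes U: "open U" "x \<in> U"
    and f: "\<And>z. z \<in> U \<Longrightarrow> (f has_derivative f' z) (at z)"
    and f1: "\<And>z. z \<in> U \<Longrightarrow> ((\<lambda>z. f' z (1, 0)) has_derivative g1 z) (at z)"
    and f2: "\<And>z. z \<in> U \<Longrightarrow> ((\<lambda>z. f' z (0, 1)) has_derivative g2 z) (at z)"
    and c1: "continuous_on U (\<lambda>z. g1 z (0, 1))"
    and c2: "continuous_on U (\<lambda>z. g2 z (1, 0))"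
  shows "g1 x (0, 1) = g2 x (1, 0)"
proof (rule ccontr)
  have line1: "((\<lambda>s. F (s, t)) has_real_derivative F' (1, 0)) (at s)"
    if "(F has_derivative F') (at (s, t))" for F :: "real \<times> real \<Rightarrow> real" and F' s t
    using has_derivative_imp_has_vector_derivative_fst[of F F' s t UNIV UNIV] that
    by (simp add: has_real_derivative_iff_has_vector_derivative)
  have line2: "((\<lambda>t. F (s, t)) has_real_derivative F' (0, 1)) (at t)"
    if "(F has_derivative F') (at (s, t))" for F :: "real \<times> real \<Rightarrow> real" and F' s t
    using has_derivative_imp_has_vector_derivative_snd[of F F' s t UNIV UNIV] that
    by (simp add: has_real_derivative_iff_has_vector_derivative)
  assume ne: "g1 x (0, 1) \<noteq> g2 x (1, 0)"
  define e where "e = \<bar>g1 x (0, 1) - g2 x (1, 0)\<bar> / 2"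
  have "e > 0" using ne by (simp add: e_def)
  obtain d1 where d1: "d1 > 0" "\<And>z. z \<in> U \<Longrightarrow> dist z x < d1 \<Longrightarrow> \<bar>g1 z (0, 1) - g1 x (0, 1)\<bar> < e"
    using c1 U \<open>e > 0\<close> unfolding continuous_on_iff dist_real_def by metis
  obtain d2 where d2: "d2 > 0" "\<And>z. z \<in> U \<Longrightarrow> dist z x < d2 \<Longrightarrow> \<bar>g2 z (1, 0) - g2 x (1, 0)\<bar> < e"
    using c2 U \<open>e > 0\<close> unfolding continuous_on_iff dist_real_def by metis
  obtain d3 where d3: "d3 > 0" "ball x d3 \<subseteq> U"
    using U open_contains_ball by blast
  define h where "h = min d1 (min d2 d3) / 3"
  have h: "h > 0" "2 * h < d1" "2 * h < d2" "2 * h < d3"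
    using d1 d2 d3 by (auto simp: h_def)
  obtain a b where x: "x = (a, b)" by (cases x)
  have near: "dist (s, t) x \<le> 2 * h" if "s \<in> {a..a+h}" "t \<in> {b..b+h}" for s t
  proof -
    have "dist (s, t) x \<le> \<bar>dist s a\<bar> + \<bar>dist t b\<bar>"
      unfolding x dist_Pair_Pair by (rule sqrt_sum_squares_le_sum_abs)
    then show ?thesis using that by (auto simp: dist_real_def)
  qed
  have inU: "(s, t) \<in> U" if "s \<in> {a..a+h}" "t \<in> {b..b+h}" for s t
    using near[OF that] h d3 by (auto simp: dist_commute)
  obtain \<xi> \<eta> where 1: "\<xi> \<in> {a..a+h}" "\<eta> \<in> {b..b+h}"
    "f (a+h, b+h) - f (a+h, b) - f (a, b+h) + f (a, b) = h * h * g1 (\<xi>, \<eta>) (0, 1)"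
    using second_difference_mean_value[of h a b "\<lambda>s t. f (s, t)" "\<lambda>s t. f' (s, t) (1, 0)"
        "\<lambda>s t. g1 (s, t) (0, 1)"] h(1) line1[OF f[OF inU]] line2[OF f1[OF inU]] by blast
  obtain \<eta>' \<xi>' where 2: "\<eta>' \<in> {b..b+h}" "\<xi>' \<in> {a..a+h}"
    "f (a+h, b+h) - f (a, b+h) - f (a+h, b) + f (a, b) = h * h * g2 (\<xi>', \<eta>') (1, 0)"
    using second_difference_mean_value[of h b a "\<lambda>t s. f (s, t)" "\<lambda>t s. f' (s, t) (0, 1)"
        "\<lambda>t s. g2 (s, t) (1, 0)"] h(1) line2[OF f[OF inU]] line1[OF f2[OF inU]] by blast
  have "h * h * g1 (\<xi>, \<eta>) (0, 1) = h * h * g2 (\<xi>', \<eta>') (1, 0)"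
    using 1 2 by linarith
  then have "g1 (\<xi>, \<eta>) (0, 1) = g2 (\<xi>', \<eta>') (1, 0)"
    using h by simp
  moreover have "\<bar>g1 (\<xi>, \<eta>) (0, 1) - g1 x (0, 1)\<bar> < e"
    using d1(2)[OF inU] near 1 h by fastforce
  moreover have "\<bar>g2 (\<xi>', \<eta>') (1, 0) - g2 x (1, 0)\<bar> < e"
    using d2(2)[OF inU] near 2 h by fastforce
  moreover have "\<bar>g1 x (0, 1) - g2 x (1, 0)\<bar> = e + e"
    by (simp add: e_def)
  ultimately show False
    by linarith
qed

lemma mixed_partials_commute:
  fixes f :: "real \<times> real \<Rightarrow> 'b::euclidean_space"
  assumes U: "open U" "x \<in> U"
    and f: "\<And>z. z \<in> U \<Longrightarrow> (f has_derivative f' z) (at z)"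
    and f1: "\<And>z. z \<in> U \<Longrightarrow> ((\<lambda>z. f' z (1, 0)) has_derivative g1 z) (at z)"
    and f2: "\<And>z. z \<in> U \<Longrightarrow> ((\<lambda>z. f' z (0, 1)) has_derivative g2 z) (at z)"
    and c1: "continuous_on U (\<lambda>z. g1 z (0, 1))"
    and c2: "continuous_on U (\<lambda>z. g2 z (1, 0))"
  shows "g1 x (0, 1) = g2 x (1, 0)"
proof (rule euclidean_eqI)
  fix b :: 'b
  show "g1 x (0, 1) \<bullet> b = g2 x (1, 0) \<bullet> b"
    by (rule mixed_partials_commute_real[OF U, of "\<lambda>z. f z \<bullet> b" "\<lambda>z h. f' z h \<bullet> b"
          "\<lambda>z h. g1 z h \<bullet> b" "\<lambda>z h. g2 z h \<bullet> b"])
      (auto intro!: continuous_intros c1 c2 has_derivative_inner_left f f1 f2)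
qed

text \<open>By uniqueness of derivatives, one and the same derivative serves for all orders of smoothness.\<close>

lemma smooth_on_derivative:
  fixes f :: "'a::euclidean_space \<Rightarrow> 'b::real_normed_vector"
  assumes "smooth_on S f"
  obtains f' where "\<And>x. x \<in> S \<Longrightarrow> (f has_derivative f' x) (at x within S)"
    "\<And>v. smooth_on S (\<lambda>x. f' x v)"
proof -
  obtain U g where U: "open U" "S \<subseteq> U" "\<forall>k. Ck_on k U g" "\<forall>x\<in>S. g x = f x"
    using assms unfolding smooth_on_def by metis
  define g' where "g' x = frechet_derivative g (at x)" for x
  have g': "(g has_derivative g' x) (at x)" if "x \<in> U" for x
  proof -
    have "Ck_on (Suc 0) U g" using U(3) by blast
    then show ?thesis
      using that frechet_derivative_works[of g "at x"] unfolding g'_def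
      by (auto intro: differentiableI)
  qed
  have "Ck_on k U (\<lambda>x. g' x v)" for k v
  proof -
    obtain h where h: "\<forall>x\<in>U. (g has_derivative h x) (at x)" "\<forall>v. Ck_on k U (\<lambda>x. h x v)"
      using U(3)[rule_format, of "Suc k"] by auto
    have "h x = g' x" if "x \<in> U" for x
      using h g' that has_derivative_unique by blast
    then show ?thesis
      using Ck_on_cong[OF h(2)[rule_format, of v] U(1), of "\<lambda>x. g' x v"] by auto
  qed
  then have "smooth_on S (\<lambda>x. g' x v)" for v
    using U unfolding smooth_on_def by blast
  moreover have "(f has_derivative g' x) (at x within S)" if "x \<in> S" for x
    using has_derivative_transform[OF that _ has_derivative_at_withinI[OF g']] U that by auto
  ultimately show thesis using that by blast
qed

text \<open>The parameter interval may contain its end points, and the profile is defined on a closed interval,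
  so all derivatives are one-sided. They are restrictions of derivatives of a smooth extension, for
  which the order of differentiation does not matter.\<close>

lemma smooth_on_partial_derivatives:
  fixes f :: "real \<Rightarrow> real \<Rightarrow> 'b::euclidean_space"
  assumes "smooth_on (I \<times> J) (\<lambda>(a, s). f a s)"
  obtains fa fs fas where
    "smooth_on (I \<times> J) (\<lambda>(a, s). fa a s)" "smooth_on (I \<times> J) (\<lambda>(a, s). fs a s)"
    "\<And>a s. a \<in> I \<Longrightarrow> s \<in> J \<Longrightarrow> ((\<lambda>b. f b s) has_vector_derivative fa a s) (at a within I)"
    "\<And>a s. a \<in> I \<Longrightarrow> s \<in> J \<Longrightarrow> (f a has_vector_derivative fs a s) (at s within J)"
    "\<And>a s. a \<in> I \<Longrightarrow> s \<in> J \<Longrightarrow> (fa a has_vector_derivative fas a s) (at s within J)"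
    "\<And>a s. a \<in> I \<Longrightarrow> s \<in> J \<Longrightarrow> ((\<lambda>b. fs b s) has_vector_derivative fas a s) (at a within I)"
proof -
  obtain U g where U: "open U" "I \<times> J \<subseteq> U" "\<forall>k. Ck_on k U g" "\<forall>x\<in>I \<times> J. g x = (\<lambda>(a, s). f a s) x"
    using assms unfolding smooth_on_def by metis
  have deriv: "\<exists>h'. (\<forall>x\<in>U. (h has_derivative h' x) (at x)) \<and> (\<forall>v. smooth_on U (\<lambda>x. h' x v))"
    if h: "smooth_on U h" for h :: "real \<times> real \<Rightarrow> 'b"
  proof -
    obtain h' where h': "\<And>x. x \<in> U \<Longrightarrow> (h has_derivative h' x) (at x within U)"
        "\<And>v. smooth_on U (\<lambda>x. h' x v)"
      using smooth_on_derivative[OF h] by blast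
    then show ?thesis
      using at_within_open[OF _ U(1)] by (intro exI[of _ h']) force
  qed
  have "smooth_on U g" using U unfolding smooth_on_def by blast
  from deriv[OF this] obtain g' where g': "\<And>x. x \<in> U \<Longrightarrow> (g has_derivative g' x) (at x)"
      and sm: "\<And>v. smooth_on U (\<lambda>x. g' x v)"
    by blast
  have "\<forall>v. \<exists>D. (\<forall>x\<in>U. ((\<lambda>x. g' x v) has_derivative D x) (at x)) \<and> (\<forall>w. smooth_on U (\<lambda>x. D x w))"
    using deriv[OF sm] by blast
  from choice[OF this] obtain D where D: "\<And>v x. x \<in> U \<Longrightarrow> ((\<lambda>x. g' x v) has_derivative D v x) (at x)"
      and smD: "\<And>v w. smooth_on U (\<lambda>x. D v x w)"
    by blast
  have comm: "D (1, 0) x (0, 1) = D (0, 1) x (1, 0)" if "x \<in> U" for x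
    using mixed_partials_commute[OF U(1) that g' D D]
      smooth_on_imp_continuous_on[OF smD] by blast
  note line1 = has_derivative_imp_has_vector_derivative_fst[OF has_derivative_at_withinI]
  note line2 = has_derivative_imp_has_vector_derivative_snd[OF has_derivative_at_withinI]
  have mem: "(a, s) \<in> U" if "a \<in> I" "s \<in> J" for a s using that U by auto
  have gf: "g (a, s) = f a s" if "a \<in> I" "s \<in> J" for a s using that U by auto
  show thesis
  proof (rule that[of "\<lambda>a s. g' (a, s) (1, 0)" "\<lambda>a s. g' (a, s) (0, 1)"
        "\<lambda>a s. D (1, 0) (a, s) (0, 1)"])
    fix a s assume *: "a \<in> I" "s \<in> J"
    show "((\<lambda>b. f b s) has_vector_derivative g' (a, s) (1, 0)) (at a within I)"
      by (rule has_vector_derivative_transform[OF _ _ line1[OF g'[OF mem]]]) (use * gf in auto)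
    show "(f a has_vector_derivative g' (a, s) (0, 1)) (at s within J)"
      by (rule has_vector_derivative_transform[OF _ _ line2[OF g'[OF mem]]]) (use * gf in auto)
    show "((\<lambda>s. g' (a, s) (1, 0)) has_vector_derivative D (1, 0) (a, s) (0, 1)) (at s within J)"
      by (rule line2[OF D[OF mem]]) (use * in auto)
    show "((\<lambda>b. g' (b, s) (0, 1)) has_vector_derivative D (1, 0) (a, s) (0, 1)) (at a within I)"
      unfolding comm[OF mem[OF *]] by (rule line1[OF D[OF mem]]) (use * in auto)
  next
    show "smooth_on (I \<times> J) (\<lambda>(a, s). g' (a, s) (1, 0))"
      using smooth_on_subset[OF sm U(2)] by (simp add: case_prod_unfold)
    show "smooth_on (I \<times> J) (\<lambda>(a, s). g' (a, s) (0, 1))"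
      using smooth_on_subset[OF sm U(2)] by (simp add: case_prod_unfold)
  qed
qed

section \<open>Linear algebra of the space forms\<close>

text \<open>Velocities of curves in the space form: no condition for \<open>\<kappa> = \<plusminus>1\<close>, and for \<open>\<kappa> = 0\<close> the direction
  space of the hyperplane.\<close>

definition spatial :: "real \<Rightarrow> real^4 \<Rightarrow> bool" where
  "spatial \<kappa> x \<longleftrightarrow> (\<kappa> = 0 \<longrightarrow> x $ 1 = 0)"

interpretation sf_inner: bounded_bilinear "sf_inner \<kappa>" for \<kappa>
  unfolding bilinear_conv_bounded_bilinear[symmetric]
  by (auto simp: bilinear_def linear_iff sf_inner_def algebra_simps)

interpretation sf_quad: bounded_bilinear "sf_quad \<kappa>" for \<kappa>
  unfolding bilinear_conv_bounded_bilinear[symmetric]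
  by (auto simp: bilinear_def linear_iff sf_quad_def algebra_simps)

lemmas sf_inner_simps = sf_inner.add_left sf_inner.add_right sf_inner.diff_left sf_inner.diff_right
  sf_inner.scaleR_left sf_inner.scaleR_right sf_inner.minus_left sf_inner.minus_right
  sf_inner.zero_left sf_inner.zero_right

lemmas sf_quad_simps = sf_quad.add_left sf_quad.add_right sf_quad.diff_left sf_quad.diff_right
  sf_quad.scaleR_left sf_quad.scaleR_right sf_quad.minus_left sf_quad.minus_right
  sf_quad.zero_left sf_quad.zero_right

lemma sf_inner_commute: "sf_inner \<kappa> x y = sf_inner \<kappa> y x"
  by (simp add: sf_inner_def algebra_simps)

lemma sf_quad_commute: "sf_quad \<kappa> x y = sf_quad \<kappa> y x"
  by (simp add: sf_quad_def algebra_simps)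

lemma sf_quad_eq_sf_inner:
  assumes "\<kappa> \<in> {-1, 0, 1}" "spatial \<kappa> y"
  shows "sf_quad \<kappa> x y = \<kappa> * sf_inner \<kappa> x y"
  using assms by (auto simp: sf_quad_def sf_inner_def spatial_def)

lemma space_form_flat: "x \<in> space_form 0 \<Longrightarrow> x $ 1 = 1"
  by (auto simp: space_form_def sf_quad_def) (metis power2_eq_1_iff power2_eq_square less_numeral_extra(1)
      neg_0_less_iff_less not_less_iff_gr_or_eq)

lemma tangent_space_spatial:
  "p \<in> space_form \<kappa> \<Longrightarrow> v \<in> tangent_space \<kappa> p \<Longrightarrow> spatial \<kappa> v"
  by (cases "\<kappa> = 0") (auto simp: spatial_def tangent_space_def sf_quad_def dest: space_form_flat)

locale sf_frame =
  fixes \<kappa> :: real and p e\<^sub>1 e\<^sub>2 e\<^sub>3 :: "real^4"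
  assumes \<kappa>: "\<kappa> \<in> {-1, 0, 1}" and p: "p \<in> space_form \<kappa>"
    and frame: "orthonormal_frame \<kappa> p e\<^sub>1 e\<^sub>2 e\<^sub>3"
begin

abbreviation co0 :: "real^4 \<Rightarrow> real" where "co0 x \<equiv> sf_quad \<kappa> p x"
abbreviation co1 :: "real^4 \<Rightarrow> real" where "co1 x \<equiv> sf_inner \<kappa> (x - co0 x *\<^sub>R p) e\<^sub>1"
abbreviation co2 :: "real^4 \<Rightarrow> real" where "co2 x \<equiv> sf_inner \<kappa> (x - co0 x *\<^sub>R p) e\<^sub>2"
abbreviation co3 :: "real^4 \<Rightarrow> real" where "co3 x \<equiv> sf_inner \<kappa> (x - co0 x *\<^sub>R p) e\<^sub>3"

lemma quad_pp [simp]: "sf_quad \<kappa> p p = 1"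
  using p by (simp add: space_form_def)

lemma quad_pe [simp]: "sf_quad \<kappa> p e\<^sub>1 = 0" "sf_quad \<kappa> p e\<^sub>2 = 0" "sf_quad \<kappa> p e\<^sub>3 = 0"
  using frame by (auto simp: orthonormal_frame_def tangent_space_def)

lemma inner_ee [simp]:
  "sf_inner \<kappa> e\<^sub>1 e\<^sub>1 = 1" "sf_inner \<kappa> e\<^sub>2 e\<^sub>2 = 1" "sf_inner \<kappa> e\<^sub>3 e\<^sub>3 = 1"
  "sf_inner \<kappa> e\<^sub>1 e\<^sub>2 = 0" "sf_inner \<kappa> e\<^sub>1 e\<^sub>3 = 0" "sf_inner \<kappa> e\<^sub>2 e\<^sub>3 = 0"
  "sf_inner \<kappa> e\<^sub>2 e\<^sub>1 = 0" "sf_inner \<kappa> e\<^sub>3 e\<^sub>1 = 0" "sf_inner \<kappa> e\<^sub>3 e\<^sub>2 = 0"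
  using frame by (auto simp: orthonormal_frame_def sf_inner_commute)

lemma spatial_e [simp]: "spatial \<kappa> e\<^sub>1" "spatial \<kappa> e\<^sub>2" "spatial \<kappa> e\<^sub>3"
  using frame p by (auto simp: orthonormal_frame_def intro: tangent_space_spatial)

lemma inner_pe: "\<kappa> * sf_inner \<kappa> p e\<^sub>1 = 0" "\<kappa> * sf_inner \<kappa> p e\<^sub>2 = 0" "\<kappa> * sf_inner \<kappa> p e\<^sub>3 = 0"
  using sf_quad_eq_sf_inner[OF \<kappa> spatial_e(1), of p] sf_quad_eq_sf_inner[OF \<kappa> spatial_e(2), of p]
    sf_quad_eq_sf_inner[OF \<kappa> spatial_e(3), of p] by simp_all

lemma inner_pp: "\<kappa> \<noteq> 0 \<Longrightarrow> sf_inner \<kappa> p p = \<kappa>"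
  using \<kappa> quad_pp sf_quad_eq_sf_inner[OF \<kappa>, of p p] by (auto simp: spatial_def)

text \<open>The four coordinate functionals are a left inverse of a linear endomorphism of \<open>\<real>\<^sup>4\<close>, which is
  therefore onto.\<close>

lemma expansion: "x = co0 x *\<^sub>R p + co1 x *\<^sub>R e\<^sub>1 + co2 x *\<^sub>R e\<^sub>2 + co3 x *\<^sub>R e\<^sub>3"
proof -
  define f :: "real^4 \<Rightarrow> real^4"
    where "f y = y$1 *\<^sub>R p + y$2 *\<^sub>R e\<^sub>1 + y$3 *\<^sub>R e\<^sub>2 + y$4 *\<^sub>R e\<^sub>3" for y
  have lin: "linear f"
    by (auto simp: linear_iff f_def algebra_simps)
  have co: "co0 (f y) = y$1" "co1 (f y) = y$2" "co2 (f y) = y$3" "co3 (f y) = y$4" for y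
    by (simp_all add: f_def sf_quad_simps sf_inner_simps)
  have "inj f"
  proof (rule injI)
    fix y z assume "f y = f z"
    then have "y $ 1 = z $ 1 \<and> y $ 2 = z $ 2 \<and> y $ 3 = z $ 3 \<and> y $ 4 = z $ 4"
      using co by metis
    then show "y = z"
      by (simp add: vec_eq_iff forall_4)
  qed
  then have "surj f"
    using lin linear_injective_imp_surjective by blast
  then obtain y where "x = f y" by (metis surjD)
  then show ?thesis
    using co by (simp add: f_def)
qed

lemma spatial_iff: "spatial \<kappa> x \<longleftrightarrow> (\<kappa> = 0 \<longrightarrow> co0 x = 0)"
  using p by (auto simp: spatial_def sf_quad_def dest: space_form_flat)

lemma spatial_co:
  assumes "spatial \<kappa> x"
  shows "co0 x = \<kappa> * sf_inner \<kappa> p x" "co1 x = sf_inner \<kappa> x e\<^sub>1" "co2 x = sf_inner \<kappa> x e\<^sub>2"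
    "co3 x = sf_inner \<kappa> x e\<^sub>3"
  using sf_quad_eq_sf_inner[OF \<kappa> assms, of p] inner_pe assms
  by (auto simp: sf_inner_simps spatial_iff)

lemma expansion_spatial:
  assumes "spatial \<kappa> x"
  shows "x = (\<kappa> * sf_inner \<kappa> p x) *\<^sub>R p + sf_inner \<kappa> x e\<^sub>1 *\<^sub>R e\<^sub>1 + sf_inner \<kappa> x e\<^sub>2 *\<^sub>R e\<^sub>2 + sf_inner \<kappa> x e\<^sub>3 *\<^sub>R e\<^sub>3"
  using expansion[of x] unfolding spatial_co(2-4)[OF assms] unfolding spatial_co(1)[OF assms] .

lemma inner_combination:
  assumes "\<kappa> = 0 \<Longrightarrow> x0 = 0" "\<kappa> = 0 \<Longrightarrow> y0 = 0"
  shows "sf_inner \<kappa> (x0 *\<^sub>R p + x1 *\<^sub>R e\<^sub>1 + x2 *\<^sub>R e\<^sub>2 + x3 *\<^sub>R e\<^sub>3) (y0 *\<^sub>R p + y1 *\<^sub>R e\<^sub>1 + y2 *\<^sub>R e\<^sub>2 + y3 *\<^sub>R e\<^sub>3)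
    = \<kappa> * x0 * y0 + x1 * y1 + x2 * y2 + x3 * y3"
proof (cases "\<kappa> = 0")
  case False
  then show ?thesis
    using inner_pe inner_pp
    by (simp add: sf_inner_simps sf_inner_commute[of _ e\<^sub>1 p] sf_inner_commute[of _ e\<^sub>2 p]
        sf_inner_commute[of _ e\<^sub>3 p])
next
  case True
  with assms have "x0 = 0" "y0 = 0" by auto
  then show ?thesis by (simp add: sf_inner_simps algebra_simps)
qed

lemma quad_combination:
  "sf_quad \<kappa> (x0 *\<^sub>R p + x1 *\<^sub>R e\<^sub>1 + x2 *\<^sub>R e\<^sub>2 + x3 *\<^sub>R e\<^sub>3) (y0 *\<^sub>R p + y1 *\<^sub>R e\<^sub>1 + y2 *\<^sub>R e\<^sub>2 + y3 *\<^sub>R e\<^sub>3)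
    = x0 * y0 + \<kappa> * (x1 * y1 + x2 * y2 + x3 * y3)"
  by (simp add: sf_quad_simps sf_quad_commute[of _ e\<^sub>1 p] sf_quad_commute[of _ e\<^sub>2 p]
      sf_quad_commute[of _ e\<^sub>3 p] sf_quad_eq_sf_inner[OF \<kappa>] algebra_simps)

lemma inner_eq_coordinates:
  assumes "spatial \<kappa> x" "spatial \<kappa> y"
  shows "sf_inner \<kappa> x y = \<kappa> * co0 x * co0 y + co1 x * co1 y + co2 x * co2 y + co3 x * co3 y"
proof -
  have "\<kappa> = 0 \<Longrightarrow> co0 x = 0" "\<kappa> = 0 \<Longrightarrow> co0 y = 0"
    using assms spatial_iff by blast+
  from inner_combination[OF this, of "co1 x" "co2 x" "co3 x" "co1 y" "co2 y" "co3 y"] show ?thesis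
    by (simp only: expansion[of x, symmetric] expansion[of y, symmetric])
qed

lemma quad_eq_coordinates:
  "sf_quad \<kappa> x y = co0 x * co0 y + \<kappa> * (co1 x * co1 y + co2 x * co2 y + co3 x * co3 y)"
  using quad_combination[of "co0 x" "co1 x" "co2 x" "co3 x" "co0 y" "co1 y" "co2 y" "co3 y"]
    expansion[of x, symmetric] expansion[of y, symmetric]
  by (simp only:)

lemma co_combination:
  "co0 (x0 *\<^sub>R p + x1 *\<^sub>R e\<^sub>1 + x2 *\<^sub>R e\<^sub>2 + x3 *\<^sub>R e\<^sub>3) = x0"
  "co1 (x0 *\<^sub>R p + x1 *\<^sub>R e\<^sub>1 + x2 *\<^sub>R e\<^sub>2 + x3 *\<^sub>R e\<^sub>3) = x1"
  "co2 (x0 *\<^sub>R p + x1 *\<^sub>R e\<^sub>1 + x2 *\<^sub>R e\<^sub>2 + x3 *\<^sub>R e\<^sub>3) = x2"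
  "co3 (x0 *\<^sub>R p + x1 *\<^sub>R e\<^sub>1 + x2 *\<^sub>R e\<^sub>2 + x3 *\<^sub>R e\<^sub>3) = x3"
  by (simp_all add: sf_quad_simps sf_inner_simps)

lemma eqI_co: "co0 x = co0 y \<Longrightarrow> co1 x = co1 y \<Longrightarrow> co2 x = co2 y \<Longrightarrow> co3 x = co3 y \<Longrightarrow> x = y"
  using expansion[of x] expansion[of y] by metis

text \<open>This covers both kinds of symmetries of the surfaces below: \<open>\<epsilon> = 1\<close> gives the rotations about the axis
  \<open>e\<^sub>3\<close>, and \<open>\<epsilon> = - 1\<close> with \<open>s = 0\<close> the reflection in the plane orthogonal to it.\<close>

lemma axial_isometry:
  assumes L: "linear L" "L p = p" "L e\<^sub>1 = c *\<^sub>R e\<^sub>1 + s *\<^sub>R e\<^sub>2" "L e\<^sub>2 = c *\<^sub>R e\<^sub>2 - s *\<^sub>R e\<^sub>1" "L e\<^sub>3 = \<epsilon> *\<^sub>R e\<^sub>3"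
    and cs: "c\<^sup>2 + s\<^sup>2 = 1" "\<epsilon>\<^sup>2 = 1"
  shows "co0 (L x) = co0 x" "co1 (L x) = c * co1 x - s * co2 x" "co2 (L x) = s * co1 x + c * co2 x"
    "co3 (L x) = \<epsilon> * co3 x"
    "spatial \<kappa> x \<Longrightarrow> spatial \<kappa> (L x)"
    "spatial \<kappa> x \<Longrightarrow> spatial \<kappa> y \<Longrightarrow> sf_inner \<kappa> (L x) (L y) = sf_inner \<kappa> x y"
    "sf_quad \<kappa> (L x) (L y) = sf_quad \<kappa> x y"
proof -
  have Lx: "L x = co0 x *\<^sub>R p + (c * co1 x - s * co2 x) *\<^sub>R e\<^sub>1 + (s * co1 x + c * co2 x) *\<^sub>R e\<^sub>2
      + (\<epsilon> * co3 x) *\<^sub>R e\<^sub>3" for x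
  proof -
    have "L x = L (co0 x *\<^sub>R p + co1 x *\<^sub>R e\<^sub>1 + co2 x *\<^sub>R e\<^sub>2 + co3 x *\<^sub>R e\<^sub>3)"
      using expansion by presburger
    also have "\<dots> = co0 x *\<^sub>R L p + co1 x *\<^sub>R L e\<^sub>1 + co2 x *\<^sub>R L e\<^sub>2 + co3 x *\<^sub>R L e\<^sub>3"
      by (simp only: linear_add[OF L(1)] linear_scale[OF L(1)])
    finally show ?thesis
      by (simp only: L(2-5)) (simp add: algebra_simps)
  qed
  show co: "co0 (L x) = co0 x" "co1 (L x) = c * co1 x - s * co2 x"
    "co2 (L x) = s * co1 x + c * co2 x" "co3 (L x) = \<epsilon> * co3 x" for x
    unfolding Lx[of x] by (rule co_combination)+
  show sp: "spatial \<kappa> (L x)" if "spatial \<kappa> x" for x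
    using that by (simp only: spatial_iff co simp_thms)
  have cc: "(c * x1 - s * x2) * (c * y1 - s * y2) + (s * x1 + c * x2) * (s * y1 + c * y2) + \<epsilon> * x3 * (\<epsilon> * y3)
      = x1 * y1 + x2 * y2 + x3 * y3" for x1 x2 x3 y1 y2 y3
  proof -
    have "(c * x1 - s * x2) * (c * y1 - s * y2) + (s * x1 + c * x2) * (s * y1 + c * y2) + \<epsilon> * x3 * (\<epsilon> * y3)
        = (c\<^sup>2 + s\<^sup>2) * (x1 * y1 + x2 * y2) + \<epsilon>\<^sup>2 * (x3 * y3)"
      by (simp add: power2_eq_square algebra_simps)
    then show ?thesis using cs by simp
  qed
  show "sf_inner \<kappa> (L x) (L y) = sf_inner \<kappa> x y" if "spatial \<kappa> x" "spatial \<kappa> y"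
    unfolding inner_eq_coordinates[OF sp[OF that(1)] sp[OF that(2)]] inner_eq_coordinates[OF that] co(2-4) unfolding co(1)
    using cc[of "co1 x" "co2 x" "co1 y" "co2 y" "co3 x" "co3 y"] by linarith
  show "sf_quad \<kappa> (L x) (L y) = sf_quad \<kappa> x y"
    unfolding quad_eq_coordinates[of "L x"] quad_eq_coordinates[of x] co(2-4) unfolding co(1)
    using cc[of "co1 x" "co2 x" "co1 y" "co2 y" "co3 x" "co3 y"] by simp
qed

text \<open>The rotation of the space form extends to a linear map, which acts on position vectors and on
  velocities alike. In the flat case, linearity is achieved by subtracting the multiple \<open>co0 x\<close> of \<open>p\<close>
  instead of \<open>p\<close> itself.\<close>

definition rot :: "real \<Rightarrow> real^4 \<Rightarrow> real^4" where
  "rot t x = x + (cos t - 1) *\<^sub>R (co1 x *\<^sub>R e\<^sub>1 + co2 x *\<^sub>R e\<^sub>2) + sin t *\<^sub>R (co1 x *\<^sub>R e\<^sub>2 - co2 x *\<^sub>R e\<^sub>1)"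

lemma linear_rot: "linear (rot t)"
  by (auto simp: linear_iff rot_def sf_inner_simps sf_quad_simps algebra_simps)

lemma rot_basis:
  "rot t p = p" "rot t e\<^sub>1 = cos t *\<^sub>R e\<^sub>1 + sin t *\<^sub>R e\<^sub>2" "rot t e\<^sub>2 = cos t *\<^sub>R e\<^sub>2 - sin t *\<^sub>R e\<^sub>1" "rot t e\<^sub>3 = 1 *\<^sub>R e\<^sub>3"
  by (simp_all add: rot_def sf_inner_simps sf_quad_simps algebra_simps)

lemmas rot_isometry = axial_isometry[OF linear_rot rot_basis sin_cos_squared_add2 power_one]

lemma co_space_form:
  assumes "x \<in> space_form \<kappa>"
  shows "co1 x = sf_inner \<kappa> (x - p) e\<^sub>1" "co2 x = sf_inner \<kappa> (x - p) e\<^sub>2"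
proof -
  have "sf_inner \<kappa> (x - p) e\<^sub>1 = co1 x \<and> sf_inner \<kappa> (x - p) e\<^sub>2 = co2 x"
  proof (cases "\<kappa> = 0")
    case True
    then have "co0 x = 1"
      using assms p space_form_flat by (auto simp: sf_quad_def)
    then show ?thesis by simp
  qed (use inner_pe in \<open>auto simp: sf_inner_simps\<close>)
  then show "co1 x = sf_inner \<kappa> (x - p) e\<^sub>1" "co2 x = sf_inner \<kappa> (x - p) e\<^sub>2" by simp_all
qed

lemma rotation_eq_rot:
  "x \<in> space_form \<kappa> \<Longrightarrow> rotation \<kappa> p e\<^sub>1 e\<^sub>2 t x = rot t x"
  by (simp add: rotation_def rot_def Let_def co_space_form)

text \<open>This is applied at a point \<open>p\<close> of a surface, with tangent plane spanned by \<open>e\<^sub>1\<close>, \<open>e\<^sub>3\<close> and unit normal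
  \<open>e\<^sub>2\<close>: another unit normal is \<open>\<plusminus>e\<^sub>2\<close>.\<close>

lemma unit_normal_unique:
  assumes "m \<in> tangent_space \<kappa> p" "sf_inner \<kappa> m e\<^sub>1 = 0" "sf_inner \<kappa> m e\<^sub>3 = 0" "sf_inner \<kappa> m m = 1"
  shows "m = sf_inner \<kappa> m e\<^sub>2 *\<^sub>R e\<^sub>2" "(sf_inner \<kappa> m e\<^sub>2)\<^sup>2 = 1"
proof -
  have sp: "spatial \<kappa> m" using tangent_space_spatial[OF p assms(1)] .
  have 0: "\<kappa> * sf_inner \<kappa> p m = 0"
    using assms(1) sf_quad_eq_sf_inner[OF \<kappa> sp, of p] by (simp add: tangent_space_def)
  show eq: "m = sf_inner \<kappa> m e\<^sub>2 *\<^sub>R e\<^sub>2"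
    using expansion_spatial[OF sp] unfolding 0 assms(2,3) scaleR_zero_left add_0_left add_0_right .
  have "sf_inner \<kappa> m m = (sf_inner \<kappa> m e\<^sub>2)\<^sup>2"
    by (subst (2) eq) (simp add: sf_inner_simps power2_eq_square)
  then show "(sf_inner \<kappa> m e\<^sub>2)\<^sup>2 = 1" using assms(4) by simp
qed

lemma bounded_linear_rot: "bounded_linear (rot t)"
  using linear_rot linear_conv_bounded_linear by blast

lemma rot_0 [simp]: "rot 0 x = x"
  by (simp add: rot_def)

lemma has_vector_derivative_rot:
  assumes "co2 x = 0"
  shows "((\<lambda>t. rot t x) has_vector_derivative co1 x *\<^sub>R rot \<theta> e\<^sub>2) (at \<theta>)"
  unfolding rot_basis rot_def assms
  by (auto intro!: derivative_eq_intros simp: has_real_derivative_iff_has_vector_derivative[symmetric] algebra_simps)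

end

section \<open>Variations of profile curves of rotational minimal surfaces\<close>

lemma has_vector_derivative_eq_0:
  assumes "(f has_vector_derivative d) (at x within S)" "\<And>y. y \<in> S \<Longrightarrow> f y = C"
    and "x \<in> S" "at x within S \<noteq> bot"
  shows "d = 0"
proof -
  have "(f has_vector_derivative 0) (at x within S)"
    by (rule has_vector_derivative_transform[OF assms(3) _ has_vector_derivative_const[of C]]) (rule assms(2))
  then show ?thesis
    using vector_derivative_unique_within assms by blast
qed

lemma has_vector_derivative_bilinear:
  assumes "bounded_bilinear B" "(f has_vector_derivative f') (at x within S)"
    "(g has_vector_derivative g') (at x within S)"
  shows "((\<lambda>t. B (f t) (g t)) has_real_derivative B (f x) g' + B f' (g x)) (at x within S)"
  using bounded_bilinear.has_vector_derivative[OF assms]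
  by (simp add: has_real_derivative_iff_has_vector_derivative)

lemma bilinear_const_derivative:
  fixes B :: "'a::real_normed_vector \<Rightarrow> 'b::real_normed_vector \<Rightarrow> real"
  assumes "bounded_bilinear B" "(f has_vector_derivative f') (at x within S)"
    "(g has_vector_derivative g') (at x within S)"
    and "\<And>y. y \<in> S \<Longrightarrow> B (f y) (g y) = C" "x \<in> S" "at x within S \<noteq> bot"
  shows "B (f x) g' + B f' (g x) = 0"
  using has_vector_derivative_eq_0[OF bounded_bilinear.has_vector_derivative[OF assms(1-3)] assms(4-6)] .

text \<open>The profile \<open>\<gamma> a\<close> of a rotational minimal surface, traversed with constant speed \<open>c a\<close> and with unit
  normal \<open>n a\<close>, moves with the parameter \<open>a\<close>. The rotation acts in the plane of \<open>e\<^sub>1\<close>, \<open>e\<^sub>2\<close>; the letters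
  \<open>a\<close>, \<open>s\<close> after \<open>\<gamma>\<close> or \<open>n\<close> denote partial derivatives. The last condition is minimality: one principal
  curvature belongs to the profile, and the other one, that of the parallel circles, is
  \<open>\<langle>n, e\<^sub>1\<rangle> / \<langle>\<gamma> - p, e\<^sub>1\<rangle>\<close>.\<close>

locale profile_family =
  fixes \<kappa> :: real and I J :: "real set" and c :: "real \<Rightarrow> real"
    and p e\<^sub>1 e\<^sub>2 :: "real^4"
    and \<gamma> n \<gamma>a \<gamma>s na ns \<gamma>as \<gamma>ss \<gamma>ass :: "real \<Rightarrow> real \<Rightarrow> real^4"
  assumes \<kappa>: "\<kappa> \<in> {-1, 0, 1}"
    and I_lim: "\<And>a. a \<in> I \<Longrightarrow> at a within I \<noteq> bot" and J_lim: "\<And>s. s \<in> J \<Longrightarrow> at s within J \<noteq> bot"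
    and D\<gamma>: "\<And>a s. a \<in> I \<Longrightarrow> s \<in> J \<Longrightarrow> ((\<lambda>b. \<gamma> b s) has_vector_derivative \<gamma>a a s) (at a within I)"
      "\<And>a s. a \<in> I \<Longrightarrow> s \<in> J \<Longrightarrow> (\<gamma> a has_vector_derivative \<gamma>s a s) (at s within J)"
    and Dn: "\<And>a s. a \<in> I \<Longrightarrow> s \<in> J \<Longrightarrow> ((\<lambda>b. n b s) has_vector_derivative na a s) (at a within I)"
      "\<And>a s. a \<in> I \<Longrightarrow> s \<in> J \<Longrightarrow> (n a has_vector_derivative ns a s) (at s within J)"
    and D\<gamma>a: "\<And>a s. a \<in> I \<Longrightarrow> s \<in> J \<Longrightarrow> (\<gamma>a a has_vector_derivative \<gamma>as a s) (at s within J)"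
    and D\<gamma>s: "\<And>a s. a \<in> I \<Longrightarrow> s \<in> J \<Longrightarrow> ((\<lambda>b. \<gamma>s b s) has_vector_derivative \<gamma>as a s) (at a within I)"
      "\<And>a s. a \<in> I \<Longrightarrow> s \<in> J \<Longrightarrow> (\<gamma>s a has_vector_derivative \<gamma>ss a s) (at s within J)"
    and D\<gamma>as: "\<And>a s. a \<in> I \<Longrightarrow> s \<in> J \<Longrightarrow> (\<gamma>as a has_vector_derivative \<gamma>ass a s) (at s within J)"
    and D\<gamma>ss: "\<And>a s. a \<in> I \<Longrightarrow> s \<in> J \<Longrightarrow> ((\<lambda>b. \<gamma>ss b s) has_vector_derivative \<gamma>ass a s) (at a within I)"
    and \<gamma>_in: "\<And>a s. a \<in> I \<Longrightarrow> s \<in> J \<Longrightarrow> \<gamma> a s \<in> space_form \<kappa>"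
    and e2_spatial: "spatial \<kappa> e\<^sub>2"
    and e22: "sf_inner \<kappa> e\<^sub>2 e\<^sub>2 = 1"
    and pe: "\<kappa> * sf_inner \<kappa> p e\<^sub>1 = 0" "\<kappa> * sf_inner \<kappa> p e\<^sub>2 = 0"
    and \<gamma>_e2: "\<And>a s. a \<in> I \<Longrightarrow> s \<in> J \<Longrightarrow> sf_inner \<kappa> (\<gamma> a s - p) e\<^sub>2 = 0"
    and \<gamma>_e1: "\<And>a s. a \<in> I \<Longrightarrow> s \<in> J \<Longrightarrow> sf_inner \<kappa> (\<gamma> a s - p) e\<^sub>1 > 0"
    and speed: "\<And>a s. a \<in> I \<Longrightarrow> s \<in> J \<Longrightarrow> sf_inner \<kappa> (\<gamma>s a s) (\<gamma>s a s) = (c a)\<^sup>2"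
    and c_pos: "\<And>a. a \<in> I \<Longrightarrow> c a > 0"
    and n_tangent: "\<And>a s. a \<in> I \<Longrightarrow> s \<in> J \<Longrightarrow> n a s \<in> tangent_space \<kappa> (\<gamma> a s)"
    and n_n: "\<And>a s. a \<in> I \<Longrightarrow> s \<in> J \<Longrightarrow> sf_inner \<kappa> (n a s) (n a s) = 1"
    and n_\<gamma>s: "\<And>a s. a \<in> I \<Longrightarrow> s \<in> J \<Longrightarrow> sf_inner \<kappa> (n a s) (\<gamma>s a s) = 0"
    and n_e2: "\<And>a s. a \<in> I \<Longrightarrow> s \<in> J \<Longrightarrow> sf_inner \<kappa> (n a s) e\<^sub>2 = 0"
    and minimal: "\<And>a s. a \<in> I \<Longrightarrow> s \<in> J \<Longrightarrow>
      sf_inner \<kappa> (ns a s) (\<gamma>s a s) = - (c a)\<^sup>2 * (sf_inner \<kappa> (n a s) e\<^sub>1 / sf_inner \<kappa> (\<gamma> a s - p) e\<^sub>1)"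
begin

text \<open>The velocity of the variation has normal part \<open>\<phi>\<close> and tangential part \<open>\<tau> / c\<close>; \<open>\<psi> / c\<close> is the speed at
  which the unit tangent turns.\<close>

definition w where "w a s = sf_inner \<kappa> (\<gamma> a s - p) e\<^sub>1"
definition k where "k a s = sf_inner \<kappa> (n a s) e\<^sub>1 / w a s"
definition \<phi> where "\<phi> a s = sf_inner \<kappa> (\<gamma>a a s) (n a s)"
definition \<psi> where "\<psi> a s = sf_inner \<kappa> (\<gamma>as a s) (n a s)"
definition \<tau> where "\<tau> a s = sf_inner \<kappa> (\<gamma>a a s) (\<gamma>s a s)"

abbreviation B where "B \<equiv> sf_inner \<kappa>"

lemmas Dinner = has_vector_derivative_bilinear[OF sf_inner.bounded_bilinear_axioms[of \<kappa>]]
lemmas inner_const = bilinear_const_derivative[OF sf_inner.bounded_bilinear_axioms[of \<kappa>]]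

lemma spatial_derivative:
  assumes "(f has_vector_derivative f') (at x within S)" "x \<in> S" "at x within S \<noteq> bot"
    and "\<And>y. y \<in> S \<Longrightarrow> spatial \<kappa> (f y - q)"
  shows "spatial \<kappa> f'"
  unfolding spatial_def
proof
  assume "\<kappa> = 0"
  then have "f y $ 1 = q $ 1" if "y \<in> S" for y
    using assms(4)[OF that] by (simp add: spatial_def)
  then show "f' $ 1 = 0"
    using has_vector_derivative_eq_0[OF bounded_linear.has_vector_derivative[OF bounded_linear_vec_nth assms(1)]
        _ assms(2,3)] by blast
qed

lemma lim: "a \<in> I \<Longrightarrow> s \<in> J \<Longrightarrow> at a within I \<noteq> bot" "a \<in> I \<Longrightarrow> s \<in> J \<Longrightarrow> at s within J \<noteq> bot"
  using I_lim J_lim by auto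

lemma spatial_\<gamma>:
  "a \<in> I \<Longrightarrow> s \<in> J \<Longrightarrow> b \<in> I \<Longrightarrow> t \<in> J \<Longrightarrow> spatial \<kappa> (\<gamma> a s - \<gamma> b t)"
  using \<gamma>_in[of a s] \<gamma>_in[of b t] by (auto simp: spatial_def space_form_flat)

lemma spatial_first:
  assumes "a \<in> I" "s \<in> J"
  shows "spatial \<kappa> (\<gamma>a a s)" "spatial \<kappa> (\<gamma>s a s)" "spatial \<kappa> (n a s)"
  using spatial_derivative[OF D\<gamma>(1) _ lim(1)] spatial_derivative[OF D\<gamma>(2) _ lim(2)] assms spatial_\<gamma>
    tangent_space_spatial[OF \<gamma>_in n_tangent] by blast+

lemma spatial_second:
  assumes "a \<in> I" "s \<in> J"
  shows "spatial \<kappa> (\<gamma>as a s)" "spatial \<kappa> (\<gamma>ss a s)" "spatial \<kappa> (na a s)" "spatial \<kappa> (ns a s)"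
  using spatial_derivative[OF D\<gamma>s(1) _ lim(1), where q = 0] spatial_derivative[OF D\<gamma>s(2) _ lim(2), where q = 0]
    spatial_derivative[OF Dn(1) _ lim(1), where q = 0] spatial_derivative[OF Dn(2) _ lim(2), where q = 0] assms
  by (simp_all add: spatial_first)

lemma w_pos: "a \<in> I \<Longrightarrow> s \<in> J \<Longrightarrow> w a s > 0"
  using \<gamma>_e1 by (simp add: w_def)

lemma quad_\<gamma>\<gamma>: "a \<in> I \<Longrightarrow> s \<in> J \<Longrightarrow> sf_quad \<kappa> (\<gamma> a s) (\<gamma> a s) = 1"
  using \<gamma>_in by (simp add: space_form_def)

lemma \<gamma>_\<gamma>s: "a \<in> I \<Longrightarrow> s \<in> J \<Longrightarrow> sf_quad \<kappa> (\<gamma> a s) (\<gamma>s a s) = 0"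
  using bilinear_const_derivative[OF sf_quad.bounded_bilinear_axioms D\<gamma>(2) D\<gamma>(2) quad_\<gamma>\<gamma> _ lim(2)]
  by (simp add: sf_quad_commute)

lemma \<gamma>_\<gamma>a: "a \<in> I \<Longrightarrow> s \<in> J \<Longrightarrow> sf_quad \<kappa> (\<gamma> a s) (\<gamma>a a s) = 0"
  using bilinear_const_derivative[OF sf_quad.bounded_bilinear_axioms D\<gamma>(1) D\<gamma>(1) quad_\<gamma>\<gamma> _ lim(1)]
  by (simp add: sf_quad_commute)

lemma \<gamma>_n: "a \<in> I \<Longrightarrow> s \<in> J \<Longrightarrow> sf_quad \<kappa> (\<gamma> a s) (n a s) = 0"
  using n_tangent by (simp add: tangent_space_def)

lemma const_e2:
  assumes "((\<lambda>t. f t) has_vector_derivative f') (at x within S)" "x \<in> S" "at x within S \<noteq> bot"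
    "\<And>y. y \<in> S \<Longrightarrow> sf_inner \<kappa> (f y) e\<^sub>2 = C"
  shows "sf_inner \<kappa> f' e\<^sub>2 = 0"
  using inner_const[OF assms(1) has_vector_derivative_const assms(4) assms(2,3)] by (simp add: sf_inner_simps)

lemma ortho_e2:
  assumes "a \<in> I" "s \<in> J"
  shows "B (\<gamma>a a s) e\<^sub>2 = 0" "B (\<gamma>s a s) e\<^sub>2 = 0" "B (na a s) e\<^sub>2 = 0" "B (ns a s) e\<^sub>2 = 0"
proof -
  have g: "B (\<gamma> b t) e\<^sub>2 = B p e\<^sub>2" if "b \<in> I" "t \<in> J" for b t
    using \<gamma>_e2[OF that] by (simp add: sf_inner_simps)
  show "B (\<gamma>a a s) e\<^sub>2 = 0" "B (\<gamma>s a s) e\<^sub>2 = 0"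
    using const_e2[OF D\<gamma>(1) _ lim(1) g] const_e2[OF D\<gamma>(2) _ lim(2) g] assms by blast+
  show "B (na a s) e\<^sub>2 = 0" "B (ns a s) e\<^sub>2 = 0"
    using const_e2[OF Dn(1) _ lim(1) n_e2] const_e2[OF Dn(2) _ lim(2) n_e2] assms by blast+
qed

lemma \<gamma>ss_e2: "a \<in> I \<Longrightarrow> s \<in> J \<Longrightarrow> B (\<gamma>ss a s) e\<^sub>2 = 0"
  using const_e2[OF D\<gamma>s(2) _ lim(2) ortho_e2(2)] by blast

text \<open>The moving frame of the profile, completed by the direction of rotation.\<close>

lemma moving_frame:
  assumes "a \<in> I" "s \<in> J"
  shows "sf_frame \<kappa> (\<gamma> a s) ((1 / c a) *\<^sub>R \<gamma>s a s) (n a s) e\<^sub>2"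
proof
  have "\<kappa> * sf_inner \<kappa> (\<gamma> a s) e\<^sub>2 = 0"
    using \<gamma>_e2[OF assms] pe(2) by (auto simp: sf_inner_simps)
  then have "sf_quad \<kappa> (\<gamma> a s) e\<^sub>2 = 0"
    using sf_quad_eq_sf_inner[OF \<kappa> e2_spatial] by simp
  then show "orthonormal_frame \<kappa> (\<gamma> a s) ((1 / c a) *\<^sub>R \<gamma>s a s) (n a s) e\<^sub>2"
    unfolding orthonormal_frame_def tangent_space_def
    using \<gamma>_\<gamma>s \<gamma>_n e22 speed c_pos[of a] n_n n_\<gamma>s n_e2 ortho_e2(2) assms
    by (simp add: sf_inner_simps sf_quad_simps sf_inner_commute[of _ "\<gamma>s a s" "n a s"] power2_eq_square)
qed (use \<kappa> \<gamma>_in assms in auto)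

lemma frame_expansion:
  assumes "a \<in> I" "s \<in> J" "spatial \<kappa> x"
  shows "x = (\<kappa> * B (\<gamma> a s) x) *\<^sub>R \<gamma> a s + (B x (\<gamma>s a s) / (c a)\<^sup>2) *\<^sub>R \<gamma>s a s + B x (n a s) *\<^sub>R n a s
    + B x e\<^sub>2 *\<^sub>R e\<^sub>2"
  using sf_frame.expansion_spatial[OF moving_frame[OF assms(1,2)] assms(3)]
  by (simp add: sf_inner_simps power2_eq_square)

text \<open>Orthogonality to the position vector, in a form valid for all curvatures: with the factor \<open>\<kappa>\<close> the
  equations are trivial in the flat case, where the position vector is not normal to the space form.\<close>

lemma inner_position:
  assumes "a \<in> I" "s \<in> J"
  shows "\<kappa> * B (\<gamma> a s) (\<gamma>a a s) = 0" "\<kappa> * B (\<gamma> a s) (\<gamma>s a s) = 0" "\<kappa> * B (\<gamma> a s) (n a s) = 0"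
  using \<gamma>_\<gamma>s \<gamma>_\<gamma>a \<gamma>_n assms sf_quad_eq_sf_inner[OF \<kappa>] spatial_first by metis+

lemma \<kappa>_inner_const:
  assumes "(f has_vector_derivative f') (at x within S)" "(g has_vector_derivative g') (at x within S)"
    "\<And>y. y \<in> S \<Longrightarrow> \<kappa> * sf_inner \<kappa> (f y) (g y) = 0" "x \<in> S" "at x within S \<noteq> bot"
  shows "\<kappa> * (B (f x) g' + B f' (g x)) = 0"
proof (cases "\<kappa> = 0")
  case False
  then have "B (f y) (g y) = 0" if "y \<in> S" for y using assms(3)[OF that] by simp
  from inner_const[OF assms(1,2) this assms(4,5)] show ?thesis by simp
qed simp

lemma inner_position_derivative:
  assumes "a \<in> I" "s \<in> J"
  shows "\<kappa> * B (\<gamma> a s) (na a s) = - \<kappa> * \<phi> a s" "\<kappa> * B (\<gamma> a s) (ns a s) = 0"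
    "\<kappa> * B (\<gamma> a s) (\<gamma>ss a s) = - \<kappa> * (c a)\<^sup>2" "\<kappa> * B (\<gamma> a s) (\<gamma>as a s) = - \<kappa> * \<tau> a s"
proof -
  have "\<kappa> * (B (\<gamma> a s) (na a s) + B (\<gamma>a a s) (n a s)) = 0"
    using \<kappa>_inner_const[OF D\<gamma>(1) Dn(1) inner_position(3) _ lim(1)] assms by blast
  then show "\<kappa> * B (\<gamma> a s) (na a s) = - \<kappa> * \<phi> a s"
    by (simp add: \<phi>_def algebra_simps)
  have "\<kappa> * (B (\<gamma> a s) (ns a s) + B (\<gamma>s a s) (n a s)) = 0"
    using \<kappa>_inner_const[OF D\<gamma>(2) Dn(2) inner_position(3) _ lim(2)] assms by blast
  then show "\<kappa> * B (\<gamma> a s) (ns a s) = 0"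
    using n_\<gamma>s assms by (simp add: sf_inner_commute)
  have "\<kappa> * (B (\<gamma> a s) (\<gamma>ss a s) + B (\<gamma>s a s) (\<gamma>s a s)) = 0"
    using \<kappa>_inner_const[OF D\<gamma>(2) D\<gamma>s(2) inner_position(2) _ lim(2)] assms by blast
  then show "\<kappa> * B (\<gamma> a s) (\<gamma>ss a s) = - \<kappa> * (c a)\<^sup>2"
    using speed assms by (simp add: algebra_simps)
  have "\<kappa> * (B (\<gamma> a s) (\<gamma>as a s) + B (\<gamma>a a s) (\<gamma>s a s)) = 0"
    using \<kappa>_inner_const[OF D\<gamma>(1) D\<gamma>s(1) inner_position(2) _ lim(1)] assms by blast
  then show "\<kappa> * B (\<gamma> a s) (\<gamma>as a s) = - \<kappa> * \<tau> a s"
    by (simp add: \<tau>_def algebra_simps)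
qed

text \<open>The Frenet equations of the profile: its geodesic curvature is the principal curvature of the
  parallel circles, by minimality.\<close>

lemma ns_eq: 
  assumes "a \<in> I" "s \<in> J"
  shows "ns a s = - k a s *\<^sub>R \<gamma>s a s"
proof -
  have "B (n a s) (ns a s) + B (ns a s) (n a s) = 0"
    using inner_const[OF Dn(2) Dn(2) n_n _ lim(2)] assms by blast
  then have "B (ns a s) (n a s) = 0"
    by (simp add: sf_inner_commute)
  then show ?thesis
    using frame_expansion[OF assms spatial_second(4)[OF assms]] inner_position_derivative(2)[OF assms] minimal[OF assms]
      ortho_e2(4)[OF assms] c_pos[OF assms(1)]
    by (simp add: k_def w_def)
qed

lemma \<gamma>ss_eq:
  assumes "a \<in> I" "s \<in> J"
  shows "\<gamma>ss a s = - (\<kappa> * (c a)\<^sup>2) *\<^sub>R \<gamma> a s + (k a s * (c a)\<^sup>2) *\<^sub>R n a s"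
proof -
  have "B (\<gamma>s a s) (\<gamma>ss a s) + B (\<gamma>ss a s) (\<gamma>s a s) = 0"
    using inner_const[OF D\<gamma>s(2) D\<gamma>s(2) speed _ lim(2)] assms by blast
  then have 1: "B (\<gamma>ss a s) (\<gamma>s a s) = 0"
    by (simp add: sf_inner_commute)
  have "B (n a s) (\<gamma>ss a s) + B (ns a s) (\<gamma>s a s) = 0"
    using inner_const[OF Dn(2) D\<gamma>s(2) n_\<gamma>s _ lim(2)] assms by blast
  then have "B (\<gamma>ss a s) (n a s) = k a s * (c a)\<^sup>2"
    using speed assms by (simp add: ns_eq sf_inner_simps sf_inner_commute[of _ "n a s"])
  then show ?thesis
    using frame_expansion[OF assms spatial_second(2)[OF assms]] 1 inner_position_derivative(3)[OF assms] \<gamma>ss_e2[OF assms]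
    by simp
qed

lemma D\<phi>:
  assumes "a \<in> I" "s \<in> J"
  shows "(\<phi> a has_real_derivative \<psi> a s - k a s * \<tau> a s) (at s within J)"
  unfolding \<phi>_def
  by (rule DERIV_cong[OF Dinner[OF D\<gamma>a Dn(2)]])
    (use assms in \<open>simp_all add: ns_eq \<psi>_def \<tau>_def sf_inner_simps\<close>)

lemma Dw:
  assumes "a \<in> I" "s \<in> J"
  shows "(w a has_real_derivative B (\<gamma>s a s) e\<^sub>1) (at s within J)"
    "((\<lambda>b. w b s) has_real_derivative B (\<gamma>a a s) e\<^sub>1) (at a within I)"
proof -
  show "(w a has_real_derivative B (\<gamma>s a s) e\<^sub>1) (at s within J)"
    unfolding w_def using assms
    by (intro DERIV_cong[OF Dinner[OF has_vector_derivative_diff[OF D\<gamma>(2) has_vector_derivative_const]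
        has_vector_derivative_const]]) (auto simp: sf_inner_simps)
  show "((\<lambda>b. w b s) has_real_derivative B (\<gamma>a a s) e\<^sub>1) (at a within I)"
    unfolding w_def using assms
    by (intro DERIV_cong[OF Dinner[OF has_vector_derivative_diff[OF D\<gamma>(1) has_vector_derivative_const]
        has_vector_derivative_const]]) (auto simp: sf_inner_simps)
qed

lemma Dk:
  assumes "a \<in> I" "s \<in> J"
  shows "(k a has_real_derivative - 2 * k a s * B (\<gamma>s a s) e\<^sub>1 / w a s) (at s within J)"
    "((\<lambda>b. k b s) has_real_derivative (B (na a s) e\<^sub>1 - k a s * B (\<gamma>a a s) e\<^sub>1) / w a s) (at a within I)"
proof -
  have w: "w a s \<noteq> 0" using w_pos[OF assms] by simp
  have kw: "B (n a s) e\<^sub>1 = k a s * w a s" using w by (simp add: k_def)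
  have "((\<lambda>s. B (n a s) e\<^sub>1 / w a s) has_real_derivative
      ((B (n a s) 0 + B (ns a s) e\<^sub>1) * w a s - B (n a s) e\<^sub>1 * B (\<gamma>s a s) e\<^sub>1) / (w a s * w a s)) (at s within J)"
    using assms w by (intro DERIV_divide Dinner Dn has_vector_derivative_const Dw)
  then show "(k a has_real_derivative - 2 * k a s * B (\<gamma>s a s) e\<^sub>1 / w a s) (at s within J)"
    unfolding k_def[symmetric]
    by (rule DERIV_cong) (use w in \<open>simp add: kw ns_eq[OF assms] sf_inner_simps field_simps\<close>)
  have "((\<lambda>b. B (n b s) e\<^sub>1 / w b s) has_real_derivative
      ((B (n a s) 0 + B (na a s) e\<^sub>1) * w a s - B (n a s) e\<^sub>1 * B (\<gamma>a a s) e\<^sub>1) / (w a s * w a s)) (at a within I)"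
    using assms w by (intro DERIV_divide Dinner Dn has_vector_derivative_const Dw)
  then show "((\<lambda>b. k b s) has_real_derivative (B (na a s) e\<^sub>1 - k a s * B (\<gamma>a a s) e\<^sub>1) / w a s) (at a within I)"
    unfolding k_def[symmetric]
    by (rule DERIV_cong) (use w in \<open>simp add: kw sf_inner_simps field_simps\<close>)
qed

lemma D\<tau>:
  assumes "a \<in> I" "s \<in> J"
  shows "(\<tau> a has_real_derivative B (\<gamma>as a s) (\<gamma>s a s) + (c a)\<^sup>2 * k a s * \<phi> a s) (at s within J)"
  unfolding \<tau>_def
  by (rule DERIV_cong[OF Dinner[OF D\<gamma>a D\<gamma>s(2)]])
    (use assms inner_position(1)[OF assms] in
      \<open>auto simp: \<gamma>ss_eq \<phi>_def sf_inner_simps sf_inner_commute[of _ "\<gamma>a a s" "\<gamma> a s"]\<close>)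

text \<open>The mixed third derivative of \<open>\<gamma>\<close> is eliminated by differentiating \<open>\<langle>\<gamma>\<^sub>s\<^sub>s, n\<rangle> = k c\<^sup>2\<close> in the parameter.\<close>

lemma D\<psi>:
  assumes "a \<in> I" "s \<in> J"
  shows "(\<psi> a has_real_derivative
    (c a)\<^sup>2 * ((B (na a s) e\<^sub>1 - k a s * B (\<gamma>a a s) e\<^sub>1) / w a s) + k a s * B (\<gamma>as a s) (\<gamma>s a s)
      - \<kappa> * (c a)\<^sup>2 * \<phi> a s) (at s within J)"
proof -
  let ?ka = "(B (na a s) e\<^sub>1 - k a s * B (\<gamma>a a s) e\<^sub>1) / w a s"
  let ?m = "B (\<gamma>as a s) (\<gamma>s a s)"
  have "B (\<gamma>ss b s) (n b s) - k b s * B (\<gamma>s b s) (\<gamma>s b s) = 0" if "b \<in> I" for b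
    using that assms inner_position(3)[OF that assms(2)]
    by (auto simp: \<gamma>ss_eq sf_inner_simps n_n speed)
  moreover have "((\<lambda>b. B (\<gamma>ss b s) (n b s) - k b s * B (\<gamma>s b s) (\<gamma>s b s)) has_real_derivative
      B (\<gamma>ss a s) (na a s) + B (\<gamma>ass a s) (n a s) - (k a s * (?m + ?m) + ?ka * (c a)\<^sup>2)) (at a within I)"
    using assms
    by (intro DERIV_cong[OF DERIV_diff[OF Dinner[OF D\<gamma>ss Dn(1)] DERIV_mult[OF Dk(2) Dinner[OF D\<gamma>s(1) D\<gamma>s(1)]]]])
      (auto simp: speed sf_inner_commute algebra_simps)
  ultimately have "B (\<gamma>ss a s) (na a s) + B (\<gamma>ass a s) (n a s) - (k a s * (?m + ?m) + ?ka * (c a)\<^sup>2) = 0"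
    using has_vector_derivative_eq_0 assms lim(1)
    unfolding has_real_derivative_iff_has_vector_derivative by blast
  moreover have "B (n a s) (na a s) + B (na a s) (n a s) = 0"
    using inner_const[OF Dn(1) Dn(1) n_n _ lim(1)] assms by blast
  then have n_na: "B (n a s) (na a s) = 0"
    by (simp add: sf_inner_commute)
  have "B (\<gamma>ss a s) (na a s) = - (c a)\<^sup>2 * (\<kappa> * B (\<gamma> a s) (na a s)) + k a s * (c a)\<^sup>2 * B (n a s) (na a s)"
    using assms by (simp add: \<gamma>ss_eq sf_inner_simps)
  then have "B (\<gamma>ss a s) (na a s) = \<kappa> * (c a)\<^sup>2 * \<phi> a s"
    unfolding n_na inner_position_derivative(1)[OF assms] by simp
  ultimately have "B (\<gamma>ass a s) (n a s) = ?ka * (c a)\<^sup>2 + (k a s * (?m + ?m)) - \<kappa> * (c a)\<^sup>2 * \<phi> a s"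
    by linarith
  then show ?thesis
    unfolding \<psi>_def using assms
    by (intro DERIV_cong[OF Dinner[OF D\<gamma>as Dn(2)]]) (auto simp: ns_eq sf_inner_simps algebra_simps)
qed

text \<open>The normal speed of a variation through minimal surfaces is a Jacobi function; in the rotational
  case the Jacobi equation is an ordinary differential equation. It follows by differentiating the
  minimal surface equation \<open>k w = \<langle>n, e\<^sub>1\<rangle>\<close> in the parameter. The contributions of the tangential motion \<open>\<tau>\<close>
  cancel because of \<open>w k\<^sub>s = - 2 k w\<^sub>s\<close>, the Codazzi equation.\<close>

lemma jacobi_equation:
  assumes "a \<in> I" "s \<in> J"
  shows "((\<lambda>s. w a s * (\<psi> a s - k a s * \<tau> a s)) has_real_derivative
    - 2 * (c a)\<^sup>2 * w a s * ((k a s)\<^sup>2 + \<kappa>) * \<phi> a s) (at s within J)"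
proof -
  let ?ws = "B (\<gamma>s a s) e\<^sub>1" and ?wa = "B (\<gamma>a a s) e\<^sub>1" and ?nwa = "B (na a s) e\<^sub>1"
  let ?m = "B (\<gamma>as a s) (\<gamma>s a s)"
  have w: "w a s > 0" and c: "c a > 0" using w_pos c_pos assms by auto
  have kw: "B (n a s) e\<^sub>1 = k a s * w a s" using w by (simp add: k_def)
  have wa: "?wa = \<tau> a s / (c a)\<^sup>2 * ?ws + \<phi> a s * (k a s * w a s)"
  proof -
    have "?wa = B ((\<tau> a s / (c a)\<^sup>2) *\<^sub>R \<gamma>s a s + \<phi> a s *\<^sub>R n a s) e\<^sub>1"
      using frame_expansion[OF assms spatial_first(1)[OF assms]] inner_position(1)[OF assms] ortho_e2(1)[OF assms]
      by (simp add: \<tau>_def \<phi>_def)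
    then show ?thesis by (simp add: sf_inner_simps kw)
  qed
  have nwa: "?nwa = - \<kappa> * \<phi> a s * w a s - \<psi> a s / (c a)\<^sup>2 * ?ws"
  proof -
    have "B (n a s) (na a s) + B (na a s) (n a s) = 0"
      using inner_const[OF Dn(1) Dn(1) n_n _ lim(1)] assms by blast
    then have 1: "B (na a s) (n a s) = 0" by (simp add: sf_inner_commute)
    have "B (n a s) (\<gamma>as a s) + B (na a s) (\<gamma>s a s) = 0"
      using inner_const[OF Dn(1) D\<gamma>s(1) n_\<gamma>s _ lim(1)] assms by blast
    then have 2: "B (na a s) (\<gamma>s a s) = - \<psi> a s" by (simp add: \<psi>_def sf_inner_commute)
    have "\<kappa> * B (\<gamma> a s) e\<^sub>1 = \<kappa> * w a s"
      using pe(1) by (auto simp: w_def sf_inner_simps)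
    moreover have "na a s = (- \<kappa> * \<phi> a s) *\<^sub>R \<gamma> a s - (\<psi> a s / (c a)\<^sup>2) *\<^sub>R \<gamma>s a s"
      using frame_expansion[OF assms spatial_second(3)[OF assms]] inner_position_derivative(1)[OF assms]
        ortho_e2(3)[OF assms] 1 2 by simp
    ultimately show ?thesis by (auto simp: sf_inner_simps)
  qed
  show ?thesis
  proof (rule DERIV_cong[OF DERIV_mult[OF Dw(1) DERIV_diff[OF D\<psi> DERIV_mult[OF Dk(1) D\<tau>]]]])
    show "?ws * (\<psi> a s - k a s * \<tau> a s) +
        ((c a)\<^sup>2 * ((?nwa - k a s * ?wa) / w a s) + k a s * ?m - \<kappa> * (c a)\<^sup>2 * \<phi> a s -
          (- 2 * k a s * ?ws / w a s * \<tau> a s + (?m + (c a)\<^sup>2 * k a s * \<phi> a s) * k a s)) * w a s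
      = - 2 * (c a)\<^sup>2 * w a s * ((k a s)\<^sup>2 + \<kappa>) * \<phi> a s"
      unfolding wa nwa using w c by (simp add: field_simps power2_eq_square)
  qed (use assms in auto)
qed

text \<open>Free boundary: the conormal is the radial direction. Differentiating this identity in the
  parameter gives both the tangential and the normal part of the boundary condition.\<close>

lemma boundary_variation:
  assumes a: "a \<in> I" and b: "b \<in> J"
    and r: "(r has_real_derivative r') (at a within I)"
    and sn_pos: "\<And>a. a \<in> I \<Longrightarrow> sn \<kappa> (r a) > 0"
    and radial: "\<And>a. a \<in> I \<Longrightarrow> sn \<kappa> (r a) *\<^sub>R \<gamma>s a b = c a *\<^sub>R (cs \<kappa> (r a) *\<^sub>R \<gamma> a b - q)"
  shows "\<tau> a b = c a * r'" "c a * cs \<kappa> (r a) * \<phi> a b = sn \<kappa> (r a) * \<psi> a b"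
proof -
  define m where "m = B (\<gamma>as a b) (\<gamma>s a b)"
  have c: "c a > 0" using c_pos a by auto
  have c_eq: "c b' = sqrt (B (\<gamma>s b' b) (\<gamma>s b' b))" if "b' \<in> I" for b'
    using speed[OF that b] c_pos[OF that] by simp
  have mm: "B (\<gamma>s a b) (\<gamma>as a b) + B (\<gamma>as a b) (\<gamma>s a b) = m + m"
    unfolding m_def sf_inner_commute[of _ "\<gamma>s a b" "\<gamma>as a b"] ..
  have g: "((\<lambda>b'. B (\<gamma>s b' b) (\<gamma>s b' b)) has_real_derivative m + m) (at a within I)"
    using Dinner[OF D\<gamma>s(1)[OF a b] D\<gamma>s(1)[OF a b]] unfolding mm .
  have "(c a)\<^sup>2 > 0" using c by simp
  from DERIV_real_sqrt[OF this]
  have "(sqrt has_real_derivative inverse (c a) / 2) (at (B (\<gamma>s a b) (\<gamma>s a b)))"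
    unfolding speed[OF a b] using c by simp
  note DERIV_chain2[OF this g]
  moreover have "inverse (c a) / 2 * (m + m) = m / c a"
    using c by (simp add: field_simps)
  ultimately have "((\<lambda>b'. sqrt (B (\<gamma>s b' b) (\<gamma>s b' b))) has_real_derivative m / c a) (at a within I)"
    by (rule DERIV_cong)
  then have Dc: "(c has_real_derivative m / c a) (at a within I)"
    unfolding has_real_derivative_iff_has_vector_derivative
    using has_vector_derivative_transform[OF a c_eq] by simp
  have Dsn: "((\<lambda>b'. sn \<kappa> (r b')) has_real_derivative cs \<kappa> (r a) * r') (at a within I)"
    and Dcs: "((\<lambda>b'. cs \<kappa> (r b')) has_real_derivative - \<kappa> * sn \<kappa> (r a) * r') (at a within I)"
    using \<kappa> r unfolding sn_def cs_def
    by (auto intro!: derivative_eq_intros)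
  let ?R = "cs \<kappa> (r a) *\<^sub>R \<gamma> a b - q"
  have D1: "((\<lambda>b'. sn \<kappa> (r b') *\<^sub>R \<gamma>s b' b) has_vector_derivative
      sn \<kappa> (r a) *\<^sub>R \<gamma>as a b + (cs \<kappa> (r a) * r') *\<^sub>R \<gamma>s a b) (at a within I)"
    by (rule has_vector_derivative_scaleR[OF Dsn D\<gamma>s(1)[OF a b]])
  have D2: "((\<lambda>b'. c b' *\<^sub>R (cs \<kappa> (r b') *\<^sub>R \<gamma> b' b - q)) has_vector_derivative
      c a *\<^sub>R (cs \<kappa> (r a) *\<^sub>R \<gamma>a a b + (- \<kappa> * sn \<kappa> (r a) * r') *\<^sub>R \<gamma> a b - 0) + (m / c a) *\<^sub>R ?R) (at a within I)"
    by (rule has_vector_derivative_scaleR[OF Dc has_vector_derivative_diff[OF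
          has_vector_derivative_scaleR[OF Dcs D\<gamma>(1)[OF a b]] has_vector_derivative_const]])
  have eq: "sn \<kappa> (r a) *\<^sub>R \<gamma>as a b + (cs \<kappa> (r a) * r') *\<^sub>R \<gamma>s a b =
      c a *\<^sub>R (cs \<kappa> (r a) *\<^sub>R \<gamma>a a b + (- \<kappa> * sn \<kappa> (r a) * r') *\<^sub>R \<gamma> a b - 0) + (m / c a) *\<^sub>R ?R"
    by (rule vector_derivative_unique_within[OF lim(1)[OF a b] D1])
      (rule has_vector_derivative_transform[OF a _ D2], rule radial)
  have R: "?R = (sn \<kappa> (r a) / c a) *\<^sub>R \<gamma>s a b"
    using arg_cong[OF radial[OF a], of "\<lambda>x. (1 / c a) *\<^sub>R x"] c by simp
  have flat: "\<kappa> * B (\<gamma> a b) (n a b) = 0" "\<kappa> * B (\<gamma> a b) (\<gamma>s a b) = 0" using inner_position a b by auto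
  show "c a * cs \<kappa> (r a) * \<phi> a b = sn \<kappa> (r a) * \<psi> a b"
    using arg_cong[OF eq, of "\<lambda>x. B x (n a b)"] flat n_\<gamma>s[OF a b] unfolding R
    by (auto simp: sf_inner_simps \<phi>_def \<psi>_def sf_inner_commute[of _ "\<gamma>s a b" "n a b"])
  \<comment> \<open>In the flat case the tangential component of the equation gives the claim. On the sphere that
    component contains the factor \<open>cs (r a)\<close>, which vanishes for \<open>r a = \<pi> / 2\<close>; if \<open>\<kappa> \<noteq> 0\<close>, the component
    along the position vector is used instead.\<close>
  show "\<tau> a b = c a * r'"
  proof (cases "\<kappa> = 0")
    case True
    then have "cs \<kappa> (r a) = 1" by (simp add: cs_def)
    moreover have "B (sn \<kappa> (r a) *\<^sub>R \<gamma>as a b + (cs \<kappa> (r a) * r') *\<^sub>R \<gamma>s a b) (\<gamma>s a b)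
        = sn \<kappa> (r a) * m + cs \<kappa> (r a) * r' * (c a)\<^sup>2"
      by (simp add: sf_inner_simps m_def speed[OF a b])
    moreover have "B (c a *\<^sub>R (cs \<kappa> (r a) *\<^sub>R \<gamma>a a b + (- \<kappa> * sn \<kappa> (r a) * r') *\<^sub>R \<gamma> a b - 0)
          + (m / c a) *\<^sub>R ?R) (\<gamma>s a b) = c a * cs \<kappa> (r a) * \<tau> a b + m * sn \<kappa> (r a)"
      unfolding R using flat(2) c
      by (auto simp: sf_inner_simps \<tau>_def speed[OF a b] power2_eq_square)
    ultimately have "c a * (c a * r') = c a * \<tau> a b"
      unfolding eq by (auto simp: power2_eq_square mult.commute)
    then show ?thesis using c by simp
  next
    case False
    have "B (\<gamma> a b) (\<gamma> a b) = \<kappa>"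
      using sf_frame.inner_pp[OF moving_frame[OF a b] False] .
    moreover have "B (\<gamma> a b) (\<gamma>s a b) = 0" "B (\<gamma> a b) (\<gamma>a a b) = 0"
      using inner_position(1,2)[OF a b] False by auto
    moreover have "\<kappa> * B (\<gamma> a b) (\<gamma>as a b) = \<kappa> * - \<tau> a b"
      using inner_position_derivative(4)[OF a b] by simp
    then have "B (\<gamma> a b) (\<gamma>as a b) = - \<tau> a b"
      using False mult_left_cancel by blast
    ultimately have "sn \<kappa> (r a) * \<tau> a b = \<kappa> * \<kappa> * (sn \<kappa> (r a) * (c a * r'))"
      using arg_cong[OF eq, of "B (\<gamma> a b)"] unfolding R
      by (simp add: sf_inner_simps algebra_simps)
    moreover have "\<kappa> * \<kappa> = 1" using \<kappa> False by auto
    ultimately show ?thesis using sn_pos[OF a] by simp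
  qed
qed

end

section \<open>Geometry of a rotational surface\<close>

lemma matrix_inv_diagonal:
  fixes A :: "real^2^2"
  assumes "A $ 1 $ 2 = 0" "A $ 2 $ 1 = 0" "A $ 1 $ 1 \<noteq> 0" "A $ 2 $ 2 \<noteq> 0"
  shows "matrix_inv A $ 1 $ 1 = 1 / A $ 1 $ 1" "matrix_inv A $ 2 $ 2 = 1 / A $ 2 $ 2"
    "matrix_inv A $ 1 $ 2 = 0" "matrix_inv A $ 2 $ 1 = 0"
proof -
  define D :: "real^2^2" where "D = (\<chi> i j. if i = j then 1 / A $ i $ j else 0)"
  have "A ** D = mat 1" "D ** A = mat 1"
    using assms by (auto simp: D_def vec_eq_iff forall_2 matrix_matrix_mult_def mat_def sum_2)
  then have "A ** matrix_inv A = mat 1"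
    unfolding matrix_inv_def by (metis (mono_tags, lifting) someI)
  then have eq: "(A ** matrix_inv A) $ i $ j = mat 1 $ i $ j" for i j by simp
  show "matrix_inv A $ 1 $ 1 = 1 / A $ 1 $ 1" "matrix_inv A $ 2 $ 2 = 1 / A $ 2 $ 2"
    "matrix_inv A $ 1 $ 2 = 0" "matrix_inv A $ 2 $ 1 = 0"
    using eq[of 1 1] eq[of 2 2] eq[of 1 2] eq[of 2 1] assms
    by (simp_all add: matrix_matrix_mult_def mat_def sum_2 field_simps)
qed

lemma at_within_Icc_neq_bot: "s \<in> {-1..1::real} \<Longrightarrow> at s within {-1..1} \<noteq> bot"
  by (simp add: trivial_limit_within)

lemma pd_1_eqI:
  "s \<in> {-1..1} \<Longrightarrow> ((\<lambda>t. f (t, \<theta>)) has_vector_derivative d) (at s within {-1..1}) \<Longrightarrow> pd 1 f (s, \<theta>) = d"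
  by (simp add: pd_def vector_derivative_within[OF at_within_Icc_neq_bot])

lemma pd_2_eqI:
  "((\<lambda>t. f (s, t)) has_vector_derivative d) (at \<theta>) \<Longrightarrow> pd 2 f (s, \<theta>) = d"
  by (simp add: pd_def vector_derivative_at)

lemma pd_has_vector_derivative:
  fixes f :: "real \<times> real \<Rightarrow> 'a::real_normed_vector"
  assumes "smooth_on annulus f" "s \<in> {-1..1}"
  shows "((\<lambda>t. f (t, \<theta>)) has_vector_derivative pd 1 f (s, \<theta>)) (at s within {-1..1})"
    "((\<lambda>t. f (s, t)) has_vector_derivative pd 2 f (s, \<theta>)) (at \<theta>)"
proof -
  obtain f' where f': "\<And>x. x \<in> annulus \<Longrightarrow> (f has_derivative f' x) (at x within annulus)"
    and "\<And>v. smooth_on annulus (\<lambda>x. f' x v)"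
    using smooth_on_derivative[OF assms(1)] by blast
  have "(f has_derivative f' (s, \<theta>)) (at (s, \<theta>) within {-1..1} \<times> UNIV)"
    using f'[of "(s, \<theta>)"] assms(2) by (simp add: annulus_def)
  note D = this
  have D1: "((\<lambda>t. f (t, \<theta>)) has_vector_derivative f' (s, \<theta>) (1, 0)) (at s within {-1..1})"
    by (rule has_derivative_imp_has_vector_derivative_fst[OF D]) simp
  have D2: "((\<lambda>t. f (s, t)) has_vector_derivative f' (s, \<theta>) (0, 1)) (at \<theta>)"
    by (rule has_derivative_imp_has_vector_derivative_snd[OF D assms(2)])
  show "((\<lambda>t. f (t, \<theta>)) has_vector_derivative pd 1 f (s, \<theta>)) (at s within {-1..1})"
    unfolding pd_1_eqI[OF assms(2) D1] by (rule D1)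
  show "((\<lambda>t. f (s, t)) has_vector_derivative pd 2 f (s, \<theta>)) (at \<theta>)"
    unfolding pd_2_eqI[OF D2] by (rule D2)
qed

lemma continuous_square_1_constant:
  fixes D :: "real \<Rightarrow> real"
  assumes "continuous_on S D" "connected S" "\<And>x. x \<in> S \<Longrightarrow> (D x)\<^sup>2 = 1" "x \<in> S" "y \<in> S"
  shows "D x = D y"
proof -
  have "D ` S \<subseteq> {-1, 1}"
    using assms(3) by (auto simp: power2_eq_1_iff)
  then have "D constant_on S"
    using continuous_finite_range_constant[OF assms(2,1)] finite_subset by blast
  then show ?thesis
    using assms(4,5) by (auto simp: constant_on_def)
qed

locale rotational_minimal_annulus = sf_frame \<kappa> p e\<^sub>1 e\<^sub>2 e\<^sub>3 for \<kappa> p e\<^sub>1 e\<^sub>2 e\<^sub>3 +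
  fixes f \<nu> :: "real \<times> real \<Rightarrow> real^4" and c :: real
  assumes imm: "immersion f" and normal: "unit_normal \<kappa> f \<nu>"
    and f_in: "\<And>q. q \<in> annulus \<Longrightarrow> f q \<in> space_form \<kappa>"
    and H0: "\<And>q. q \<in> annulus \<Longrightarrow> mean_curvature \<kappa> f \<nu> q = 0"
    and f_rotation: "\<And>s \<theta> t. s \<in> {-1..1} \<Longrightarrow> f (s, \<theta> + t) = rotation \<kappa> p e\<^sub>1 e\<^sub>2 t (f (s, \<theta>))"
    and f_e2: "\<And>s. s \<in> {-1..1} \<Longrightarrow> sf_inner \<kappa> (f (s, 0) - p) e\<^sub>2 = 0"
    and f_e1: "\<And>s. s \<in> {-1..1} \<Longrightarrow> sf_inner \<kappa> (f (s, 0) - p) e\<^sub>1 \<ge> 0"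
    and c_pos: "c > 0"
    and speed: "\<And>q. q \<in> annulus \<Longrightarrow> sf_inner \<kappa> (pd 1 f q) (pd 1 f q) = c\<^sup>2"
begin

abbreviation J :: "real set" where "J \<equiv> {-1..1}"
abbreviation B where "B \<equiv> sf_inner \<kappa>"

text \<open>The parallel circle through \<open>f (s, 0)\<close> has length \<open>2 \<pi> w s\<close> and normal curvature \<open>k s\<close>.\<close>

definition w :: "real \<Rightarrow> real" where "w s = B (f (s, 0) - p) e\<^sub>1"
definition k :: "real \<Rightarrow> real" where "k s = B (\<nu> (s, 0)) e\<^sub>1 / w s"

lemma annulus_iff [simp]: "(s, \<theta>) \<in> annulus \<longleftrightarrow> s \<in> J"
  by (auto simp: annulus_def)

lemma smooth: "smooth_on annulus f" "smooth_on annulus \<nu>"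
  using imm normal by (auto simp: immersion_def unit_normal_def)

lemma \<nu>_props:
  assumes "s \<in> J"
  shows "\<nu> (s, \<theta>) \<in> tangent_space \<kappa> (f (s, \<theta>))" "B (\<nu> (s, \<theta>)) (\<nu> (s, \<theta>)) = 1"
    "B (\<nu> (s, \<theta>)) (pd i f (s, \<theta>)) = 0"
  using normal assms by (auto simp: unit_normal_def)

lemma f_rot: "s \<in> J \<Longrightarrow> f (s, \<theta>) = rot \<theta> (f (s, 0))"
  using f_rotation[of s 0 \<theta>] rotation_eq_rot f_in by simp

lemma co_f: "s \<in> J \<Longrightarrow> co1 (f (s, 0)) = w s" "s \<in> J \<Longrightarrow> co2 (f (s, 0)) = 0"
  using co_space_form[OF f_in[of "(s, 0)"]] f_e2 by (auto simp: w_def)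

lemma pd_f:
  assumes "s \<in> J"
  shows "pd 1 f (s, \<theta>) = rot \<theta> (pd 1 f (s, 0))" "pd 2 f (s, \<theta>) = w s *\<^sub>R rot \<theta> e\<^sub>2"
proof -
  have "((\<lambda>t. f (t, \<theta>)) has_vector_derivative rot \<theta> (pd 1 f (s, 0))) (at s within J)"
    by (rule has_vector_derivative_transform[OF assms f_rot bounded_linear.has_vector_derivative[OF
            bounded_linear_rot pd_has_vector_derivative(1)[OF smooth(1) assms]]])
  then show "pd 1 f (s, \<theta>) = rot \<theta> (pd 1 f (s, 0))"
    by (rule pd_1_eqI[OF assms])
  have "((\<lambda>t. f (s, t)) has_vector_derivative w s *\<^sub>R rot \<theta> e\<^sub>2) (at \<theta>)"
    unfolding ext[of "\<lambda>t. f (s, t)", OF f_rot[OF assms]]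
    using has_vector_derivative_rot[of "f (s, 0)" \<theta>] unfolding co_f[OF assms] by blast
  then show "pd 2 f (s, \<theta>) = w s *\<^sub>R rot \<theta> e\<^sub>2"
    by (rule pd_2_eqI)
qed

lemma w_pos: 
  assumes "s \<in> J"
  shows "w s > 0"
proof (rule ccontr)
  assume "\<not> w s > 0"
  then have "w s = 0" using f_e1[OF assms] by (simp add: w_def)
  then have "pd 2 f (s, 0) = 0" using pd_f[OF assms] by simp
  then have "(\<Sum>i\<in>UNIV. (axis 2 1 :: real^2) $ i *\<^sub>R pd i f (s, 0)) = 0"
    by (simp add: sum_2 axis_def)
  moreover have "(s, 0) \<in> annulus" using assms by simp
  ultimately have "(axis 2 1 :: real^2) = 0"
    using imm unfolding immersion_def by blast
  then show False by (simp add: axis_eq_0_iff)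
qed

lemma spatial_pd: "s \<in> J \<Longrightarrow> spatial \<kappa> (pd 1 f (s, \<theta>))" "s \<in> J \<Longrightarrow> spatial \<kappa> (\<nu> (s, \<theta>))"
  and quad_f_pd: "s \<in> J \<Longrightarrow> sf_quad \<kappa> (f (s, \<theta>)) (pd 1 f (s, \<theta>)) = 0"
proof -
  assume s: "s \<in> J"
  note D = pd_has_vector_derivative(1)[OF smooth(1) s, of \<theta>]
  have "sf_quad \<kappa> (f (t, \<theta>)) (f (t, \<theta>)) = 1" if "t \<in> J" for t
    using f_in[of "(t, \<theta>)"] that by (simp add: space_form_def)
  from bilinear_const_derivative[OF sf_quad.bounded_bilinear_axioms[of \<kappa>] D D this s at_within_Icc_neq_bot[OF s]]
  show "sf_quad \<kappa> (f (s, \<theta>)) (pd 1 f (s, \<theta>)) = 0"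
    by (simp add: sf_quad_commute)
  then show "spatial \<kappa> (pd 1 f (s, \<theta>))"
    using tangent_space_spatial[of "f (s, \<theta>)"] f_in s by (simp add: tangent_space_def)
  show "spatial \<kappa> (\<nu> (s, \<theta>))"
    using tangent_space_spatial[of "f (s, \<theta>)"] f_in s \<nu>_props(1) by simp
qed

lemma inner_e2:
  assumes "s \<in> J"
  shows "B (pd 1 f (s, 0)) e\<^sub>2 = 0" "B (\<nu> (s, 0)) e\<^sub>2 = 0" "B (pd 1 \<nu> (s, 0)) e\<^sub>2 = 0"
proof -
  have cst: "B g' e\<^sub>2 = 0" if "(g has_vector_derivative g') (at s within J)" "\<And>t. t \<in> J \<Longrightarrow> B (g t) e\<^sub>2 = C" for g g' C
    using bilinear_const_derivative[OF sf_inner.bounded_bilinear_axioms[of \<kappa>] that(1)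
        has_vector_derivative_const that(2) assms at_within_Icc_neq_bot[OF assms]]
    by (simp add: sf_inner_simps)
  have "B (f (t, 0)) e\<^sub>2 = B p e\<^sub>2" if "t \<in> J" for t
    using f_e2[OF that] by (simp add: sf_inner_simps)
  from cst[OF pd_has_vector_derivative(1)[OF smooth(1) assms] this]
  show "B (pd 1 f (s, 0)) e\<^sub>2 = 0" .
  have \<nu>2: "B (\<nu> (t, 0)) e\<^sub>2 = 0" if "t \<in> J" for t
    using \<nu>_props(3)[OF that, of 0 2] pd_f[OF that, of 0] w_pos[OF that] by (simp add: sf_inner_simps)
  then show "B (\<nu> (s, 0)) e\<^sub>2 = 0" using assms .
  from cst[OF pd_has_vector_derivative(1)[OF smooth(2) assms] \<nu>2]
  show "B (pd 1 \<nu> (s, 0)) e\<^sub>2 = 0" .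
qed

lemma surface_frame:
  assumes "s \<in> J"
  shows "sf_frame \<kappa> (f (s, \<theta>)) ((1 / c) *\<^sub>R pd 1 f (s, \<theta>)) (\<nu> (s, \<theta>)) (rot \<theta> e\<^sub>2)"
proof
  have "sf_quad \<kappa> (f (s, \<theta>)) (rot \<theta> e\<^sub>2) = sf_quad \<kappa> (f (s, 0)) e\<^sub>2"
    using rot_isometry(7) f_rot[OF assms, of \<theta>] by simp
  also have "\<dots> = \<kappa> * B (f (s, 0)) e\<^sub>2"
    using sf_quad_eq_sf_inner[OF \<kappa> spatial_e(2)] .
  also have "\<dots> = 0"
    using f_e2[OF assms] inner_pe(2) by (auto simp: sf_inner_simps)
  finally have 1: "sf_quad \<kappa> (f (s, \<theta>)) (rot \<theta> e\<^sub>2) = 0" .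
  have 2: "B (rot \<theta> e\<^sub>2) (rot \<theta> e\<^sub>2) = 1"
    using rot_isometry(6)[OF spatial_e(2) spatial_e(2)] by simp
  have 3: "B (pd 1 f (s, \<theta>)) (rot \<theta> e\<^sub>2) = 0"
    unfolding pd_f(1)[OF assms, of \<theta>] using rot_isometry(6)[OF spatial_pd(1)[OF assms] spatial_e(2)] inner_e2[OF assms] by simp
  have 4: "B (\<nu> (s, \<theta>)) (rot \<theta> e\<^sub>2) = 0"
    using \<nu>_props(3)[OF assms, of \<theta> 2] pd_f(2)[OF assms] w_pos[OF assms] by (simp add: sf_inner_simps)
  show "orthonormal_frame \<kappa> (f (s, \<theta>)) ((1 / c) *\<^sub>R pd 1 f (s, \<theta>)) (\<nu> (s, \<theta>)) (rot \<theta> e\<^sub>2)"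
    unfolding orthonormal_frame_def tangent_space_def
    using 1 2 3 4 quad_f_pd[OF assms] \<nu>_props[OF assms] speed[of "(s, \<theta>)"] c_pos assms
    by (simp add: sf_inner_simps sf_quad_simps tangent_space_def power2_eq_square
        sf_inner_commute[of _ "pd 1 f (s, \<theta>)" "\<nu> (s, \<theta>)"])
qed (use \<kappa> f_in assms in auto)

text \<open>A unit normal is determined up to sign, and the sign does not change along an orbit.\<close>

lemma \<nu>_rot:
  assumes s: "s \<in> J"
  shows "\<nu> (s, \<theta>) = rot \<theta> (\<nu> (s, 0))"
proof -
  define D where "D \<theta> = B (rot \<theta> (\<nu> (s, 0))) (\<nu> (s, \<theta>))" for \<theta>
  have R: "rot \<theta> (\<nu> (s, 0)) = D \<theta> *\<^sub>R \<nu> (s, \<theta>) \<and> (D \<theta>)\<^sup>2 = 1" for \<theta>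
  proof -
    interpret F: sf_frame \<kappa> "f (s, \<theta>)" "(1 / c) *\<^sub>R pd 1 f (s, \<theta>)" "\<nu> (s, \<theta>)" "rot \<theta> e\<^sub>2"
      using surface_frame[OF s] .
    have "rot \<theta> (\<nu> (s, 0)) \<in> tangent_space \<kappa> (f (s, \<theta>))"
      using \<nu>_props(1)[OF s] f_rot[OF s, of \<theta>] rot_isometry(7) by (simp add: tangent_space_def)
    moreover have "B (rot \<theta> (\<nu> (s, 0))) ((1 / c) *\<^sub>R pd 1 f (s, \<theta>)) = 0"
      unfolding pd_f(1)[OF s, of \<theta>] using rot_isometry(6)[OF spatial_pd(2)[OF s] spatial_pd(1)[OF s]] \<nu>_props(3)[OF s]
      by (simp add: sf_inner_simps)
    moreover have "B (rot \<theta> (\<nu> (s, 0))) (rot \<theta> e\<^sub>2) = 0"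
      using rot_isometry(6)[OF spatial_pd(2)[OF s] spatial_e(2)] inner_e2(2)[OF s] by simp
    moreover have "B (rot \<theta> (\<nu> (s, 0))) (rot \<theta> (\<nu> (s, 0))) = 1"
      using rot_isometry(6)[OF spatial_pd(2)[OF s] spatial_pd(2)[OF s]] \<nu>_props(2)[OF s] by simp
    ultimately show ?thesis
      using F.unit_normal_unique unfolding D_def by blast
  qed
  have "continuous_on UNIV (\<lambda>\<theta>. \<nu> (s, \<theta>))"
    using has_vector_derivative_continuous[OF pd_has_vector_derivative(2)[OF smooth(2) s]]
    by (intro continuous_at_imp_continuous_on) blast
  then have "continuous_on UNIV D"
    unfolding D_def rot_def
    by (intro sf_inner.continuous_on continuous_intros)
  then have "D \<theta> = D 0"
    by (rule continuous_square_1_constant[of UNIV]) (use R in auto)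
  also have "D 0 = 1" using \<nu>_props(2)[OF s] by (simp add: D_def)
  finally show ?thesis using R[of \<theta>] by simp
qed

lemma pd_\<nu>:
  assumes "s \<in> J"
  shows "pd 1 \<nu> (s, \<theta>) = rot \<theta> (pd 1 \<nu> (s, 0))" "pd 2 \<nu> (s, \<theta>) = (k s * w s) *\<^sub>R rot \<theta> e\<^sub>2"
proof -
  have "((\<lambda>t. \<nu> (t, \<theta>)) has_vector_derivative rot \<theta> (pd 1 \<nu> (s, 0))) (at s within J)"
    by (rule has_vector_derivative_transform[OF assms \<nu>_rot bounded_linear.has_vector_derivative[OF
            bounded_linear_rot pd_has_vector_derivative(1)[OF smooth(2) assms]]])
  then show "pd 1 \<nu> (s, \<theta>) = rot \<theta> (pd 1 \<nu> (s, 0))"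
    by (rule pd_1_eqI[OF assms])
  have "co1 (\<nu> (s, 0)) = k s * w s" "co2 (\<nu> (s, 0)) = 0"
    using spatial_co(2,3)[OF spatial_pd(2)[OF assms]] inner_e2(2)[OF assms] w_pos[OF assms]
    by (simp_all add: k_def)
  then have "((\<lambda>t. \<nu> (s, t)) has_vector_derivative (k s * w s) *\<^sub>R rot \<theta> e\<^sub>2) (at \<theta>)"
    unfolding ext[of "\<lambda>t. \<nu> (s, t)", OF \<nu>_rot[OF assms]]
    using has_vector_derivative_rot[of "\<nu> (s, 0)" \<theta>] by metis
  then show "pd 2 \<nu> (s, \<theta>) = (k s * w s) *\<^sub>R rot \<theta> e\<^sub>2"
    by (rule pd_2_eqI)
qed

lemma spatial_pd_\<nu>: 
  assumes "s \<in> J"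
  shows "spatial \<kappa> (pd 1 \<nu> (s, \<theta>))"
  unfolding spatial_def
proof
  assume "\<kappa> = 0"
  then have "\<nu> (t, \<theta>) $ 1 = 0" if "t \<in> J" for t
    using spatial_pd(2)[OF that] by (simp add: spatial_def)
  then show "pd 1 \<nu> (s, \<theta>) $ 1 = 0"
    using has_vector_derivative_eq_0[OF bounded_linear.has_vector_derivative[OF bounded_linear_vec_nth
          pd_has_vector_derivative(1)[OF smooth(2) assms]] _ assms at_within_Icc_neq_bot[OF assms]] by blast
qed

lemma first_form_entries:
  assumes "s \<in> J"
  shows "first_form \<kappa> f (s, \<theta>) $ 1 $ 1 = c\<^sup>2" "first_form \<kappa> f (s, \<theta>) $ 2 $ 2 = (w s)\<^sup>2"
    "first_form \<kappa> f (s, \<theta>) $ 1 $ 2 = 0" "first_form \<kappa> f (s, \<theta>) $ 2 $ 1 = 0"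
proof -
  have "B (rot \<theta> e\<^sub>2) (rot \<theta> e\<^sub>2) = 1"
    using rot_isometry(6)[OF spatial_e(2) spatial_e(2)] by simp
  moreover have "B (pd 1 f (s, \<theta>)) (rot \<theta> e\<^sub>2) = 0"
    unfolding pd_f(1)[OF assms, of \<theta>] using rot_isometry(6)[OF spatial_pd(1)[OF assms] spatial_e(2)] inner_e2[OF assms] by simp
  ultimately show "first_form \<kappa> f (s, \<theta>) $ 1 $ 1 = c\<^sup>2" "first_form \<kappa> f (s, \<theta>) $ 2 $ 2 = (w s)\<^sup>2"
    "first_form \<kappa> f (s, \<theta>) $ 1 $ 2 = 0" "first_form \<kappa> f (s, \<theta>) $ 2 $ 1 = 0"
    using speed[of "(s, \<theta>)"] assms
    by (simp_all add: first_form_def pd_f(2) sf_inner_simps power2_eq_square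
        sf_inner_commute[of _ "rot \<theta> e\<^sub>2" "pd 1 f (s, \<theta>)"])
qed

lemma inv_form_entries:
  assumes "s \<in> J"
  shows "inv_form \<kappa> f (s, \<theta>) $ 1 $ 1 = 1 / c\<^sup>2" "inv_form \<kappa> f (s, \<theta>) $ 2 $ 2 = 1 / (w s)\<^sup>2"
    "inv_form \<kappa> f (s, \<theta>) $ 1 $ 2 = 0" "inv_form \<kappa> f (s, \<theta>) $ 2 $ 1 = 0"
  using matrix_inv_diagonal[of "first_form \<kappa> f (s, \<theta>)"] first_form_entries[OF assms, of \<theta>] c_pos w_pos[OF assms]
  by (simp_all add: inv_form_def)

lemma sqrt_det_first_form: "s \<in> J \<Longrightarrow> sqrt (det (first_form \<kappa> f (s, \<theta>))) = c * w s"
  using w_pos[of s] c_pos by (simp add: det_2 first_form_entries real_sqrt_mult)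

lemma second_form_entries:
  assumes "s \<in> J"
  shows "second_form \<kappa> f \<nu> (s, \<theta>) $ 1 $ 1 = B (pd 1 \<nu> (s, 0)) (pd 1 f (s, 0))"
    "second_form \<kappa> f \<nu> (s, \<theta>) $ 2 $ 2 = k s * (w s)\<^sup>2"
    "second_form \<kappa> f \<nu> (s, \<theta>) $ 1 $ 2 = 0" "second_form \<kappa> f \<nu> (s, \<theta>) $ 2 $ 1 = 0"
proof -
  have "second_form \<kappa> f \<nu> (s, \<theta>) $ i $ j = B (pd i \<nu> (s, \<theta>)) (pd j f (s, \<theta>))" for i j
    by (simp add: second_form_def cov_deriv_def \<nu>_props(3)[OF assms])
  moreover have "B (rot \<theta> e\<^sub>2) (rot \<theta> e\<^sub>2) = 1"
    using rot_isometry(6)[OF spatial_e(2) spatial_e(2)] by simp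
  moreover have "B (rot \<theta> e\<^sub>2) (rot \<theta> (pd 1 f (s, 0))) = 0"
    using rot_isometry(6)[OF spatial_e(2) spatial_pd(1)[OF assms]] inner_e2(1)[OF assms]
    by (simp add: sf_inner_commute)
  moreover have "B (rot \<theta> (pd 1 \<nu> (s, 0))) (rot \<theta> e\<^sub>2) = 0"
    using rot_isometry(6)[OF spatial_pd_\<nu>[OF assms] spatial_e(2)] inner_e2(3)[OF assms] by simp
  ultimately show "second_form \<kappa> f \<nu> (s, \<theta>) $ 1 $ 1 = B (pd 1 \<nu> (s, 0)) (pd 1 f (s, 0))"
    "second_form \<kappa> f \<nu> (s, \<theta>) $ 2 $ 2 = k s * (w s)\<^sup>2"
    "second_form \<kappa> f \<nu> (s, \<theta>) $ 1 $ 2 = 0" "second_form \<kappa> f \<nu> (s, \<theta>) $ 2 $ 1 = 0"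
    using rot_isometry(6)[OF spatial_pd_\<nu>[OF assms] spatial_pd(1)[OF assms]]
    by (simp_all add: pd_f[OF assms, of \<theta>] pd_\<nu>[OF assms, of \<theta>] sf_inner_simps power2_eq_square)
qed

lemma minimal:
  assumes "s \<in> J"
  shows "B (pd 1 \<nu> (s, 0)) (pd 1 f (s, 0)) = - c\<^sup>2 * k s"
proof -
  have "mean_curvature \<kappa> f \<nu> (s, 0) = B (pd 1 \<nu> (s, 0)) (pd 1 f (s, 0)) / c\<^sup>2 + k s"
    using w_pos[OF assms]
    by (simp add: mean_curvature_def sum_2 inv_form_entries[OF assms] second_form_entries[OF assms])
  then show ?thesis
    using H0[of "(s, 0)"] assms c_pos by (simp add: field_simps)
qed

lemma second_form_norm2_eq:
  assumes "s \<in> J"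
  shows "second_form_norm2 \<kappa> f \<nu> (s, \<theta>) = 2 * (k s)\<^sup>2"
  using w_pos[OF assms] c_pos
  by (simp add: second_form_norm2_def sum_2 inv_form_entries[OF assms] second_form_entries[OF assms]
      minimal[OF assms] power2_eq_square)

lemma annulus_bd_iff: "(s, \<theta>) \<in> annulus_bd \<longleftrightarrow> s = -1 \<or> s = 1"
  by (auto simp: annulus_bd_def)

lemma conormal_eq:
  assumes "s = -1 \<or> s = 1"
  shows "conormal \<kappa> f (s, \<theta>) $ 1 = s / c" "conormal \<kappa> f (s, \<theta>) $ 2 = 0"
proof -
  have "s \<in> J" using assms by auto
  from inv_form_entries[OF this, of \<theta>] c_pos assms
  show "conormal \<kappa> f (s, \<theta>) $ 1 = s / c" "conormal \<kappa> f (s, \<theta>) $ 2 = 0"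
    by (auto simp: conormal_def real_sqrt_divide power2_eq_square)
qed

lemma conormal_deriv_eq:
  "s = -1 \<or> s = 1 \<Longrightarrow> conormal_deriv \<kappa> f u (s, \<theta>) = (s / c) *\<^sub>R pd 1 u (s, \<theta>)"
  by (simp add: conormal_deriv_def sum_2 conormal_eq)

lemma second_form_conormal_eq:
  assumes "s = -1 \<or> s = 1"
  shows "second_form_conormal \<kappa> f \<nu> (s, \<theta>) = - k s"
proof -
  have s: "s \<in> J" using assms by auto
  show ?thesis
    using assms c_pos
    by (auto simp: second_form_conormal_def sum_2 conormal_eq second_form_entries minimal power2_eq_square)
qed

lemma laplacian_rotational:
  assumes s: "s \<in> J" and u: "\<And>s \<theta>. s \<in> J \<Longrightarrow> u (s, \<theta>) = v s"
    and v: "\<And>s. s \<in> J \<Longrightarrow> (v has_real_derivative v' s) (at s within J)"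
    and d: "((\<lambda>s. w s * v' s) has_real_derivative d) (at s within J)"
  shows "laplacian \<kappa> f u (s, \<theta>) = d / (c\<^sup>2 * w s)"
proof -
  have u1: "pd 1 u (t, \<theta>) = v' t" if "t \<in> J" for t \<theta>
    by (rule pd_1_eqI[OF that has_vector_derivative_transform[OF that _
            v[OF that, unfolded has_real_derivative_iff_has_vector_derivative]]]) (rule u)
  have u2: "pd 2 u (t, \<theta>) = 0" if "t \<in> J" for t \<theta>
    by (rule pd_2_eqI) (simp add: u[OF that])
  let ?F = "\<lambda>i q. sqrt (det (first_form \<kappa> f q)) * (\<Sum>j\<in>UNIV. inv_form \<kappa> f q $ i $ j * pd j u q)"
  have F1: "?F 1 (t, \<theta>) = w t * v' t / c" if "t \<in> J" for t \<theta>
    using that c_pos by (simp add: sum_2 sqrt_det_first_form inv_form_entries u1 u2 power2_eq_square)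
  have F2: "?F 2 (t, \<theta>) = 0" if "t \<in> J" for t \<theta>
    using that by (simp add: sum_2 inv_form_entries u2)
  have D: "((\<lambda>t. w t * v' t / c) has_vector_derivative d / c) (at s within J)"
    using DERIV_cdivide[OF d] by (simp add: has_real_derivative_iff_has_vector_derivative)
  have "((\<lambda>t. ?F 1 (t, \<theta>)) has_vector_derivative d / c) (at s within J)"
    by (rule has_vector_derivative_transform[where g = "\<lambda>t. ?F 1 (t, \<theta>)", OF s _ D]) (rule F1)
  then have 1: "pd 1 (?F 1) (s, \<theta>) = d / c"
    by (rule pd_1_eqI[OF s, of "?F 1"])
  have "((\<lambda>t. ?F 2 (s, t)) has_vector_derivative 0) (at \<theta>)"
    using has_vector_derivative_const[of 0] unfolding F2[OF s] .
  then have 2: "pd 2 (?F 2) (s, \<theta>) = 0"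
    by (rule pd_2_eqI[of "?F 2"])
  have "laplacian \<kappa> f u (s, \<theta>) = (pd 1 (?F 1) (s, \<theta>) + pd 2 (?F 2) (s, \<theta>)) / sqrt (det (first_form \<kappa> f (s, \<theta>)))"
    by (simp add: laplacian_def sum_2)
  then show ?thesis
    unfolding 1 2 sqrt_det_first_form[OF s] by (simp add: power2_eq_square)
qed

end

section \<open>Reflection symmetry\<close>

text \<open>The reversed Cauchy-Schwarz inequality for timelike vectors, from Lagrange's identity for the
  spatial parts.\<close>

lemma space_form_hyperbolic_product_pos:
  assumes "x \<in> space_form (-1)" "y \<in> space_form (-1)"
  shows "sf_quad (-1) x y > 0"
proof -
  have x: "(x$1)\<^sup>2 = 1 + (x$2)\<^sup>2 + (x$3)\<^sup>2 + (x$4)\<^sup>2" "x$1 > 0"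
    and y: "(y$1)\<^sup>2 = 1 + (y$2)\<^sup>2 + (y$3)\<^sup>2 + (y$4)\<^sup>2" "y$1 > 0"
    using assms by (auto simp: space_form_def sf_quad_def power2_eq_square)
  let ?d = "x$2 * y$2 + x$3 * y$3 + x$4 * y$4"
  have lagrange: "?d\<^sup>2 + (x$2 * y$3 - x$3 * y$2)\<^sup>2 + (x$2 * y$4 - x$4 * y$2)\<^sup>2 + (x$3 * y$4 - x$4 * y$3)\<^sup>2
      = ((x$2)\<^sup>2 + (x$3)\<^sup>2 + (x$4)\<^sup>2) * ((y$2)\<^sup>2 + (y$3)\<^sup>2 + (y$4)\<^sup>2)"
    by (simp add: power2_eq_square algebra_simps)
  have less: "((x$2)\<^sup>2 + (x$3)\<^sup>2 + (x$4)\<^sup>2) * ((y$2)\<^sup>2 + (y$3)\<^sup>2 + (y$4)\<^sup>2) < (x$1)\<^sup>2 * (y$1)\<^sup>2"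
    unfolding x(1) y(1) by (rule mult_strict_mono) (auto simp: add_pos_nonneg)
  have "a < g" if "a + b\<^sup>2 + d\<^sup>2 + e\<^sup>2 = h" "h < g" for a b d e g h :: real
    using that zero_le_power2[of b] zero_le_power2[of d] zero_le_power2[of e] by linarith
  from this[OF lagrange less] have "?d\<^sup>2 < (x$1 * y$1)\<^sup>2"
    unfolding power_mult_distrib .
  then have "?d < x$1 * y$1"
    by (rule power2_less_imp_less) (use x(2) y(2) in simp)
  then show ?thesis by (simp add: sf_quad_def)
qed

context sf_frame
begin

text \<open>The distance from \<open>p\<close> is an injective function of the coordinate along \<open>p\<close>, on the range of values that
  this coordinate takes.\<close>

lemma co0_eqI_dist:
  assumes "x \<in> space_form \<kappa>" "y \<in> space_form \<kappa>" "sf_dist \<kappa> p x = sf_dist \<kappa> p y"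
  shows "co0 x = co0 y"
proof -
  define N where "N z = (co1 z)\<^sup>2 + (co2 z)\<^sup>2 + (co3 z)\<^sup>2" for z
  have q: "(co0 z)\<^sup>2 + \<kappa> * N z = 1" if "z \<in> space_form \<kappa>" for z
    using that quad_eq_coordinates[of z z] by (simp add: space_form_def N_def power2_eq_square)
  have nonneg: "N z \<ge> 0" for z by (simp add: N_def)
  consider "\<kappa> = 0" | "\<kappa> = 1" | "\<kappa> = -1" using \<kappa> by auto
  then show ?thesis
  proof cases
    case 1
    then show ?thesis
      using assms p space_form_flat by (auto simp: sf_quad_def)
  next
    case 2
    have "cos (arccos (co0 z)) = co0 z" if "z \<in> space_form \<kappa>" for z
    proof -
      have "(co0 z)\<^sup>2 \<le> 1" using q[OF that] nonneg[of z] 2 by simp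
      then have "\<bar>co0 z\<bar> \<le> 1" using abs_square_le_1 by blast
      then show ?thesis by (intro cos_arccos) auto
    qed
    moreover have "co0 z = sf_inner \<kappa> p z" for z
      using 2 by (simp add: sf_quad_def sf_inner_def)
    ultimately show ?thesis
      using assms 2 unfolding sf_dist_def by (metis (no_types, lifting))
  next
    case 3
    have "cosh (arcosh (co0 z)) = co0 z" if "z \<in> space_form \<kappa>" for z
    proof -
      have "co0 z > 0" using space_form_hyperbolic_product_pos[of p z] p that 3 by simp
      moreover have "(co0 z)\<^sup>2 \<ge> 1" using q[OF that] nonneg[of z] 3 by simp
      ultimately have "co0 z \<ge> 1"
        using power2_le_imp_le[of 1 "co0 z"] by simp
      then show ?thesis by simp
    qed
    moreover have "co0 z = - sf_inner \<kappa> p z" for z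
      using 3 by (simp add: sf_quad_def sf_inner_def)
    ultimately show ?thesis
      using assms 3 unfolding sf_dist_def by (metis (no_types, lifting) one_neq_neg_one)
  qed
qed

end

lemma has_vector_derivative_reflect:
  assumes "(h has_vector_derivative h') (at (- s) within {-1..1::real})"
  shows "((\<lambda>t. h (- t)) has_vector_derivative - h') (at s within {-1..1})"
proof -
  have "(uminus has_vector_derivative -1) (at s within {-1..1::real})"
    by (auto intro!: derivative_eq_intros)
  moreover have "uminus ` {-1..1::real} = {-1..1}" by simp
  ultimately show ?thesis
    using vector_diff_chain_within[of uminus "-1" s "{-1..1}" h h'] assms by (simp add: o_def)
qed

locale reflection_symmetric_annulus = rotational_minimal_annulus \<kappa> p e\<^sub>1 e\<^sub>2 e\<^sub>3 f \<nu> c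
  for \<kappa> p e\<^sub>1 e\<^sub>2 e\<^sub>3 f \<nu> c +
  fixes F :: "real^4 \<Rightarrow> real^4"
  assumes lin: "linear F" and F_p: "F p = p" and det_F: "det (matrix F) < 0"
    and F_dist: "\<And>x. x \<in> space_form \<kappa> \<Longrightarrow> sf_dist \<kappa> p (F x) = sf_dist \<kappa> p x"
    and F_f: "\<And>s \<theta>. s \<in> {-1..1} \<Longrightarrow> F (f (s, \<theta>)) = f (- s, \<theta>)"
begin

text \<open>The reflection maps the parallel circle at \<open>s\<close> to that at \<open>- s\<close> and preserves the angle. Comparing
  points that differ by a half and by a quarter turn identifies its action on \<open>e\<^sub>1\<close> and \<open>e\<^sub>2\<close>.\<close>

lemma F_e12: "F e\<^sub>1 = e\<^sub>1" "F e\<^sub>2 = e\<^sub>2" and w_even: "s \<in> J \<Longrightarrow> w (- s) = w s"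
proof -
  have half_turn: "f (s, pi) = f (s, 0) - (2 * w s) *\<^sub>R e\<^sub>1"
    and quarter_turn: "f (s, pi / 2) = f (s, 0) - w s *\<^sub>R e\<^sub>1 + w s *\<^sub>R e\<^sub>2" if "s \<in> J" for s
    using f_rot[OF that, of pi] f_rot[OF that, of "pi / 2"] unfolding rot_def co_f[OF that]
    by (simp_all add: algebra_simps)
  have 1: "w s *\<^sub>R F e\<^sub>1 = w (- s) *\<^sub>R e\<^sub>1" if s: "s \<in> J" for s
  proof -
    have s': "- s \<in> J" using s by auto
    have "F (f (s, 0) - (2 * w s) *\<^sub>R e\<^sub>1) = f (- s, 0) - (2 * w (- s)) *\<^sub>R e\<^sub>1"
      using F_f[OF s, of pi] half_turn[OF s] half_turn[OF s'] by simp
    then have "(2 * w s) *\<^sub>R F e\<^sub>1 = (2 * w (- s)) *\<^sub>R e\<^sub>1"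
      by (simp add: linear_diff[OF lin] linear_scale[OF lin] F_f[OF s])
    then have "2 *\<^sub>R (w s *\<^sub>R F e\<^sub>1) = 2 *\<^sub>R (w (- s) *\<^sub>R e\<^sub>1)" by simp
    then show ?thesis by (simp only: scaleR_cancel_left) simp
  qed
  from 1[of 0] show e1: "F e\<^sub>1 = e\<^sub>1" using w_pos[of 0] by simp
  have "F (f (0, 0) - w 0 *\<^sub>R e\<^sub>1 + w 0 *\<^sub>R e\<^sub>2) = f (0, 0) - w 0 *\<^sub>R e\<^sub>1 + w 0 *\<^sub>R e\<^sub>2"
    using F_f[of 0 "pi / 2"] quarter_turn[of 0] by simp
  then show "F e\<^sub>2 = e\<^sub>2"
    using F_f[of 0 0] w_pos[of 0]
    by (simp add: linear_diff[OF lin] linear_add[OF lin] linear_scale[OF lin] e1)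
  show "w (- s) = w s" if "s \<in> J"
    using arg_cong[OF 1[OF that], of "\<lambda>x. B x e\<^sub>1"] e1 by (simp add: sf_inner_simps)
qed

lemma F_pd: 
  assumes "s \<in> J"
  shows "F (pd 1 f (s, 0)) = - pd 1 f (- s, 0)"
proof -
  have s': "- s \<in> J" using assms by auto
  have F: "bounded_linear F" using lin linear_conv_bounded_linear by blast
  have "((\<lambda>t. F (f (t, 0))) has_vector_derivative - pd 1 f (- s, 0)) (at s within J)"
    by (rule has_vector_derivative_transform[OF assms F_f has_vector_derivative_reflect[OF
            pd_has_vector_derivative(1)[OF smooth(1) s']]])
  moreover have "((\<lambda>t. F (f (t, 0))) has_vector_derivative F (pd 1 f (s, 0))) (at s within J)"
    by (rule bounded_linear.has_vector_derivative[OF F pd_has_vector_derivative(1)[OF smooth(1) assms]])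
  ultimately show ?thesis
    using vector_derivative_unique_within[OF at_within_Icc_neq_bot[OF assms]] by blast
qed

text \<open>The profile leaves the span of \<open>p\<close> and \<open>e\<^sub>1\<close>, since otherwise it would be fixed pointwise by the
  reflection and also reversed. A point of it outside that plane shows that \<open>e\<^sub>3\<close> is mapped to \<open>\<plusminus>e\<^sub>3\<close>, and
  the plus sign would make \<open>F\<close> the identity, which preserves orientation.\<close>

lemma F_e3: "F e\<^sub>3 = - e\<^sub>3"
proof -
  let ?z = "\<lambda>s. co3 (f (s, 0))"
  have z: "?z s *\<^sub>R F e\<^sub>3 = ?z (- s) *\<^sub>R e\<^sub>3" if s: "s \<in> J" for s
  proof -
    have s': "- s \<in> J" using s by auto
    have f: "f (t, 0) = co0 (f (t, 0)) *\<^sub>R p + w t *\<^sub>R e\<^sub>1 + ?z t *\<^sub>R e\<^sub>3" if "t \<in> J" for t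
      using expansion[of "f (t, 0)"] unfolding co_f[OF that] by simp
    have "co0 (f (- s, 0)) = co0 (f (s, 0))"
      using co0_eqI_dist[of "f (- s, 0)" "f (s, 0)"] f_in F_dist[of "f (s, 0)"] F_f[OF s, of 0] s s'
      by simp
    moreover have "F (co0 (f (s, 0)) *\<^sub>R p + w s *\<^sub>R e\<^sub>1 + ?z s *\<^sub>R e\<^sub>3)
        = co0 (f (- s, 0)) *\<^sub>R p + w (- s) *\<^sub>R e\<^sub>1 + ?z (- s) *\<^sub>R e\<^sub>3"
      using F_f[OF s, of 0] f[OF s] f[OF s'] by presburger
    ultimately show ?thesis
      using w_even[OF s] by (simp add: linear_add[OF lin] linear_scale[OF lin] F_p F_e12)
  qed
  have "\<exists>s\<in>J. ?z s \<noteq> 0"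
  proof (rule ccontr)
    assume no: "\<not> (\<exists>s\<in>J. ?z s \<noteq> 0)"
    have Ff: "F (f (s, 0)) = f (s, 0)" if "s \<in> J" for s
    proof -
      have f: "f (s, 0) = co0 (f (s, 0)) *\<^sub>R p + w s *\<^sub>R e\<^sub>1"
        using expansion[of "f (s, 0)"] no that unfolding co_f[OF that] by simp
      have "F (co0 (f (s, 0)) *\<^sub>R p + w s *\<^sub>R e\<^sub>1) = co0 (f (s, 0)) *\<^sub>R p + w s *\<^sub>R e\<^sub>1"
        by (simp add: linear_add[OF lin] linear_scale[OF lin] F_p F_e12)
      then show ?thesis unfolding f[symmetric] .
    qed
    have F: "bounded_linear F" using lin linear_conv_bounded_linear by blast
    have J0: "0 \<in> J" by simp
    note D = pd_has_vector_derivative(1)[OF smooth(1) J0, of 0]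
    have "((\<lambda>t. F (f (t, 0))) has_vector_derivative pd 1 f (0, 0)) (at 0 within J)"
      by (rule has_vector_derivative_transform[OF J0 Ff D])
    then have "F (pd 1 f (0, 0)) = pd 1 f (0, 0)"
      using vector_derivative_unique_within[OF at_within_Icc_neq_bot[OF J0]
          bounded_linear.has_vector_derivative[OF F D]] by blast
    then have "pd 1 f (0, 0) = - pd 1 f (0, 0)" using F_pd[of 0] by simp
    then have "pd 1 f (0, 0) + pd 1 f (0, 0) = 0" by (metis add.right_inverse)
    then have "2 *\<^sub>R pd 1 f (0, 0) = 0" unfolding scaleR_2 .
    then have "pd 1 f (0, 0) = 0" by (simp only: scaleR_eq_0_iff) simp
    then show False using speed[of "(0, 0)"] c_pos by (simp add: sf_inner_simps)
  qed
  then obtain s where s: "s \<in> J" "?z s \<noteq> 0" by blast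
  have s': "- s \<in> J" using s by auto
  define t where "t = ?z (- s) / ?z s"
  have Fe: "F e\<^sub>3 = t *\<^sub>R e\<^sub>3"
    using arg_cong[OF z[OF s(1)], of "\<lambda>x. (1 / ?z s) *\<^sub>R x"] s(2) by (simp add: t_def)
  have e3: "e\<^sub>3 \<noteq> 0" using inner_ee(3) by (auto simp only: sf_inner_simps zero_neq_one)
  have "?z (- s) * t = ?z s"
    using z[OF s'] e3 unfolding Fe by simp
  then have "t * t = 1" using s(2) by (simp add: t_def field_simps)
  moreover have "t \<noteq> 1"
  proof
    assume "t = 1"
    then have "F x = x" for x
    proof -
      have "F (co0 x *\<^sub>R p + co1 x *\<^sub>R e\<^sub>1 + co2 x *\<^sub>R e\<^sub>2 + co3 x *\<^sub>R e\<^sub>3)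
        = co0 x *\<^sub>R p + co1 x *\<^sub>R e\<^sub>1 + co2 x *\<^sub>R e\<^sub>2 + co3 x *\<^sub>R e\<^sub>3"
        using \<open>t = 1\<close> by (simp only: linear_add[OF lin] linear_scale[OF lin] F_p F_e12 Fe scaleR_one)
      then show ?thesis unfolding expansion[of x, symmetric] .
    qed
    then have "F = id" by auto
    then show False using det_F by (simp add: matrix_id_mat_1)
  qed
  ultimately have "t = -1"
    by (simp add: square_eq_1_iff)
  then show ?thesis using Fe by simp
qed

lemma F_isometry:
  "co0 (F x) = co0 x" "co1 (F x) = co1 x" "co2 (F x) = co2 x" "co3 (F x) = - co3 x"
  "spatial \<kappa> x \<Longrightarrow> spatial \<kappa> (F x)"
  "spatial \<kappa> x \<Longrightarrow> spatial \<kappa> y \<Longrightarrow> B (F x) (F y) = B x y"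
  "sf_quad \<kappa> (F x) (F y) = sf_quad \<kappa> x y"
  using axial_isometry[OF lin F_p, of 1 0 "-1"] F_e12 F_e3 by simp_all

text \<open>At \<open>s = 0\<close> the profile crosses the plane of reflection orthogonally, so that the normal lies in
  that plane and is fixed.\<close>

lemma \<nu>_00: "F (\<nu> (0, 0)) = \<nu> (0, 0)"
proof -
  have J0: "0 \<in> J" by simp
  let ?X = "pd 1 f (0, 0)"
  have FX: "F ?X = - ?X" using F_pd[OF J0] by simp
  have "co0 (- ?X) = co0 ?X" "co1 (- ?X) = co1 ?X" "co2 (- ?X) = co2 ?X"
    unfolding FX[symmetric] by (rule F_isometry)+
  then have co: "co0 ?X = 0" "co1 ?X = 0" "co2 ?X = 0"
    by (simp_all add: sf_inner_simps sf_quad_simps)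
  have X: "?X = co3 ?X *\<^sub>R e\<^sub>3"
    using expansion[of ?X] unfolding co(2,3) unfolding co(1) scaleR_zero_left add_0_left .
  have "?X \<noteq> 0" using speed[of "(0, 0)"] c_pos by (auto simp: sf_inner_simps)
  then have "co3 ?X \<noteq> 0" using X by auto
  moreover have "co3 ?X * B (\<nu> (0, 0)) e\<^sub>3 = 0"
    using \<nu>_props(3)[OF J0, of 0 1] X by (metis sf_inner.scaleR_right real_scaleR_def)
  ultimately have 0: "co3 (\<nu> (0, 0)) = 0"
    using spatial_co(4)[OF spatial_pd(2)[OF J0]] by simp
  have "co3 (F (\<nu> (0, 0))) = co3 (\<nu> (0, 0))"
    unfolding F_isometry(4) 0 by (rule minus_zero)
  then show ?thesis
    by (rule eqI_co[OF F_isometry(1-3)])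
qed

text \<open>Both sides are unit normals at the same point, and they agree at \<open>s = 0\<close>. This sign is what makes the
  normal speed of a symmetric family even, rather than odd.\<close>

lemma F_\<nu>:
  assumes s: "s \<in> J"
  shows "F (\<nu> (s, 0)) = \<nu> (- s, 0)"
proof -
  define D where "D s = B (F (\<nu> (s, 0))) (\<nu> (- s, 0))" for s
  have R: "F (\<nu> (s, 0)) = D s *\<^sub>R \<nu> (- s, 0) \<and> (D s)\<^sup>2 = 1" if s: "s \<in> J" for s
  proof -
    have s': "- s \<in> J" using s by auto
    interpret G: sf_frame \<kappa> "f (- s, 0)" "(1 / c) *\<^sub>R pd 1 f (- s, 0)" "\<nu> (- s, 0)" e\<^sub>2
      using surface_frame[OF s', of 0] by simp
    have "F (\<nu> (s, 0)) \<in> tangent_space \<kappa> (f (- s, 0))"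
      using \<nu>_props(1)[OF s, of 0] F_f[OF s, of 0, symmetric] F_isometry(7) by (simp add: tangent_space_def)
    moreover have "B (F (\<nu> (s, 0))) (F (pd 1 f (s, 0))) = 0"
      using F_isometry(6)[OF spatial_pd(2)[OF s] spatial_pd(1)[OF s]] \<nu>_props(3)[OF s] by simp
    then have "B (F (\<nu> (s, 0))) ((1 / c) *\<^sub>R pd 1 f (- s, 0)) = 0"
      unfolding F_pd[OF s] by (simp add: sf_inner_simps)
    moreover have "B (F (\<nu> (s, 0))) e\<^sub>2 = 0"
      using F_isometry(6)[OF spatial_pd(2)[OF s] spatial_e(2)] inner_e2(2)[OF s] F_e12 by simp
    moreover have "B (F (\<nu> (s, 0))) (F (\<nu> (s, 0))) = 1"
      using F_isometry(6)[OF spatial_pd(2)[OF s] spatial_pd(2)[OF s]] \<nu>_props(2)[OF s] by simp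
    ultimately show ?thesis
      using G.unit_normal_unique unfolding D_def by blast
  qed
  have cont: "continuous_on J (\<lambda>s. \<nu> (s, 0))"
    using has_vector_derivative_continuous[OF pd_has_vector_derivative(1)[OF smooth(2)]]
    by (auto simp: continuous_on_eq_continuous_within)
  have "continuous_on J D"
    unfolding D_def
    by (intro sf_inner.continuous_on linear_continuous_on_compose[OF cont] lin
        continuous_on_compose2[OF cont] continuous_intros) auto
  then have "D s = D 0"
    by (rule continuous_square_1_constant[of J]) (use R s in auto)
  also have "D 0 = 1"
    using \<nu>_00 \<nu>_props(2)[of 0 0] by (simp add: D_def)
  finally show ?thesis using R[OF s] by simp
qed

end

section \<open>The even kernel as a space of solutions of an ordinary differential equation\<close>

text \<open>Gronwall's argument: \<open>v\<^sup>2 + P\<^sup>2\<close> grows at most exponentially.\<close>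

lemma linear_ode_unique:
  fixes v P w Q :: "real \<Rightarrow> real"
  assumes v: "\<And>s. s \<in> {-1..1} \<Longrightarrow> (v has_real_derivative P s / w s) (at s within {-1..1})"
    and P: "\<And>s. s \<in> {-1..1} \<Longrightarrow> (P has_real_derivative - Q s * v s) (at s within {-1..1})"
    and cont: "continuous_on {-1..1} w" "continuous_on {-1..1} Q" and w: "\<And>s. s \<in> {-1..1} \<Longrightarrow> w s > 0"
    and init: "v 0 = 0" "P 0 = 0" and s: "s \<in> {0..1}"
  shows "v s = 0"
proof -
  have w0: "w s \<noteq> 0" if "s \<in> {-1..1}" for s using w[OF that] by simp
  have "continuous_on {-1..1} (\<lambda>s. 1 / w s - Q s)"
    by (intro continuous_intros cont) (use w0 in auto)
  then have "bounded ((\<lambda>s. 1 / w s - Q s) ` {-1..1})"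
    by (intro compact_imp_bounded compact_continuous_image) auto
  then obtain K where "\<forall>s\<in>{-1..1}. \<bar>1 / w s - Q s\<bar> \<le> K"
    by (auto simp: bounded_iff)
  then have K: "\<And>s. s \<in> {-1..1} \<Longrightarrow> \<bar>1 / w s - Q s\<bar> \<le> K" by blast
  \<comment> \<open>By \<open>2 |v P| \<le> v\<^sup>2 + P\<^sup>2\<close>, the logarithmic derivative of \<open>v\<^sup>2 + P\<^sup>2\<close> is at most \<open>K\<close>.\<close>
  define E where "E s = ((v s)\<^sup>2 + (P s)\<^sup>2) * exp (- K * s)" for s
  have E: "(E has_real_derivative (2 * v s * P s * (1 / w s - Q s) - K * ((v s)\<^sup>2 + (P s)\<^sup>2)) * exp (- K * s))
      (at s within {-1..1})" if "s \<in> {-1..1}" for s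
    unfolding E_def
    by (rule derivative_eq_intros v[OF that] P[OF that] refl)+ (simp add: algebra_simps power2_eq_square)
  have neg: "(2 * v s * P s * (1 / w s - Q s) - K * ((v s)\<^sup>2 + (P s)\<^sup>2)) * exp (- K * s) \<le> 0"
    if "s \<in> {-1..1}" for s
  proof -
    have 1: "\<bar>2 * v s * P s\<bar> \<le> (v s)\<^sup>2 + (P s)\<^sup>2"
      using sum_squares_bound[of "\<bar>v s\<bar>" "\<bar>P s\<bar>"] by (simp add: abs_mult)
    have "2 * v s * P s * (1 / w s - Q s) \<le> \<bar>2 * v s * P s\<bar> * \<bar>1 / w s - Q s\<bar>"
      by (metis abs_ge_self abs_mult)
    also have "\<dots> \<le> ((v s)\<^sup>2 + (P s)\<^sup>2) * K"
      by (intro mult_mono 1 K that) auto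
    finally show ?thesis
      by (intro mult_nonpos_nonneg) (auto simp: algebra_simps)
  qed
  have "E s \<le> E 0"
  proof (rule DERIV_nonpos_imp_decreasing_open[of 0 s E])
    show "0 \<le> s" using s by auto
    show "\<exists>y. (E has_real_derivative y) (at x) \<and> y \<le> 0" if "0 < x" "x < s" for x
    proof -
      have "x \<in> {-1..1}" "x \<in> interior {-1..1}" using that s by auto
      then show ?thesis
        using E[of x] neg[of x] at_within_interior[of x "{-1..1}"] by auto
    qed
    have "continuous_on {-1..1} E"
      using DERIV_continuous[OF E] by (auto simp: continuous_on_eq_continuous_within)
    then show "continuous_on {0..s} E"
      by (rule continuous_on_subset) (use s in auto)
  qed
  then have "E s \<le> 0" using init by (simp add: E_def)
  then have "(v s)\<^sup>2 + (P s)\<^sup>2 \<le> 0" by (simp add: E_def mult_le_0_iff)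
  then show ?thesis by (simp add: sum_power2_le_zero_iff)
qed

lemma has_vector_derivative_even:
  assumes even: "\<And>s. s \<in> {-1..1} \<Longrightarrow> v (- s) = v s" and s: "s \<in> {-1..1::real}"
    and v: "(v has_vector_derivative d) (at s within {-1..1})"
  shows "(v has_vector_derivative - d) (at (- s) within {-1..1})"
proof -
  have D: "((\<lambda>t. v (- t)) has_vector_derivative - d) (at (- s) within {-1..1})"
    using has_vector_derivative_reflect[of v d "- s"] v by simp
  show ?thesis
    by (rule has_vector_derivative_transform[of "- s" "{-1..1}" v "\<lambda>t. v (- t)", OF _ _ D]) (use even s in auto)
qed

lemma even_derivative_0:
  fixes v :: "real \<Rightarrow> real"
  assumes "\<And>s. s \<in> {-1..1} \<Longrightarrow> v (- s) = v s" "(v has_real_derivative d) (at 0 within {-1..1})"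
  shows "d = 0"
proof -
  have d: "(v has_vector_derivative d) (at 0 within {-1..1})"
    using assms(2) by (simp add: has_real_derivative_iff_has_vector_derivative)
  have "(v has_vector_derivative - d) (at 0 within {-1..1})"
    using has_vector_derivative_even[OF assms(1) _ d] by simp
  from vector_derivative_unique_within[OF at_within_Icc_neq_bot this d] show ?thesis by simp
qed

context rotational_minimal_annulus
begin

text \<open>With \<open>|A|\<^sup>2 = 2 k\<^sup>2\<close>, the Jacobi equation for functions of \<open>s\<close> is \<open>(w v')' = - Q v\<close>.\<close>

definition Q :: "real \<Rightarrow> real" where "Q s = 2 * c\<^sup>2 * w s * ((k s)\<^sup>2 + \<kappa>)"

lemma continuous_w: "continuous_on J w" and continuous_Q: "continuous_on J Q"
proof -
  have cont: "continuous_on J (\<lambda>s. f (s, 0))" "continuous_on J (\<lambda>s. \<nu> (s, 0))"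
    using has_vector_derivative_continuous[OF pd_has_vector_derivative(1)[OF smooth(1)]]
      has_vector_derivative_continuous[OF pd_has_vector_derivative(1)[OF smooth(2)]]
    by (auto simp: continuous_on_eq_continuous_within)
  show w: "continuous_on J w"
    unfolding w_def by (intro sf_inner.continuous_on continuous_intros cont)
  have "continuous_on J k"
    unfolding k_def
    by (intro continuous_on_divide w sf_inner.continuous_on cont continuous_intros) (use w_pos in force)
  then show "continuous_on J Q"
    unfolding Q_def by (intro continuous_intros w)
qed

lemma even_kernelD:
  assumes "u \<in> even_kernel \<kappa> R f \<nu>"
  obtains v' where "\<And>s \<theta>. s \<in> J \<Longrightarrow> u (s, \<theta>) = u (s, 0)" "\<And>s. s \<in> J \<Longrightarrow> u (- s, 0) = u (s, 0)"
    "\<And>q. q \<notin> annulus \<Longrightarrow> u q = 0"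
    "\<And>s. s \<in> J \<Longrightarrow> ((\<lambda>s. u (s, 0)) has_real_derivative v' s) (at s within J)"
    "\<And>s. s \<in> J \<Longrightarrow> ((\<lambda>s. w s * v' s) has_real_derivative - Q s * u (s, 0)) (at s within J)"
    "v' 1 / c = ct \<kappa> R * u (1, 0)"
proof -
  have sm: "smooth_on annulus u" and out: "\<And>q. q \<notin> annulus \<Longrightarrow> u q = 0"
    and eq: "\<And>q. q \<in> annulus \<Longrightarrow> laplacian \<kappa> f u q + (second_form_norm2 \<kappa> f \<nu> q + 2 * \<kappa>) * u q = 0"
    and bd: "\<And>q. q \<in> annulus_bd \<Longrightarrow> conormal_deriv \<kappa> f u q - ct \<kappa> R * u q = 0"
    and ind: "\<And>s \<theta> \<theta>'. s \<in> J \<Longrightarrow> u (s, \<theta>) = u (s, \<theta>')"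
    and even: "\<And>s \<theta>. s \<in> J \<Longrightarrow> u (- s, \<theta>) = u (s, \<theta>)"
    using assms unfolding even_kernel_def jacobi_robin_kernel_def smooth_functions_def by blast+
  obtain u' where u': "\<And>x. x \<in> annulus \<Longrightarrow> (u has_derivative u' x) (at x within annulus)"
      and smu': "\<And>v. smooth_on annulus (\<lambda>x. u' x v)"
    using smooth_on_derivative[OF sm] by blast
  define v' where "v' s = u' (s, 0) (1, 0)" for s
  have v': "((\<lambda>s. u (s, 0)) has_real_derivative v' s) (at s within J)" if "s \<in> J" for s
    using has_derivative_imp_has_vector_derivative_fst[of u "u' (s, 0)" s 0 J UNIV] u'[of "(s, 0)"] that
    by (simp add: v'_def annulus_def has_real_derivative_iff_has_vector_derivative)
  have pd1: "pd 1 u (s, 0) = v' s" if "s \<in> J" for s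
    using pd_1_eqI[OF that] v'[OF that] by (simp add: has_real_derivative_iff_has_vector_derivative)
  have Dw: "\<exists>d. (w has_real_derivative d) (at s within J)" if "s \<in> J" for s
    unfolding w_def
    using has_vector_derivative_bilinear[OF sf_inner.bounded_bilinear_axioms[of \<kappa>]
        has_vector_derivative_diff[OF pd_has_vector_derivative(1)[OF smooth(1) that] has_vector_derivative_const]
        has_vector_derivative_const] by blast
  have Dv': "\<exists>d. (v' has_real_derivative d) (at s within J)" if "s \<in> J" for s
    using pd_has_vector_derivative(1)[OF smu'[of "(1, 0)"] that, of 0] unfolding v'_def
    by (auto simp: has_real_derivative_iff_has_vector_derivative)
  have P: "((\<lambda>s. w s * v' s) has_real_derivative - Q s * u (s, 0)) (at s within J)" if s: "s \<in> J" for s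
  proof -
    obtain d1 d2 where "(w has_real_derivative d1) (at s within J)" "(v' has_real_derivative d2) (at s within J)"
      using Dw[OF s] Dv'[OF s] by blast
    from DERIV_mult[OF this] obtain d where d: "((\<lambda>s. w s * v' s) has_real_derivative d) (at s within J)"
      by blast
    have "laplacian \<kappa> f u (s, 0) = d / (c\<^sup>2 * w s)"
      by (rule laplacian_rotational[OF s _ v' d]) (use ind in auto)
    then have "d / (c\<^sup>2 * w s) + (2 * (k s)\<^sup>2 + 2 * \<kappa>) * u (s, 0) = 0"
      using eq[of "(s, 0)"] second_form_norm2_eq[OF s] s by simp
    then have "d = - Q s * u (s, 0)"
      using w_pos[OF s] c_pos by (simp add: Q_def field_simps add_eq_0_iff)
    then show ?thesis using d by simp
  qed
  have "v' 1 / c = ct \<kappa> R * u (1, 0)"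
    using bd[of "(1, 0)"] conormal_deriv_eq[of 1 u 0] pd1[of 1] by (simp add: annulus_bd_iff)
  then show thesis
    using that[of v'] ind even out v' P by blast
qed

lemma even_kernelI:
  assumes u: "smooth_on annulus u" "\<And>q. q \<notin> annulus \<Longrightarrow> u q = 0" "\<And>s \<theta>. s \<in> J \<Longrightarrow> u (s, \<theta>) = v s"
    and even: "\<And>s. s \<in> J \<Longrightarrow> v (- s) = v s"
    and v: "\<And>s. s \<in> J \<Longrightarrow> (v has_real_derivative v' s) (at s within J)"
    and P: "\<And>s. s \<in> J \<Longrightarrow> ((\<lambda>s. w s * v' s) has_real_derivative - Q s * v s) (at s within J)"
    and bd: "v' 1 / c = ct \<kappa> R * v 1"
  shows "u \<in> even_kernel \<kappa> R f \<nu>"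
proof -
  have pd1: "pd 1 u (s, \<theta>) = v' s" if "s \<in> J" for s \<theta>
  proof (rule pd_1_eqI[OF that])
    show "((\<lambda>t. u (t, \<theta>)) has_vector_derivative v' s) (at s within J)"
      by (rule has_vector_derivative_transform[where g = "\<lambda>t. u (t, \<theta>)", OF that _
            v[OF that, unfolded has_real_derivative_iff_has_vector_derivative]]) (rule u(3))
  qed
  have "(v has_vector_derivative v' 1) (at 1 within J)" "(v has_vector_derivative v' (-1)) (at (-1) within J)"
    using v[of 1] v[of "-1"] by (simp_all add: has_real_derivative_iff_has_vector_derivative)
  moreover from this(1) have "(v has_vector_derivative - v' 1) (at (-1) within J)"
    using has_vector_derivative_even[of v 1 "v' 1"] even by simp
  ultimately have "v' (-1) = - v' 1"
    using vector_derivative_unique_within[OF at_within_Icc_neq_bot[of "-1"]] by simp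
  then have "conormal_deriv \<kappa> f u (s, \<theta>) - ct \<kappa> R * u (s, \<theta>) = 0" if "s = -1 \<or> s = 1" for s \<theta>
    using that conormal_deriv_eq[OF that, of u \<theta>] pd1[of s \<theta>] u(3)[of s \<theta>] bd even[of 1] by auto
  moreover have "laplacian \<kappa> f u (s, \<theta>) + (second_form_norm2 \<kappa> f \<nu> (s, \<theta>) + 2 * \<kappa>) * u (s, \<theta>) = 0"
    if s: "s \<in> J" for s \<theta>
  proof -
    have "laplacian \<kappa> f u (s, \<theta>) = - Q s * v s / (c\<^sup>2 * w s)"
      by (rule laplacian_rotational[OF s u(3) v P[OF s]])
    also have "\<dots> = - (2 * (k s)\<^sup>2 + 2 * \<kappa>) * v s"
      using w_pos[OF s] c_pos by (simp add: Q_def field_simps)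
    finally show ?thesis
      using u(3)[OF s] second_form_norm2_eq[OF s] by (simp add: algebra_simps)
  qed
  moreover have "periodic_map u"
    using u(3) by (simp add: periodic_map_def)
  ultimately show ?thesis
    using u even
    by (auto simp: even_kernel_def jacobi_robin_kernel_def smooth_functions_def annulus_def annulus_bd_def)
qed

end

section \<open>Families of free boundary minimal annuli\<close>

lemma sn_pos: "t > 0 \<Longrightarrow> (\<kappa> = 1 \<Longrightarrow> t < pi) \<Longrightarrow> sn \<kappa> t > 0"
  by (auto simp: sn_def sin_gt_zero)

lemma ct_mult_sn: "sn \<kappa> t > 0 \<Longrightarrow> ct \<kappa> t * sn \<kappa> t = cs \<kappa> t"
  by (auto simp: ct_def sn_def cs_def cot_def split: if_splits)

locale symmetric_family = sf_frame \<kappa> p e\<^sub>1 e\<^sub>2 e\<^sub>3 for \<kappa> p e\<^sub>1 e\<^sub>2 e\<^sub>3 +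
  fixes I :: "real set" and r c :: "real \<Rightarrow> real" and \<Phi> \<nu> :: "real \<Rightarrow> real \<times> real \<Rightarrow> real^4"
    and F :: "real^4 \<Rightarrow> real^4"
  assumes family: "variable_radius_family \<kappa> p I r \<Phi> \<nu>"
    and annuli: "\<And>a. a \<in> I \<Longrightarrow> reflection_symmetric_annulus \<kappa> p e\<^sub>1 e\<^sub>2 e\<^sub>3 (\<Phi> a) (\<nu> a) (c a) F"
begin

abbreviation J :: "real set" where "J \<equiv> {-1..1}"

lemma at_within_I: 
  assumes "a \<in> I"
  shows "at a within I \<noteq> bot"
proof -
  have "I \<noteq> {b}" for b
    using family interior_singleton by (auto simp: variable_radius_family_def)
  moreover have "connected I"
    using family is_interval_connected by (auto simp: variable_radius_family_def)
  ultimately show ?thesis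
    using connected_imp_perfect[of I a] assms by (simp add: trivial_limit_within)
qed

lemma smooth_profile:
  assumes "smooth_on (I \<times> annulus) (\<lambda>(a, q). G a q)"
  shows "smooth_on (I \<times> J) (\<lambda>(a, s). G a (s, 0))"
proof -
  have L: "bounded_linear (\<lambda>x :: real \<times> real. (fst x, (snd x, 0 :: real)))"
    by (intro bounded_linear_intros)
  have "smooth_on (I \<times> J) (\<lambda>x. (\<lambda>(a, q). G a q) (0 + (fst x, (snd x, 0))))"
    by (rule smooth_on_affine[OF L assms]) (auto simp: annulus_def)
  then show ?thesis by (simp add: case_prod_unfold)
qed

lemma profile_family_exists:
  obtains \<gamma>a \<gamma>s na ns \<gamma>as \<gamma>ss \<gamma>ass where
    "profile_family \<kappa> I J c p e\<^sub>1 e\<^sub>2 (\<lambda>a s. \<Phi> a (s, 0)) (\<lambda>a s. \<nu> a (s, 0)) \<gamma>a \<gamma>s na ns \<gamma>as \<gamma>ss \<gamma>ass"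
proof -
  have sm: "smooth_on (I \<times> annulus) (\<lambda>(a, q). \<Phi> a q)" "smooth_on (I \<times> annulus) (\<lambda>(a, q). \<nu> a q)"
    using family by (auto simp: variable_radius_family_def)
  obtain \<gamma>a \<gamma>s \<gamma>as where
    "smooth_on (I \<times> J) (\<lambda>(a, s). \<gamma>a a s)" and sm_\<gamma>s: "smooth_on (I \<times> J) (\<lambda>(a, s). \<gamma>s a s)"
    and \<gamma>a: "\<And>a s. a \<in> I \<Longrightarrow> s \<in> J \<Longrightarrow> ((\<lambda>b. \<Phi> b (s, 0)) has_vector_derivative \<gamma>a a s) (at a within I)"
    and \<gamma>s: "\<And>a s. a \<in> I \<Longrightarrow> s \<in> J \<Longrightarrow> ((\<lambda>s. \<Phi> a (s, 0)) has_vector_derivative \<gamma>s a s) (at s within J)"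
    and \<gamma>as: "\<And>a s. a \<in> I \<Longrightarrow> s \<in> J \<Longrightarrow> (\<gamma>a a has_vector_derivative \<gamma>as a s) (at s within J)"
    and \<gamma>sa: "\<And>a s. a \<in> I \<Longrightarrow> s \<in> J \<Longrightarrow> ((\<lambda>b. \<gamma>s b s) has_vector_derivative \<gamma>as a s) (at a within I)"
    using smooth_on_partial_derivatives[OF smooth_profile[OF sm(1)]] by blast
  obtain \<gamma>sa' \<gamma>ss \<gamma>ass where
    "smooth_on (I \<times> J) (\<lambda>(a, s). \<gamma>sa' a s)" "smooth_on (I \<times> J) (\<lambda>(a, s). \<gamma>ss a s)"
    and \<gamma>sa': "\<And>a s. a \<in> I \<Longrightarrow> s \<in> J \<Longrightarrow> ((\<lambda>b. \<gamma>s b s) has_vector_derivative \<gamma>sa' a s) (at a within I)"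
    and \<gamma>ss: "\<And>a s. a \<in> I \<Longrightarrow> s \<in> J \<Longrightarrow> (\<gamma>s a has_vector_derivative \<gamma>ss a s) (at s within J)"
    and \<gamma>ass: "\<And>a s. a \<in> I \<Longrightarrow> s \<in> J \<Longrightarrow> (\<gamma>sa' a has_vector_derivative \<gamma>ass a s) (at s within J)"
    and \<gamma>ssa: "\<And>a s. a \<in> I \<Longrightarrow> s \<in> J \<Longrightarrow> ((\<lambda>b. \<gamma>ss b s) has_vector_derivative \<gamma>ass a s) (at a within I)"
    using smooth_on_partial_derivatives[OF sm_\<gamma>s] by blast
  have \<gamma>as': "(\<gamma>a a has_vector_derivative \<gamma>sa' a s) (at s within J)" if "a \<in> I" "s \<in> J" for a s
    using \<gamma>as[OF that] vector_derivative_unique_within[OF at_within_I[OF that(1)] \<gamma>sa[OF that] \<gamma>sa'[OF that]]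
    by simp
  obtain na ns nas where
    "smooth_on (I \<times> J) (\<lambda>(a, s). na a s)" "smooth_on (I \<times> J) (\<lambda>(a, s). ns a s)"
    and na: "\<And>a s. a \<in> I \<Longrightarrow> s \<in> J \<Longrightarrow> ((\<lambda>b. \<nu> b (s, 0)) has_vector_derivative na a s) (at a within I)"
    and ns: "\<And>a s. a \<in> I \<Longrightarrow> s \<in> J \<Longrightarrow> ((\<lambda>s. \<nu> a (s, 0)) has_vector_derivative ns a s) (at s within J)"
    and "\<And>a s. a \<in> I \<Longrightarrow> s \<in> J \<Longrightarrow> (na a has_vector_derivative nas a s) (at s within J)"
      "\<And>a s. a \<in> I \<Longrightarrow> s \<in> J \<Longrightarrow> ((\<lambda>b. ns b s) has_vector_derivative nas a s) (at a within I)"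
    using smooth_on_partial_derivatives[OF smooth_profile[OF sm(2)]] by blast
  have "profile_family \<kappa> I J c p e\<^sub>1 e\<^sub>2 (\<lambda>a s. \<Phi> a (s, 0)) (\<lambda>a s. \<nu> a (s, 0)) \<gamma>a \<gamma>s na ns \<gamma>sa' \<gamma>ss \<gamma>ass"
  proof
    fix a s assume a: "a \<in> I" and s: "s \<in> J"
    interpret R: reflection_symmetric_annulus \<kappa> p e\<^sub>1 e\<^sub>2 e\<^sub>3 "\<Phi> a" "\<nu> a" "c a" F
      by (rule annuli[OF a])
    have pd: "pd 1 (\<Phi> a) (s, 0) = \<gamma>s a s" "pd 1 (\<nu> a) (s, 0) = ns a s"
      by (rule pd_1_eqI[OF s \<gamma>s[OF a s]], rule pd_1_eqI[OF s ns[OF a s]])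
    show "\<Phi> a (s, 0) \<in> space_form \<kappa>" using R.f_in s by simp
    show "sf_inner \<kappa> (\<Phi> a (s, 0) - p) e\<^sub>2 = 0" by (rule R.f_e2[OF s])
    show "0 < sf_inner \<kappa> (\<Phi> a (s, 0) - p) e\<^sub>1" using R.w_pos[OF s] by (simp add: R.w_def)
    show "sf_inner \<kappa> (\<gamma>s a s) (\<gamma>s a s) = (c a)\<^sup>2"
      using R.speed[of "(s, 0)"] s by (simp add: pd)
    show "\<nu> a (s, 0) \<in> tangent_space \<kappa> (\<Phi> a (s, 0))" "sf_inner \<kappa> (\<nu> a (s, 0)) (\<nu> a (s, 0)) = 1"
      by (rule R.\<nu>_props[OF s])+
    show "sf_inner \<kappa> (\<nu> a (s, 0)) (\<gamma>s a s) = 0"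
      using R.\<nu>_props(3)[OF s, of 0 1] by (simp add: pd)
    show "sf_inner \<kappa> (\<nu> a (s, 0)) e\<^sub>2 = 0" by (rule R.inner_e2[OF s])
    show "sf_inner \<kappa> (ns a s) (\<gamma>s a s)
        = - (c a)\<^sup>2 * (sf_inner \<kappa> (\<nu> a (s, 0)) e\<^sub>1 / sf_inner \<kappa> (\<Phi> a (s, 0) - p) e\<^sub>1)"
      using R.minimal[OF s] by (simp add: pd R.k_def R.w_def)
  next
    fix a assume "a \<in> I"
    then show "c a > 0"
      using annuli reflection_symmetric_annulus.axioms(1) rotational_minimal_annulus.c_pos by blast
  qed (use \<kappa> at_within_I at_within_Icc_neq_bot \<gamma>a \<gamma>s na ns \<gamma>as' \<gamma>sa' \<gamma>ss \<gamma>ass \<gamma>ssa inner_pe in simp_all)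
  then show thesis by (rule that)
qed

lemma smooth_normal_speed:
  assumes a: "a \<in> I"
  shows "smooth_on annulus (normal_speed \<kappa> I \<Phi> \<nu> a)"
proof -
  have sm: "smooth_on (I \<times> annulus) (\<lambda>(a, q). \<Phi> a q)" "smooth_on (I \<times> annulus) (\<lambda>(a, q). \<nu> a q)"
    using family by (auto simp: variable_radius_family_def)
  obtain \<Phi>' where \<Phi>': "\<And>x. x \<in> I \<times> annulus \<Longrightarrow> ((\<lambda>(a, q). \<Phi> a q) has_derivative \<Phi>' x) (at x within I \<times> annulus)"
      and sm': "\<And>v. smooth_on (I \<times> annulus) (\<lambda>x. \<Phi>' x v)"
    using smooth_on_derivative[OF sm(1)] by blast
  have "smooth_on (I \<times> annulus) (\<lambda>x. sf_inner \<kappa> (\<Phi>' x (1, 0)) ((\<lambda>(a, q). \<nu> a q) x))"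
    by (rule smooth_on_bilinear[OF sf_inner.bounded_bilinear_axioms sm' sm(2)])
  moreover have "bounded_linear (\<lambda>q :: real \<times> real. (0 :: real, q))"
    by (intro bounded_linear_intros)
  ultimately have "smooth_on annulus (\<lambda>q. sf_inner \<kappa> (\<Phi>' ((a, 0) + (0, q)) (1, 0)) ((\<lambda>(a, q). \<nu> a q) ((a, 0) + (0, q))))"
    by (intro smooth_on_affine[where f = "\<lambda>x. sf_inner \<kappa> (\<Phi>' x (1, 0)) ((\<lambda>(a, q). \<nu> a q) x)"]) (use a in auto)
  then show ?thesis
  proof (rule smooth_on_cong)
    fix q assume q: "q \<in> annulus"
    have "((\<lambda>b. \<Phi> b q) has_vector_derivative \<Phi>' (a, q) (1, 0)) (at a within I)"
      using has_derivative_imp_has_vector_derivative_fst[OF \<Phi>'[of "(a, q)"] q] a q by simp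
    then show "sf_inner \<kappa> (\<Phi>' ((a, 0) + (0, q)) (1, 0)) ((\<lambda>(a, q). \<nu> a q) ((a, 0) + (0, q))) = normal_speed \<kappa> I \<Phi> \<nu> a q"
      by (simp add: normal_speed_def vector_derivative_within[OF at_within_I[OF a]])
  qed
qed

text \<open>The normal speed \<open>\<phi>\<close> spans the even solutions of the Jacobi equation; whether it satisfies the Robin
  condition is decided by \<open>r'\<close>.\<close>

lemma has_dim_even_kernel:
  assumes a: "a \<in> I"
    and nontrivial: "\<exists>q\<in>annulus. normal_speed \<kappa> I \<Phi> \<nu> a q \<noteq> 0"
    and conormal: "second_form_conormal \<kappa> (\<Phi> a) (\<nu> a) (1, 0) \<noteq> 0"
  shows "has_dim (even_kernel \<kappa> (r a) (\<Phi> a) (\<nu> a)) (if vector_derivative r (at a within I) = 0 then 1 else 0)"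
proof -
  interpret R: reflection_symmetric_annulus \<kappa> p e\<^sub>1 e\<^sub>2 e\<^sub>3 "\<Phi> a" "\<nu> a" "c a" F
    by (rule annuli[OF a])
  obtain \<gamma>a \<gamma>s na ns \<gamma>as \<gamma>ss \<gamma>ass where
    "profile_family \<kappa> I J c p e\<^sub>1 e\<^sub>2 (\<lambda>a s. \<Phi> a (s, 0)) (\<lambda>a s. \<nu> a (s, 0)) \<gamma>a \<gamma>s na ns \<gamma>as \<gamma>ss \<gamma>ass"
    by (rule profile_family_exists)
  then interpret P: profile_family \<kappa> I J c p e\<^sub>1 e\<^sub>2 "\<lambda>a s. \<Phi> a (s, 0)" "\<lambda>a s. \<nu> a (s, 0)"
    \<gamma>a \<gamma>s na ns \<gamma>as \<gamma>ss \<gamma>ass .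
  define K where "K = even_kernel \<kappa> (r a) (\<Phi> a) (\<nu> a)"
  define r' where "r' = vector_derivative r (at a within I)"
  define \<phi> where "\<phi> = P.\<phi> a"
  define \<phi>' where "\<phi>' s = P.\<psi> a s - P.k a s * P.\<tau> a s" for s
  have w: "P.w a s = R.w s" and k: "P.k a s = R.k s" for s
    by (simp_all add: P.w_def R.w_def P.k_def R.k_def)
  have D\<phi>: "(\<phi> has_real_derivative \<phi>' s) (at s within J)" if "s \<in> J" for s
    unfolding \<phi>_def \<phi>'_def by (rule P.D\<phi>[OF a that])
  have D\<phi>': "((\<lambda>s. R.w s * \<phi>' s) has_real_derivative - R.Q s * \<phi> s) (at s within J)" if "s \<in> J" for s
    using P.jacobi_equation[OF a that] unfolding w k \<phi>_def \<phi>'_def R.Q_def by (simp add: w k)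
  have \<phi>_even: "\<phi> (- s) = \<phi> s" if s: "s \<in> J" for s
  proof -
    have s': "- s \<in> J" using s by auto
    have bl: "bounded_linear F" using R.lin linear_conv_bounded_linear by blast
    have "((\<lambda>b. \<Phi> b (- s, 0)) has_vector_derivative F (\<gamma>a a s)) (at a within I)"
    proof (rule has_vector_derivative_transform[OF a _ bounded_linear.has_vector_derivative[OF bl P.D\<gamma>(1)[OF a s]]])
      fix b assume "b \<in> I"
      from reflection_symmetric_annulus.F_f[OF annuli[OF this] s] show "\<Phi> b (- s, 0) = F (\<Phi> b (s, 0))" by simp
    qed
    then have "\<gamma>a a (- s) = F (\<gamma>a a s)"
      using vector_derivative_unique_within[OF at_within_I[OF a] P.D\<gamma>(1)[OF a s']] by blast
    then show ?thesis
      using R.F_isometry(6)[OF P.spatial_first(1)[OF a s] R.spatial_pd(2)[OF s, of 0], unfolded R.F_\<nu>[OF s]]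
      by (simp add: \<phi>_def P.\<phi>_def)
  qed
  have speed: "normal_speed \<kappa> I \<Phi> \<nu> a (s, \<theta>) = \<phi> s" if s: "s \<in> J" for s \<theta>
  proof -
    have "((\<lambda>b. \<Phi> b (s, \<theta>)) has_vector_derivative rot \<theta> (\<gamma>a a s)) (at a within I)"
    proof (rule has_vector_derivative_transform[OF a _ bounded_linear.has_vector_derivative[OF
            bounded_linear_rot P.D\<gamma>(1)[OF a s]]])
      fix b assume "b \<in> I"
      then interpret Rb: reflection_symmetric_annulus \<kappa> p e\<^sub>1 e\<^sub>2 e\<^sub>3 "\<Phi> b" "\<nu> b" "c b" F
        by (rule annuli)
      show "\<Phi> b (s, \<theta>) = rot \<theta> (\<Phi> b (s, 0))" by (rule Rb.f_rot[OF s])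
    qed
    then have "normal_speed \<kappa> I \<Phi> \<nu> a (s, \<theta>) = sf_inner \<kappa> (rot \<theta> (\<gamma>a a s)) (rot \<theta> (\<nu> a (s, 0)))"
      using R.\<nu>_rot[OF s, of \<theta>]
      by (simp add: normal_speed_def vector_derivative_within[OF at_within_I[OF a]])
    then show ?thesis
      using rot_isometry(6)[OF P.spatial_first(1)[OF a s] R.spatial_pd(2)[OF s]]
      by (simp add: \<phi>_def P.\<phi>_def)
  qed
  have J1: "1 \<in> J" by simp
  have fb: "r b > 0" "\<kappa> = 1 \<Longrightarrow> r b < pi" "free_boundary_minimal \<kappa> p (r b) (\<Phi> b) (\<nu> b)" if "b \<in> I" for b
    using family that by (auto simp: variable_radius_family_def)
  have sn_r: "sn \<kappa> (r b) > 0" if "b \<in> I" for b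
    using fb[OF that] sn_pos by blast
  have radial: "sn \<kappa> (r b) *\<^sub>R \<gamma>s b 1 = c b *\<^sub>R (cs \<kappa> (r b) *\<^sub>R \<Phi> b (1, 0) - p)" if b: "b \<in> I" for b
  proof -
    interpret Rb: reflection_symmetric_annulus \<kappa> p e\<^sub>1 e\<^sub>2 e\<^sub>3 "\<Phi> b" "\<nu> b" "c b" F
      by (rule annuli[OF b])
    have bd: "(1, 0) \<in> annulus_bd" by (simp add: Rb.annulus_bd_iff)
    have "sf_dist \<kappa> p (\<Phi> b (1, 0)) = r b"
      using fb(3)[OF b] bd by (auto simp: free_boundary_minimal_def geo_sphere_def)
    moreover have "conormal_deriv \<kappa> (\<Phi> b) (\<Phi> b) (1, 0) = radial_field \<kappa> p (\<Phi> b (1, 0))"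
      using fb(3)[OF b] bd by (auto simp: free_boundary_minimal_def)
    moreover have "pd 1 (\<Phi> b) (1, 0) = \<gamma>s b 1"
      by (rule pd_1_eqI[OF J1 P.D\<gamma>(2)[OF b J1]])
    ultimately have "(1 / c b) *\<^sub>R \<gamma>s b 1 = (1 / sn \<kappa> (r b)) *\<^sub>R (cs \<kappa> (r b) *\<^sub>R \<Phi> b (1, 0) - p)"
      using Rb.conormal_deriv_eq[of 1 "\<Phi> b" 0] by (simp add: radial_field_def Let_def)
    from arg_cong[OF this, of "\<lambda>x. (c b * sn \<kappa> (r b)) *\<^sub>R x"] show ?thesis
      using sn_r[OF b] Rb.c_pos by (simp del: scaleR_right_diff_distrib)
  qed
  have "smooth_on I r" using family by (auto simp: variable_radius_family_def)
  then obtain D where "\<And>x. x \<in> I \<Longrightarrow> (r has_derivative D x) (at x within I)" "\<And>v. smooth_on I (\<lambda>x. D x v)"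
    using smooth_on_derivative by blast
  then have "r differentiable (at a within I)"
    using a differentiableI by blast
  then have Dr: "(r has_real_derivative r') (at a within I)"
    unfolding r'_def has_real_derivative_iff_has_vector_derivative by (simp add: vector_derivative_works)
  note bv = P.boundary_variation[OF a J1 Dr sn_r radial]
  have ca: "c a > 0" by (rule R.c_pos)
  \<comment> \<open>The Robin condition fails for \<open>\<phi>\<close> exactly by \<open>r' A(\<eta>, \<eta>)\<close>, as \<open>A(\<eta>, \<eta>) = - k\<close>.\<close>
  have robin: "\<phi>' 1 / c a - ct \<kappa> (r a) * \<phi> 1 = - R.k 1 * r'"
  proof -
    have "sn \<kappa> (r a) * P.\<psi> a 1 = sn \<kappa> (r a) * (c a * (ct \<kappa> (r a) * \<phi> 1))"
      using bv(2) ct_mult_sn[OF sn_r[OF a], symmetric] by (auto simp: \<phi>_def)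
    then have "P.\<psi> a 1 = c a * (ct \<kappa> (r a) * \<phi> 1)"
      using sn_r[OF a] by simp
    then show ?thesis
      using ca bv(1) by (simp add: \<phi>'_def k field_simps)
  qed
  have k1: "R.k 1 \<noteq> 0"
    using conormal R.second_form_conormal_eq[of 1 0] by simp
  \<comment> \<open>An even solution has vanishing derivative at \<open>0\<close>, so that it is determined by its value there. Hence
    the even solutions form a line, spanned by \<open>\<phi>\<close>.\<close>
  have unique: "v s = 0"
    if v: "\<And>s. s \<in> J \<Longrightarrow> (v has_real_derivative v' s) (at s within J)"
      and P: "\<And>s. s \<in> J \<Longrightarrow> ((\<lambda>s. R.w s * v' s) has_real_derivative - R.Q s * v s) (at s within J)"
      and even: "\<And>s. s \<in> J \<Longrightarrow> v (- s) = v s" and v0: "v 0 = 0" and s: "s \<in> J"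
    for v v' s
  proof -
    have v'0: "v' 0 = 0"
      using even_derivative_0[OF even v[of 0]] by simp
    have z: "v t = 0" if "t \<in> {0..1}" for t
    proof (rule linear_ode_unique[where v = v and s = t and P = "\<lambda>s. R.w s * v' s" and w = R.w and Q = R.Q])
      show "(v has_real_derivative R.w s * v' s / R.w s) (at s within J)" if "s \<in> J" for s
        using v[OF that] R.w_pos[OF that] by simp
    qed (use P R.continuous_w R.continuous_Q R.w_pos v0 v'0 that in auto)
    show ?thesis
    proof (cases "s \<ge> 0")
      case False
      then have "v (- s) = 0" using s by (intro z) auto
      then show ?thesis using even[OF s] by simp
    qed (use s z in auto)
  qed
  have \<phi>0: "\<phi> 0 \<noteq> 0"
  proof
    assume "\<phi> 0 = 0"
    then have "\<phi> s = 0" if "s \<in> J" for s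
      using unique[OF D\<phi> D\<phi>' \<phi>_even] that by blast
    then show False
      using nontrivial speed by (auto simp: annulus_def)
  qed
  \<comment> \<open>Elements of the kernel vanish outside the annulus by convention.\<close>
  define U where "U q = (if q \<in> annulus then normal_speed \<kappa> I \<Phi> \<nu> a q else 0)" for q
  have U: "U (s, \<theta>) = \<phi> s" if "s \<in> J" for s \<theta>
    using that speed by (simp add: U_def)
  have mult: "\<exists>l. u = l *\<^sub>R U \<and> l * (R.k 1 * r') = 0" if u: "u \<in> K" for u
  proof -
    obtain v' where ind: "\<And>s \<theta>. s \<in> J \<Longrightarrow> u (s, \<theta>) = u (s, 0)" and even: "\<And>s. s \<in> J \<Longrightarrow> u (- s, 0) = u (s, 0)"
      and out: "\<And>q. q \<notin> annulus \<Longrightarrow> u q = 0"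
      and Dv: "\<And>s. s \<in> J \<Longrightarrow> ((\<lambda>s. u (s, 0)) has_real_derivative v' s) (at s within J)"
      and Dv': "\<And>s. s \<in> J \<Longrightarrow> ((\<lambda>s. R.w s * v' s) has_real_derivative - R.Q s * u (s, 0)) (at s within J)"
      and bd: "v' 1 / c a = ct \<kappa> (r a) * u (1, 0)"
      using R.even_kernelD[OF u[unfolded K_def]] by blast
    define l where "l = u (0, 0) / \<phi> 0"
    have D1: "((\<lambda>s. u (s, 0) - l * \<phi> s) has_real_derivative v' s - l * \<phi>' s) (at s within J)" if "s \<in> J" for s
      by (intro DERIV_diff DERIV_cmult Dv D\<phi> that)
    have D2: "((\<lambda>s. R.w s * (v' s - l * \<phi>' s)) has_real_derivative - R.Q s * (u (s, 0) - l * \<phi> s)) (at s within J)"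
      if "s \<in> J" for s
    proof -
      have "((\<lambda>s. R.w s * v' s - l * (R.w s * \<phi>' s)) has_real_derivative
          - R.Q s * u (s, 0) - l * (- R.Q s * \<phi> s)) (at s within J)"
        by (intro DERIV_diff DERIV_cmult Dv' D\<phi>' that)
      then show ?thesis by (simp add: algebra_simps)
    qed
    have eq: "u (s, 0) - l * \<phi> s = 0" if "s \<in> J" for s
      by (rule unique[OF D1 D2]) (use even \<phi>_even \<phi>0 that in \<open>auto simp: l_def\<close>)
    have "u = l *\<^sub>R U"
    proof
      fix q :: "real \<times> real"
      obtain s \<theta> where q: "q = (s, \<theta>)" by fastforce
      show "u q = (l *\<^sub>R U) q"
      proof (cases "s \<in> J")
        case True
        then show ?thesis using ind[of s \<theta>] eq[of s] U[of s \<theta>] by (simp add: q scaleR_fun_def)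
      next
        case False
        then have "q \<notin> annulus" by (simp add: q)
        then show ?thesis using out by (simp add: U_def scaleR_fun_def)
      qed
    qed
    moreover have "v' 1 - l * \<phi>' 1 = 0"
      by (rule has_vector_derivative_eq_0[OF D1[OF J1, unfolded has_real_derivative_iff_has_vector_derivative]
            eq J1 at_within_Icc_neq_bot[OF J1]])
    then have "l * (\<phi>' 1 / c a - ct \<kappa> (r a) * \<phi> 1) = v' 1 / c a - ct \<kappa> (r a) * u (1, 0)"
      using eq[OF J1] by (simp add: algebra_simps)
    then have "l * (R.k 1 * r') = 0"
      using bd robin by simp
    ultimately show ?thesis by blast
  qed
  show ?thesis
  proof (cases "r' = 0")
    case True
    have "U \<in> K"
      unfolding K_def
    proof (rule R.even_kernelI[OF _ _ U \<phi>_even D\<phi> D\<phi>'])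
      show "smooth_on annulus U"
        by (rule smooth_on_cong[OF smooth_normal_speed[OF a]]) (simp add: U_def)
      show "\<phi>' 1 / c a = ct \<kappa> (r a) * \<phi> 1" using robin True by simp
    qed (simp_all add: U_def)
    have "U \<noteq> 0" using U[of 0 0] \<phi>0 by auto
    have sub: "K \<subseteq> span {U}"
      using mult span_base[of U "{U}"] span_scale by blast
    have "dim K = 1"
      using dim_unique[of "{U}" K 1] \<open>U \<in> K\<close> sub \<open>U \<noteq> 0\<close> by simp
    then show ?thesis
      using sub True unfolding has_dim_def K_def r'_def by (auto intro!: exI[of _ "{U}"])
  next
    case False
    have sub: "K \<subseteq> span {}"
    proof
      fix u assume "u \<in> K"
      then obtain l where "u = l *\<^sub>R U" "l * (R.k 1 * r') = 0" using mult by blast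
      then show "u \<in> span {}" using False k1 by simp
    qed
    then have "dim K = 0"
      using dim_le_card[of K "{}"] by simp
    then show ?thesis
      using sub False unfolding has_dim_def K_def r'_def by (auto intro!: exI[of _ "{}"])
  qed
qed

end

theorem theorem4p6:
  fixes \<kappa> :: real and p\<^sub>0 :: "real^4" and I :: "real set" and r :: "real \<Rightarrow> real"
    and \<Phi> \<nu> :: "real \<Rightarrow> real \<times> real \<Rightarrow> real^4"
  assumes "\<kappa> \<in> {-1, 0, 1}"
    and "p\<^sub>0 \<in> space_form \<kappa>"
    and "variable_radius_family \<kappa> p\<^sub>0 I r \<Phi> \<nu>"
    and "rotational \<kappa> p\<^sub>0 I \<Phi>"
    and "reflection_symmetric \<kappa> p\<^sub>0 I \<Phi>"
    and "\<forall>a\<in>I. \<exists>p\<in>annulus. normal_speed \<kappa> I \<Phi> \<nu> a p \<noteq> 0"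
    and "\<forall>a\<in>I. \<forall>p\<in>annulus_bd. second_form_conormal \<kappa> (\<Phi> a) (\<nu> a) p \<noteq> 0"
  shows "(\<forall>a\<in>I. has_dim (even_kernel \<kappa> (r a) (\<Phi> a) (\<nu> a))
            (if vector_derivative r (at a within I) = 0 then 1 else 0)) \<and>
         (\<forall>a\<in>I. real (dim (even_kernel \<kappa> (r a) (\<Phi> a) (\<nu> a))) =
            indicat_real {b \<in> I. vector_derivative r (at b within I) = 0} a)"
proof -
  obtain e\<^sub>1 e\<^sub>2 e\<^sub>3 where frame: "orthonormal_frame \<kappa> p\<^sub>0 e\<^sub>1 e\<^sub>2 e\<^sub>3"
    and rotation: "\<forall>a\<in>I. \<forall>s\<in>{-1..1}. \<forall>\<theta> t. \<Phi> a (s, \<theta> + t) = rotation \<kappa> p\<^sub>0 e\<^sub>1 e\<^sub>2 t (\<Phi> a (s, \<theta>))"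
    and half_plane: "\<forall>a\<in>I. \<forall>s\<in>{-1..1}. sf_inner \<kappa> (\<Phi> a (s, 0) - p\<^sub>0) e\<^sub>2 = 0 \<and> sf_inner \<kappa> (\<Phi> a (s, 0) - p\<^sub>0) e\<^sub>1 \<ge> 0"
    and arclength: "\<forall>a\<in>I. \<exists>c>0. \<forall>p\<in>annulus. sf_inner \<kappa> (pd 1 (\<Phi> a) p) (pd 1 (\<Phi> a) p) = c\<^sup>2"
    using assms(4) unfolding rotational_def by blast
  from bchoice[OF arclength] obtain c where c: "\<And>a. a \<in> I \<Longrightarrow> c a > 0"
      "\<And>a p. a \<in> I \<Longrightarrow> p \<in> annulus \<Longrightarrow> sf_inner \<kappa> (pd 1 (\<Phi> a) p) (pd 1 (\<Phi> a) p) = (c a)\<^sup>2"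
    by blast
  obtain \<sigma> F where \<sigma>: "\<sigma> p\<^sub>0 = p\<^sub>0"
      "\<And>x y. x \<in> space_form \<kappa> \<Longrightarrow> y \<in> space_form \<kappa> \<Longrightarrow> sf_dist \<kappa> (\<sigma> x) (\<sigma> y) = sf_dist \<kappa> x y"
      "\<And>a s \<theta>. a \<in> I \<Longrightarrow> s \<in> {-1..1} \<Longrightarrow> \<sigma> (\<Phi> a (s, \<theta>)) = \<Phi> a (-s, \<theta>)"
    and F: "linear F" "det (matrix F) < 0" "\<And>x. x \<in> space_form \<kappa> \<Longrightarrow> F x = \<sigma> x"
    using assms(5) unfolding reflection_symmetric_def orientation_reversing_isometry_def by blast
  have fb: "free_boundary_minimal \<kappa> p\<^sub>0 (r a) (\<Phi> a) (\<nu> a)" if "a \<in> I" for a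
    using assms(3) that by (simp add: variable_radius_family_def)
  have \<Phi>_in: "\<Phi> a q \<in> space_form \<kappa>" if "a \<in> I" "q \<in> annulus" for a q
    using fb[OF that(1)] that(2) by (auto simp: free_boundary_minimal_def geo_ball_def)
  interpret symmetric_family \<kappa> p\<^sub>0 e\<^sub>1 e\<^sub>2 e\<^sub>3 I r c \<Phi> \<nu> F
  proof (intro symmetric_family.intro sf_frame.intro symmetric_family_axioms.intro)
    show "\<kappa> \<in> {-1, 0, 1}" "p\<^sub>0 \<in> space_form \<kappa>" "orthonormal_frame \<kappa> p\<^sub>0 e\<^sub>1 e\<^sub>2 e\<^sub>3"
      "variable_radius_family \<kappa> p\<^sub>0 I r \<Phi> \<nu>"
      by (fact assms frame)+
    fix a assume a: "a \<in> I"
    show "reflection_symmetric_annulus \<kappa> p\<^sub>0 e\<^sub>1 e\<^sub>2 e\<^sub>3 (\<Phi> a) (\<nu> a) (c a) F"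
    proof (intro reflection_symmetric_annulus.intro rotational_minimal_annulus.intro sf_frame.intro
        rotational_minimal_annulus_axioms.intro reflection_symmetric_annulus_axioms.intro)
      show "\<kappa> \<in> {-1, 0, 1}" "p\<^sub>0 \<in> space_form \<kappa>" "orthonormal_frame \<kappa> p\<^sub>0 e\<^sub>1 e\<^sub>2 e\<^sub>3" "linear F" "det (matrix F) < 0"
        by (fact assms frame F)+
      show "immersion (\<Phi> a)" "unit_normal \<kappa> (\<Phi> a) (\<nu> a)" 
        using fb[OF a] by (simp_all add: free_boundary_minimal_def)
      show "mean_curvature \<kappa> (\<Phi> a) (\<nu> a) q = 0" if "q \<in> annulus" for q
        using fb[OF a] that by (simp add: free_boundary_minimal_def)
      show "F p\<^sub>0 = p\<^sub>0" using F(3) \<sigma>(1) assms(2) by simp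
      show "sf_dist \<kappa> p\<^sub>0 (F x) = sf_dist \<kappa> p\<^sub>0 x" if "x \<in> space_form \<kappa>" for x
        using \<sigma>(2)[OF assms(2) that] \<sigma>(1) F(3)[OF that] by simp
      show "F (\<Phi> a (s, \<theta>)) = \<Phi> a (- s, \<theta>)" if "s \<in> {-1..1}" for s \<theta>
        using F(3)[OF \<Phi>_in[OF a, of "(s, \<theta>)"]] \<sigma>(3)[OF a that] that by (simp add: annulus_def)
    qed (use a \<Phi>_in rotation half_plane c in simp_all)
  qed
  have dims: "has_dim (even_kernel \<kappa> (r a) (\<Phi> a) (\<nu> a)) (if vector_derivative r (at a within I) = 0 then 1 else 0)"
    if "a \<in> I" for a
    using has_dim_even_kernel[OF that] assms(6,7) that by (simp add: annulus_bd_def)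
  moreover have "real (dim (even_kernel \<kappa> (r a) (\<Phi> a) (\<nu> a))) =
      indicat_real {b \<in> I. vector_derivative r (at b within I) = 0} a" if "a \<in> I" for a
    using dims[OF that] that by (simp add: has_dim_def indicator_def split: if_splits)
  ultimately show ?thesis by blast
qed

end
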